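(* Let $\Omega\subset\mathbb{R}^3$ be a bounded domain with a conforming tetrahedral grid $\mathcal{T}$, let $k\ge1$, and let $p\ge1$ be a real number. Then $$V_{h,k}^{\mathrm{sym\,Curl}}\subset H(\operatorname{sym}\operatorname{Curl})\subset H(\operatorname{dev}\operatorname{sym}\operatorname{Curl}).$$
   Context: For $A\in\mathbb{R}^{3\times3}$: $\operatorname{sym}A:=\frac12(A+A^T)$, $\operatorname{dev}A:=A-\frac13(\operatorname{trace}A)I$. $\operatorname{Curl}$ is the classical $\operatorname{curl}$ applied row-wise (distributionally). $H(\operatorname{sym}\operatorname{Curl}):=\{P\in L^p(\Omega;\mathbb{R}^{3\times3}):\operatorname{sym}\operatorname{Curl}P\in L^p(\Omega;\mathbb{R}^{3\times3})\}$ and $H(\operatorname{dev}\operatorname{sym}\operatorname{Curl}):=\{P\in L^p(\Omega;\mathbb{R}^{3\times3}):\operatorname{dev}\operatorname{sym}\operatorname{Curl}P\in L^p(\Omega;\mathbb{R}^{3\times3})\}$. A conforming tetrahedral grid $\mathcal{T}$ of $\Omega$ is a finite set of non-degenerate closed tetrahedra such that $\Omega$ is the interior of their union and any two distinct tetrahedra intersect in the empty set, a common vertex, a common edge or a common face. $\Pi_k(T;\mathbb{R}^{3\times3})$ is the space of $\mathbb{R}^{3\times3}$-valued polynomials of (total) degree $k$ or less on $T$. Lagrange points on $T$ are the points with barycentric coordinates in $\frac1k\mathbb{Z}_{\ge 0}$ with respect to $T$; inner Lagrange points of an edge or face are those in its relative interior. Once and for all for the entire grid the following are fixed: for each face a unit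 normal $\mathbf{n}$ and two vectors $\mathbf{a}_1,\mathbf{a}_2$ such that $\mathbf{a}_1,\mathbf{a}_2,\mathbf{n}$ are linearly independent; for each edge $E$ a unit tangent $\mathbf{t}_E$ and two unit vectors $\mathbf{n}_{E,1},\mathbf{n}_{E,2}$ spanning the plane orthogonal to $E$. For a face with normal $\mathbf{n}$ containing the edge $E$, set $\boldsymbol{\partial}:=\mathbf{t}_E\times\mathbf{n}$. $V_{h,k}^{\mathrm{sym\,Curl}}$ is the set of all $U_h\in L^2(\Omega;\mathbb{R}^{3\times3})$ with $U_h|_T\in\Pi_k(T;\mathbb{R}^{3\times3})$ for all $T\in\mathcal{T}$ such that, writing $U$ for the polynomial $U_h|_T$ evaluated at points of the closed tetrahedron $T$, the following quantities coincide for the elements concerned: - for every vertex $V$, the quantities $U(V)_{ij}$ ($i\ne j$), $U(V)_{11}-U(V)_{22}$ and $U(V)_{22}-U(V)_{33}$ coincide for all elements that share $V$; - for every edge $E$ and every inner Lagrange point $L$ of $E$, the quantities $\mathbf{n}_{E,1}^TU(L)\mathbf{t}_E$ and $\mathbf{n}_{E,2}^TU(L)\mathbf{t}_E$ coincide for all elements that share $E$; and for every face with normal $\mathbf{n}$ containing $E$, the quantities $\mathbf{t}_E^TU(L)(\mathbf{n}\times\mathbf{t}_E)$, $\mathbf{n}^TU(L)(\mathbf{n}\times\mathbf{t}_E)$ and $\mathbf{t}_E^TU(L)(\mathbf{n}\times\boldsymbol{\partial})+\boldsymbol{\partial}^TU(L)(\mathbf{n}\times\mathbf{t}_E)$ coincide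 for the elements having that face; - for every face $F$ with associated vectors $\mathbf{n},\mathbf{a}_1,\mathbf{a}_2$ and every inner Lagrange point $L$ of $F$, the quantities $\mathbf{a}_1^TU(L)(\mathbf{n}\times\mathbf{a}_1)$, $\mathbf{a}_2^TU(L)(\mathbf{n}\times\mathbf{a}_2)$, $\mathbf{a}_1^TU(L)(\mathbf{n}\times\mathbf{a}_2)+\mathbf{a}_2^TU(L)(\mathbf{n}\times\mathbf{a}_1)$, $\mathbf{n}^TU(L)(\mathbf{n}\times\mathbf{a}_1)$ and $\mathbf{n}^TU(L)(\mathbf{n}\times\mathbf{a}_2)$ coincide for the elements that share $F$. (All other local degrees of freedom are unconstrained across elements.) *)

theory Defs
  imports "HOL-Analysis.Analysis"
begin

definition sym_part :: "real^3^3 \<Rightarrow> real^3^3" where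
  "sym_part A = (1/2) *\<^sub>R (A + transpose A)"

definition dev_part :: "real^3^3 \<Rightarrow> real^3^3" where
  "dev_part A = A - (1/3 * trace A) *\<^sub>R mat 1"

definition pderivative :: "3 \<Rightarrow> (real^3 \<Rightarrow> real) \<Rightarrow> real^3 \<Rightarrow> real" where
  "pderivative j \<phi> x = frechet_derivative \<phi> (at x) (axis j 1)"

primrec C_times :: "nat \<Rightarrow> (real^3 \<Rightarrow> real) \<Rightarrow> bool" where
  "C_times 0 \<phi> \<longleftrightarrow> continuous_on UNIV \<phi>"
| "C_times (Suc m) \<phi> \<longleftrightarrow> (\<forall>x. \<phi> differentiable (at x)) \<and> (\<forall>j. C_times m (pderivative j \<phi>))"

definition test_functions :: "(real^3) set \<Rightarrow> (real^3 \<Rightarrow> real) set" where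
  "test_functions \<Omega> = {\<phi>. (\<forall>m. C_times m \<phi>) \<and>
     compact (closure {x. \<phi> x \<noteq> 0}) \<and> closure {x. \<phi> x \<noteq> 0} \<subseteq> \<Omega>}"

text \<open>
  A vector- or matrix-valued distribution is represented by its action on scalar test
  functions; it is only ever applied to elements of \<^const>\<open>test_functions\<close>.
\<close>

definition regular_distr :: "(real^3) set \<Rightarrow> (real^3 \<Rightarrow> real^3^3) \<Rightarrow> (real^3 \<Rightarrow> real) \<Rightarrow> real^3^3" where
  "regular_distr \<Omega> P \<phi> = (LINT x:\<Omega>|lebesgue. \<phi> x *\<^sub>R P x)"

definition distr_pderivative ::
  "3 \<Rightarrow> ((real^3 \<Rightarrow> real) \<Rightarrow> real^3) \<Rightarrow> (real^3 \<Rightarrow> real) \<Rightarrow> real^3" where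
  "distr_pderivative j S \<phi> = - S (pderivative j \<phi>)"

definition distr_curl :: "((real^3 \<Rightarrow> real) \<Rightarrow> real^3) \<Rightarrow> (real^3 \<Rightarrow> real) \<Rightarrow> real^3" where
  "distr_curl S \<phi> = vector
     [distr_pderivative 2 S \<phi> $ 3 - distr_pderivative 3 S \<phi> $ 2,
      distr_pderivative 3 S \<phi> $ 1 - distr_pderivative 1 S \<phi> $ 3,
      distr_pderivative 1 S \<phi> $ 2 - distr_pderivative 2 S \<phi> $ 1]"

definition distr_Curl :: "((real^3 \<Rightarrow> real) \<Rightarrow> real^3^3) \<Rightarrow> (real^3 \<Rightarrow> real) \<Rightarrow> real^3^3" where
  "distr_Curl S \<phi> = (\<chi> i. distr_curl (\<lambda>\<psi>. S \<psi> $ i) \<phi>)"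

text \<open>
  All spaces consist of functions rather than of classes modulo null sets. Membership is
  invariant under changes on null sets and under changes outside \<open>\<Omega>\<close>.
\<close>

definition Lp :: "(real^3) set \<Rightarrow> real \<Rightarrow> (real^3 \<Rightarrow> real^3^3) set" where
  "Lp \<Omega> p = {P. set_borel_measurable lebesgue \<Omega> P \<and>
                 set_integrable lebesgue \<Omega> (\<lambda>x. norm (P x) powr p)}"

definition H_symCurl :: "(real^3) set \<Rightarrow> real \<Rightarrow> (real^3 \<Rightarrow> real^3^3) set" where
  "H_symCurl \<Omega> p = {P \<in> Lp \<Omega> p. \<exists>Q\<in>Lp \<Omega> p. \<forall>\<phi>\<in>test_functions \<Omega>.
     sym_part (distr_Curl (regular_distr \<Omega> P) \<phi>) = regular_distr \<Omega> Q \<phi>}"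

definition H_devsymCurl :: "(real^3) set \<Rightarrow> real \<Rightarrow> (real^3 \<Rightarrow> real^3^3) set" where
  "H_devsymCurl \<Omega> p = {P \<in> Lp \<Omega> p. \<exists>Q\<in>Lp \<Omega> p. \<forall>\<phi>\<in>test_functions \<Omega>.
     dev_part (sym_part (distr_Curl (regular_distr \<Omega> P) \<phi>)) = regular_distr \<Omega> Q \<phi>}"

text \<open>
  \<^const>\<open>triangulation\<close> demands that \<open>T \<inter> T'\<close> is a face of both \<open>T\<close> and \<open>T'\<close> in the sense of
  \<^const>\<open>face_of\<close>. For distinct tetrahedra this face cannot be all of \<open>T\<close>, so it is empty,
  a vertex, an edge or a (two-dimensional) face.
\<close>

definition conforming_grid :: "(real^3) set \<Rightarrow> (real^3) set set \<Rightarrow> bool" where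
  "conforming_grid \<Omega> \<T> \<longleftrightarrow>
     triangulation \<T> \<and> (\<forall>T\<in>\<T>. 3 simplex T) \<and> \<Omega> = interior (\<Union>\<T>)"

record grid_vectors =
  face_normal  :: "(real^3) set \<Rightarrow> real^3"
  face_vec1    :: "(real^3) set \<Rightarrow> real^3"
  face_vec2    :: "(real^3) set \<Rightarrow> real^3"
  edge_tangent :: "(real^3) set \<Rightarrow> real^3"
  edge_normal1 :: "(real^3) set \<Rightarrow> real^3"
  edge_normal2 :: "(real^3) set \<Rightarrow> real^3"

text \<open>
  \<^const>\<open>independent\<close> is a predicate on sets, so linear independence of a family also needs
  \<^const>\<open>distinct\<close>.
\<close>

definition admissible_vectors :: "(real^3) set set \<Rightarrow> grid_vectors \<Rightarrow> bool" where
  "admissible_vectors \<T> D \<longleftrightarrow>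
     (\<forall>T\<in>\<T>. \<forall>F. F facet_of T \<longrightarrow>
        (let n = face_normal D F; a\<^sub>1 = face_vec1 D F; a\<^sub>2 = face_vec2 D F in
           norm n = 1 \<and> (\<forall>x\<in>F. \<forall>y\<in>F. n \<bullet> (x - y) = 0) \<and>
           distinct [a\<^sub>1, a\<^sub>2, n] \<and> independent {a\<^sub>1, a\<^sub>2, n})) \<and>
     (\<forall>T\<in>\<T>. \<forall>E. E edge_of T \<longrightarrow>
        (let t = edge_tangent D E; n\<^sub>1 = edge_normal1 D E; n\<^sub>2 = edge_normal2 D E in
           norm t = 1 \<and> t \<in> span {x - y |x y. x \<in> E \<and> y \<in> E} \<and>
           norm n\<^sub>1 = 1 \<and> norm n\<^sub>2 = 1 \<and>
           span {n\<^sub>1, n\<^sub>2} = {v. \<forall>x\<in>E. \<forall>y\<in>E. v \<bullet> (x - y) = 0}))"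

definition lagrange_points :: "nat \<Rightarrow> (real^3) set \<Rightarrow> (real^3) set" where
  "lagrange_points k T =
     {\<Sum>v | v extreme_point_of T. (real (m v) / real k) *\<^sub>R v |m :: real^3 \<Rightarrow> nat.
        (\<Sum>v | v extreme_point_of T. real (m v) / real k) = 1}"

definition multi_indices :: "nat \<Rightarrow> (nat^3) set" where
  "multi_indices k = {\<alpha>. (\<Sum>i\<in>UNIV. \<alpha> $ i) \<le> k}"

lemma finite_multi_indices: "finite (multi_indices k)"
proof (rule finite_subset)
  have "\<alpha> $ i \<le> k" if "\<alpha> \<in> multi_indices k" for \<alpha> i
    using that member_le_sum[of i UNIV "\<lambda>i. \<alpha> $ i"] by (auto simp: multi_indices_def)
  then have "(\<lambda>\<alpha>. ($) \<alpha>) ` multi_indices k \<subseteq> UNIV \<rightarrow>\<^sub>E {..k}"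
    by (auto simp: PiE_def)
  then show "multi_indices k \<subseteq> vec_lambda ` (UNIV \<rightarrow>\<^sub>E {..k})"
    by (metis (no_types, lifting) image_iff image_subset_iff subsetI vec_lambda_eta)
  show "finite (vec_lambda ` (UNIV \<rightarrow>\<^sub>E {..k}) :: (nat^3) set)"
    by (intro finite_imageI finite_PiE) auto
qed

definition matrix_polynomials :: "nat \<Rightarrow> (real^3 \<Rightarrow> real^3^3) set" where
  "matrix_polynomials k =
     {f. \<exists>c. \<forall>x. f x = (\<Sum>\<alpha>\<in>multi_indices k. (\<Prod>i\<in>UNIV. (x $ i) ^ (\<alpha> $ i)) *\<^sub>R c \<alpha>)}"

abbreviation sandwich :: "real^3 \<Rightarrow> real^3^3 \<Rightarrow> real^3 \<Rightarrow> real" where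
  "sandwich a A b \<equiv> a \<bullet> (A *v b)"

text \<open>In the following, \<open>W T\<close> is the polynomial associated with the tetrahedron \<open>T\<close>.\<close>

definition vertex_conditions ::
  "(real^3) set set \<Rightarrow> ((real^3) set \<Rightarrow> real^3 \<Rightarrow> real^3^3) \<Rightarrow> bool" where
  "vertex_conditions \<T> W \<longleftrightarrow>
     (\<forall>V. let sharing = {T\<in>\<T>. V extreme_point_of T} in
        (\<forall>i j. i \<noteq> j \<longrightarrow> (\<lambda>T. W T V $ i $ j) constant_on sharing) \<and>
        (\<lambda>T. W T V $ 1 $ 1 - W T V $ 2 $ 2) constant_on sharing \<and>
        (\<lambda>T. W T V $ 2 $ 2 - W T V $ 3 $ 3) constant_on sharing)"

definition edge_conditions ::
  "(real^3) set set \<Rightarrow> grid_vectors \<Rightarrow> nat \<Rightarrow> ((real^3) set \<Rightarrow> real^3 \<Rightarrow> real^3^3) \<Rightarrow> bool" where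
  "edge_conditions \<T> D k W \<longleftrightarrow>
     (\<forall>T\<^sub>0\<in>\<T>. \<forall>E. E edge_of T\<^sub>0 \<longrightarrow> (\<forall>L \<in> lagrange_points k T\<^sub>0 \<inter> rel_interior E.
        let t = edge_tangent D E; sharing = {T\<in>\<T>. E edge_of T} in
          (\<lambda>T. sandwich (edge_normal1 D E) (W T L) t) constant_on sharing \<and>
          (\<lambda>T. sandwich (edge_normal2 D E) (W T L) t) constant_on sharing \<and>
          (\<forall>F. E edge_of F \<longrightarrow>
             (let n = face_normal D F; d = cross3 t n; having = {T\<in>\<T>. F facet_of T} in
                (\<lambda>T. sandwich t (W T L) (cross3 n t)) constant_on having \<and>
                (\<lambda>T. sandwich n (W T L) (cross3 n t)) constant_on having \<and>
                (\<lambda>T. sandwich t (W T L) (cross3 n d) + sandwich d (W T L) (cross3 n t))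
                   constant_on having))))"

definition face_conditions ::
  "(real^3) set set \<Rightarrow> grid_vectors \<Rightarrow> nat \<Rightarrow> ((real^3) set \<Rightarrow> real^3 \<Rightarrow> real^3^3) \<Rightarrow> bool" where
  "face_conditions \<T> D k W \<longleftrightarrow>
     (\<forall>T\<^sub>0\<in>\<T>. \<forall>F. F facet_of T\<^sub>0 \<longrightarrow> (\<forall>L \<in> lagrange_points k T\<^sub>0 \<inter> rel_interior F.
        let n = face_normal D F; a\<^sub>1 = face_vec1 D F; a\<^sub>2 = face_vec2 D F;
            sharing = {T\<in>\<T>. F facet_of T} in
          (\<lambda>T. sandwich a\<^sub>1 (W T L) (cross3 n a\<^sub>1)) constant_on sharing \<and>
          (\<lambda>T. sandwich a\<^sub>2 (W T L) (cross3 n a\<^sub>2)) constant_on sharing \<and>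
          (\<lambda>T. sandwich a\<^sub>1 (W T L) (cross3 n a\<^sub>2) + sandwich a\<^sub>2 (W T L) (cross3 n a\<^sub>1))
             constant_on sharing \<and>
          (\<lambda>T. sandwich n (W T L) (cross3 n a\<^sub>1)) constant_on sharing \<and>
          (\<lambda>T. sandwich n (W T L) (cross3 n a\<^sub>2)) constant_on sharing))"

definition V_symCurl ::
  "(real^3) set \<Rightarrow> (real^3) set set \<Rightarrow> grid_vectors \<Rightarrow> nat \<Rightarrow> (real^3 \<Rightarrow> real^3^3) set" where
  "V_symCurl \<Omega> \<T> D k = {U \<in> Lp \<Omega> 2. \<exists>W.
     (\<forall>T\<in>\<T>. W T \<in> matrix_polynomials k \<and>
             (AE x in lebesgue. x \<in> T \<inter> \<Omega> \<longrightarrow> U x = W T x)) \<and>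
     vertex_conditions \<T> W \<and> edge_conditions \<T> D k W \<and> face_conditions \<T> D k W}"

end

theory Submission
  imports Defs
begin

text \<open>
The second inclusion holds because \<^const>\<open>dev_part\<close> is linear: if \<open>Q\<close> represents
\<open>sym Curl P\<close>, then \<open>dev Q\<close> represents \<open>dev sym Curl P\<close>. The weight is in the first inclusion. For a
piecewise polynomial field \<open>U\<close>, integration by parts on each tetrahedron represents the distribution
\<open>sym Curl U\<close> by the piecewise symmetric curl plus a surface distribution on the interior facets, whose
density is the symmetric part of the row-wise product of the jump of \<open>U\<close> with the normal. This density
is encoded by the symmetric bilinear form \<open>jump_form J n\<close> of the jump \<open>J\<close>, and the claim is that it
vanishes.

It vanishes at every Lagrange point of a shared facet. At a vertex the jump is a multiple of the
identity, whose product with \<open>n\<close> is skew. At an inner point of an edge or of the facet, the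
conditions say that the form vanishes on the pairs from a basis, \<open>{t, t \<times> n, n}\<close> or
\<open>{a\<^sub>1, a\<^sub>2, n}\<close> (\<open>jump_lagrange_point\<close>). The form is a polynomial of degree at most \<open>k\<close> in the
point, and the Lagrange points of a triangle are unisolvent for such polynomials
(\<open>triangle_lagrange_unisolvent\<close>). So it vanishes on the whole facet (\<open>jump_facet\<close>).

The integration by parts uses no surface integrals. The indicator function of a tetrahedron \<open>T\<close> with
barycentric coordinates \<open>\<lambda>\<^sub>v\<close> is approximated by the \<open>C\<^sup>1\<close> function \<open>b / (b + \<epsilon>)\<close>, where \<open>b\<close> is the
product of the squares of the positive parts of the \<open>\<lambda>\<^sub>v\<close>. Its gradient is a sum over the facets of
the normal \<open>\<nabla>\<lambda>\<^sub>w\<close> times a density \<open>layer\<close> concentrated near the facet \<open>\<lambda>\<^sub>w = 0\<close>. Two facts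
replace the calculus of traces. A \<open>C\<^sup>1\<close> function that vanishes on the facet is at most a multiple of
\<open>\<lambda>\<^sub>w\<close> in absolute value on \<open>T\<close>, and then its integral against the layer tends to \<open>0\<close> by dominated
convergence (\<open>integral_layer_tendsto_0\<close>). And if \<open>T\<close> and \<open>T'\<close> share a facet, the affine map that fixes the
facet and sends the apex of \<open>T'\<close> to that of \<open>T\<close> carries one layer to the other, with a Jacobian
that turns the gradient of the apex coordinate of \<open>T\<close> into minus that of \<open>T'\<close> (\<open>reflected_layers_cancel\<close>). So only the jump of the normal
component matters. A facet that meets \<open>\<Omega>\<close> belongs to exactly two tetrahedra, and on all
other facets the test function vanishes. This gives \<open>piecewise_divergence\<close>, which is applied to test
functions times the fields \<open>flux\<close>, whose normal component is the jump form.
\<close>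

section \<open>Barycentric coordinates of a tetrahedron\<close>

definition tetra_vertices :: "(real^3) set \<Rightarrow> bool" where
  "tetra_vertices C \<longleftrightarrow> finite C \<and> card C = 4 \<and> \<not> affine_dependent C"

text \<open>
The gradient of the affine function that is \<open>1\<close> at \<open>v\<close> and \<open>0\<close> at the other points of \<open>C\<close>.
\<close>

definition bary_grad :: "(real^3) set \<Rightarrow> real^3 \<Rightarrow> real^3" where
  "bary_grad C v = (SOME G. \<forall>w\<in>C - {v}. G \<bullet> (w - v) = - 1)"

definition bary :: "(real^3) set \<Rightarrow> real^3 \<Rightarrow> real^3 \<Rightarrow> real" where
  "bary C v x = 1 + bary_grad C v \<bullet> (x - v)"

lemma tetra_vertices_difference_basis:
  assumes "tetra_vertices C" "v \<in> C"
  shows "independent ((\<lambda>w. w - v) ` (C - {v}))" "card ((\<lambda>w. w - v) ` (C - {v})) = 3"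
    "span ((\<lambda>w. w - v) ` (C - {v})) = UNIV"
proof -
  show ind: "independent ((\<lambda>w. w - v) ` (C - {v}))"
    using assms affine_dependent_iff_dependent2[of v C] by (simp add: tetra_vertices_def)
  show card: "card ((\<lambda>w. w - v) ` (C - {v})) = 3"
    using assms by (subst card_image) (auto simp: tetra_vertices_def inj_on_def)
  show "span ((\<lambda>w. w - v) ` (C - {v})) = UNIV"
    using card_ge_dim_independent[OF _ ind, of UNIV] card by (auto simp: dim_UNIV)
qed

text \<open>
The differences of four affinely independent points span the space, so a linear functional that is
constant on the points is zero. All identities between barycentric coordinates reduce to this.
\<close>

lemma affine_function_determined:
  fixes g :: "real^3"
  assumes "tetra_vertices C" "\<And>w. w \<in> C \<Longrightarrow> g \<bullet> w = \<gamma>"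
  shows "g = 0"
proof -
  obtain v where v: "v \<in> C"
    using assms(1) unfolding tetra_vertices_def by fastforce
  have "g \<bullet> y = 0" if "y \<in> (\<lambda>w. w - v) ` (C - {v})" for y
    using that assms(2) v by (auto simp: inner_diff_right)
  then have "g \<bullet> y = 0" for y
    using orthogonal_to_span[of y "(\<lambda>w. w - v) ` (C - {v})" g] 
      tetra_vertices_difference_basis(3)[OF assms(1) v]
    by (auto simp: orthogonal_def)
  then show ?thesis
    using inner_eq_zero_iff by blast
qed

lemma bary_grad_diff:
  assumes "tetra_vertices C" "v \<in> C" "w \<in> C - {v}"
  shows "bary_grad C v \<bullet> (w - v) = - 1"
proof -
  obtain g :: "real^3 \<Rightarrow> real" where "linear g"
    and g: "\<forall>y\<in>(\<lambda>w. w - v) ` (C - {v}). g y = - 1"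
    using linear_independent_extend[OF tetra_vertices_difference_basis(1)[OF assms(1,2)],
        of "\<lambda>_. - 1"] by blast
  define G where "G = adjoint g 1"
  have "G \<bullet> y = g y" for y
    using adjoint_works[OF \<open>linear g\<close>, of y 1] by (simp add: G_def inner_commute)
  then have "\<forall>w\<in>C - {v}. G \<bullet> (w - v) = - 1"
    using g by auto
  then have "\<forall>w\<in>C - {v}. bary_grad C v \<bullet> (w - v) = - 1"
    unfolding bary_grad_def by (rule someI)
  then show ?thesis
    using assms(3) by blast
qed

lemma bary_vertex:
  assumes "tetra_vertices C" "v \<in> C" "w \<in> C"
  shows "bary C v w = (if w = v then 1 else 0)"
  using bary_grad_diff[OF assms(1,2), of w] assms(3) by (auto simp: bary_def)

lemma bary_diff: "bary C v x - bary C v y = bary_grad C v \<bullet> (x - y)"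
  by (simp add: bary_def inner_diff_right)

text \<open>
Both sides are affine in \<open>x\<close> and agree on \<open>C\<close>.
\<close>

lemma affine_interpolation:
  assumes "tetra_vertices C"
  shows "g \<bullet> x + \<gamma> = (\<Sum>v\<in>C. bary C v x * (g \<bullet> v + \<gamma>))"
proof -
  have fin: "finite C" and "C \<noteq> {}"
    using assms by (auto simp: tetra_vertices_def)
  define h where "h = g - (\<Sum>v\<in>C. (g \<bullet> v + \<gamma>) *\<^sub>R bary_grad C v)"
  define r where "r = (\<Sum>v\<in>C. (1 - bary_grad C v \<bullet> v) * (g \<bullet> v + \<gamma>)) - \<gamma>"
  have eq: "g \<bullet> x + \<gamma> - (\<Sum>v\<in>C. bary C v x * (g \<bullet> v + \<gamma>)) = h \<bullet> x - r" for x
    by (simp add: h_def r_def bary_def inner_diff_left inner_diff_right inner_sum_left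
        algebra_simps sum.distrib sum_subtractf)
  have "h \<bullet> w = r" if w: "w \<in> C" for w
  proof -
    have "(\<Sum>v\<in>C. bary C v w * (g \<bullet> v + \<gamma>)) = (\<Sum>v\<in>C. if w = v then g \<bullet> v + \<gamma> else 0)"
      by (intro sum.cong) (auto simp: bary_vertex[OF assms _ w])
    then show ?thesis
      using eq[of w] w fin by simp
  qed
  then have "h = 0" and "r = 0"
    using affine_function_determined[OF assms, of h r] \<open>C \<noteq> {}\<close> by auto
  then show ?thesis
    using eq[of x] by simp
qed

lemma sum_bary: "tetra_vertices C \<Longrightarrow> (\<Sum>v\<in>C. bary C v x) = 1"
  using affine_interpolation[of C 0 x 1] by simp

lemma sum_bary_vertices:
  assumes "tetra_vertices C"
  shows "(\<Sum>v\<in>C. bary C v x *\<^sub>R v) = x"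
proof -
  have "\<forall>g. g \<bullet> (\<Sum>v\<in>C. bary C v x *\<^sub>R v) = g \<bullet> x"
    using affine_interpolation[OF assms, of _ x 0] by (simp add: inner_sum_right)
  then show ?thesis
    by (rule vector_eq_ldot[THEN iffD1])
qed

lemma bary_affine_combination:
  assumes "sum u S = 1"
  shows "bary C v (\<Sum>w\<in>S. u w *\<^sub>R w) = (\<Sum>w\<in>S. u w * bary C v w)"
proof -
  have "(\<Sum>w\<in>S. u w * bary C v w) = (\<Sum>w\<in>S. u w * (bary_grad C v \<bullet> w)) + sum u S * (1 - bary_grad C v \<bullet> v)"
    by (simp add: bary_def inner_diff_right algebra_simps sum.distrib sum_subtractf flip: sum_distrib_left sum_distrib_right)
  then show ?thesis
    using assms by (simp add: bary_def inner_diff_right inner_sum_right)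
qed

lemma bary_combination:
  assumes "tetra_vertices C" "S \<subseteq> C" "v \<in> C" "sum u S = 1"
  shows "bary C v (\<Sum>w\<in>S. u w *\<^sub>R w) = (if v \<in> S then u v else 0)"
proof -
  have "finite S"
    using assms(1,2) finite_subset[of S C] by (auto simp: tetra_vertices_def)
  have "(\<Sum>w\<in>S. u w * bary C v w) = (\<Sum>w\<in>S. if w = v then u w else 0)"
    using assms by (intro sum.cong) (auto simp: bary_vertex)
  then show ?thesis
    using bary_affine_combination[OF assms(4), of C v] \<open>finite S\<close> by simp
qed

lemma convex_hull_iff_bary:
  assumes "tetra_vertices C" "S \<subseteq> C"
  shows "x \<in> convex hull S \<longleftrightarrow> (\<forall>v\<in>C. 0 \<le> bary C v x) \<and> (\<forall>v\<in>C - S. bary C v x = 0)"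
proof
  have fin: "finite C" "finite S"
    using assms finite_subset[of S C] by (auto simp: tetra_vertices_def)
  { assume "x \<in> convex hull S"
    then obtain u where u: "\<forall>w\<in>S. 0 \<le> u w" "sum u S = 1" "x = (\<Sum>w\<in>S. u w *\<^sub>R w)"
      using fin by (auto simp: convex_hull_finite)
    show "(\<forall>v\<in>C. 0 \<le> bary C v x) \<and> (\<forall>v\<in>C - S. bary C v x = 0)"
      unfolding u(3) using bary_combination[OF assms _ u(2)] u(1) by auto }
  assume R: "(\<forall>v\<in>C. 0 \<le> bary C v x) \<and> (\<forall>v\<in>C - S. bary C v x = 0)"
  have "(\<Sum>v\<in>S. bary C v x) = 1" "(\<Sum>v\<in>S. bary C v x *\<^sub>R v) = x"
    using R fin assms sum_bary[OF assms(1), of x] sum_bary_vertices[OF assms(1), of x]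
      sum.mono_neutral_right[of C S "\<lambda>v. bary C v x"] 
      sum.mono_neutral_right[of C S "\<lambda>v. bary C v x *\<^sub>R v"]
    by auto
  then show "x \<in> convex hull S"
    using R assms(2) fin by (auto simp: convex_hull_finite intro!: exI[of _ "\<lambda>v. bary C v x"])
qed

lemma tetra_iff_bary:
  "tetra_vertices C \<Longrightarrow> x \<in> convex hull C \<longleftrightarrow> (\<forall>v\<in>C. 0 \<le> bary C v x)"
  using convex_hull_iff_bary[of C C x] by auto

lemma facet_iff_bary:
  assumes "tetra_vertices C" "w \<in> C"
  shows "x \<in> convex hull (C - {w}) \<longleftrightarrow> x \<in> convex hull C \<and> bary C w x = 0"
  using convex_hull_iff_bary[OF assms(1), of "C - {w}" x] convex_hull_iff_bary[OF assms(1), of C x] assms(2)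
  by (auto simp: Ball_def)

lemma continuous_bary [continuous_intros]: "continuous_on S (bary C v)"
  unfolding bary_def by (intro continuous_intros)

lemma interior_tetra:
  assumes "tetra_vertices C" "\<forall>v\<in>C. 0 < bary C v x"
  shows "x \<in> interior (convex hull C)"
proof -
  have fin: "finite C"
    using assms by (auto simp: tetra_vertices_def)
  have "{x. \<forall>v\<in>C. 0 < bary C v x} = (\<Inter>v\<in>C. {x. 0 < bary C v x})"
    by auto
  moreover have "open \<dots>"
    using fin by (intro open_INT) (auto intro!: open_Collect_less continuous_intros)
  ultimately have "open {x. \<forall>v\<in>C. 0 < bary C v x}"
    by simp
  moreover have "{x. \<forall>v\<in>C. 0 < bary C v x} \<subseteq> convex hull C"
    using tetra_iff_bary[OF assms(1)] by (auto intro: less_imp_le)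
  ultimately show ?thesis
    using assms(2) interiorI by blast
qed

lemma bary_grad_nonzero:
  assumes "tetra_vertices C" "v \<in> C"
  shows "bary_grad C v \<noteq> 0"
proof -
  have "card (C - {v}) = 3"
    using assms by (simp add: tetra_vertices_def)
  then obtain w where "w \<in> C - {v}"
    by (metis card.empty ex_in_conv zero_neq_numeral)
  then show ?thesis
    using bary_grad_diff[OF assms] by fastforce
qed

lemma bary_level_negligible:
  assumes "tetra_vertices C" "v \<in> C"
  shows "negligible {x. bary C v x = 0}"
proof -
  have "{x. bary C v x = 0} = {x. bary_grad C v \<bullet> x = bary_grad C v \<bullet> v - 1}"
    by (auto simp: bary_def inner_diff_right)
  then show ?thesis
    using negligible_hyperplane[of "bary_grad C v"] bary_grad_nonzero[OF assms] by simp
qed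

definition normal_to :: "(real^3) set \<Rightarrow> real^3 \<Rightarrow> bool" where
  "normal_to F \<nu> \<longleftrightarrow> (\<forall>x\<in>F. \<forall>y\<in>F. \<nu> \<bullet> (x - y) = 0)"

lemma bary_grad_normal:
  assumes "tetra_vertices C" "w \<in> C"
  shows "normal_to (convex hull (C - {w})) (bary_grad C w)"
  unfolding normal_to_def by (simp add: facet_iff_bary[OF assms] flip: bary_diff)

text \<open>
The normals of a facet form a line, spanned by the gradient of the barycentric coordinate of the
opposite vertex. The factor is found by testing with the edge from \<open>a\<close> to \<open>w\<close>.
\<close>

lemma facet_normal_multiple:
  assumes "tetra_vertices C" "w \<in> C"
    and "normal_to (convex hull (C - {w})) \<nu>" and "a \<in> C - {w}"
  shows "\<nu> = (\<nu> \<bullet> (w - a)) *\<^sub>R bary_grad C w"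
proof -
  define g where "g = \<nu> - (\<nu> \<bullet> (w - a)) *\<^sub>R bary_grad C w"
  have wa: "bary_grad C w \<bullet> (w - a) = 1"
    using bary_grad_diff[OF assms(1,2,4)] by (simp add: inner_diff_right)
  have "g \<bullet> (v - a) = 0" if "v \<in> C" for v
  proof (cases "v = w")
    case True
    then show ?thesis
      using wa by (simp add: g_def inner_diff_left)
  next
    case False
    then have "\<nu> \<bullet> (v - a) = 0"
      using assms(3,4) that by (simp add: normal_to_def hull_inc)
    moreover have "bary_grad C w \<bullet> (v - a) = 0"
      using bary_grad_diff[OF assms(1,2,4)] bary_grad_diff[OF assms(1,2), of v] that False
      by (simp add: inner_diff_right)
    ultimately show ?thesis
      by (simp add: g_def inner_diff_left)
  qed
  then have "\<And>v. v \<in> C \<Longrightarrow> g \<bullet> v = g \<bullet> a"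
    by (simp add: inner_diff_right)
  then have "g = 0"
    using affine_function_determined[OF assms(1)] by blast
  then show ?thesis
    by (simp add: g_def)
qed

section \<open>Continuously differentiable functions\<close>

text \<open>
The derivative is kept as an explicit witness \<open>f'\<close>, with continuity required for each direction
separately. Divergences and integrals can then be written in terms of \<open>f'\<close> itself.
\<close>

definition has_C1_derivative ::
    "(real^3 \<Rightarrow> 'b::real_normed_vector) \<Rightarrow> (real^3 \<Rightarrow> real^3 \<Rightarrow> 'b) \<Rightarrow> bool" where
  "has_C1_derivative f f' \<longleftrightarrow>
     (\<forall>x. (f has_derivative f' x) (at x)) \<and> (\<forall>v. continuous_on UNIV (\<lambda>x. f' x v))"

lemma has_C1_derivativeD:
  assumes "has_C1_derivative f f'"
  shows "(f has_derivative f' x) (at x within S)" "continuous_on S (\<lambda>x. f' x v)"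
    "continuous_on S f"
proof -
  show *: "(f has_derivative f' x) (at x within S)" for x S
    using assms has_derivative_at_withinI unfolding has_C1_derivative_def by blast
  show "continuous_on S (\<lambda>x. f' x v)"
    using assms by (auto simp: has_C1_derivative_def intro: continuous_on_subset)
  show "continuous_on S f"
    using has_derivative_continuous_on[of S f f'] * by blast
qed

lemma has_C1_derivative_mult:
  fixes f g :: "real^3 \<Rightarrow> real"
  assumes "has_C1_derivative f f'" "has_C1_derivative g g'"
  shows "has_C1_derivative (\<lambda>x. f x * g x) (\<lambda>x v. f x * g' x v + f' x v * g x)"
  unfolding has_C1_derivative_def
  by (intro conjI allI has_derivative_mult continuous_intros has_C1_derivativeD[OF assms(1)]
      has_C1_derivativeD[OF assms(2)])

lemma integrable_compact_support:
  fixes f :: "'a::euclidean_space \<Rightarrow> real"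
  assumes "continuous_on UNIV f" "compact K" "\<And>x. x \<notin> K \<Longrightarrow> f x = 0"
  shows "integrable lborel f"
proof -
  have "integrable lborel (\<lambda>x. indicator K x *\<^sub>R f x)"
    by (intro borel_integrable_compact assms(2) continuous_on_subset[OF assms(1)]) auto
  moreover have "(\<lambda>x. indicator K x *\<^sub>R f x) = f"
    using assms(3) by (auto simp: indicator_def fun_eq_iff)
  ultimately show ?thesis
    by simp
qed

lemma mean_value_line:
  fixes f :: "real^3 \<Rightarrow> real"
  assumes "\<And>x. (f has_derivative f' x) (at x)"
  shows "\<exists>t\<in>{0..1}. f (x + v) - f x = f' (x + t *\<^sub>R v) v"
proof -
  have "((\<lambda>t. f (x + t *\<^sub>R v)) has_derivative (\<lambda>s. f' (x + t *\<^sub>R v) (s *\<^sub>R v))) (at t within {0..1})" for t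
    by (rule has_derivative_compose[OF _ assms]) (auto intro!: derivative_eq_intros)
  then have "\<exists>t\<in>{0..1}. f (x + 1 *\<^sub>R v) - f (x + 0 *\<^sub>R v) = f' (x + t *\<^sub>R v) ((1 - 0) *\<^sub>R v)"
    by (intro mvt_very_simple) auto
  then show ?thesis
    by auto
qed

lemma directional_difference_quotient:
  fixes f :: "real^3 \<Rightarrow> real"
  assumes "(f has_derivative D) (at x)"
  shows "(\<lambda>n. (f (x + (1 / real (Suc n)) *\<^sub>R v) - f x) / (1 / real (Suc n))) \<longlonglongrightarrow> D v"
proof -
  interpret bounded_linear D
    using assms has_derivative_bounded_linear by blast
  have "((\<lambda>s. f (x + s *\<^sub>R v)) has_derivative (\<lambda>s. D (s *\<^sub>R v))) (at 0)"
    by (rule has_derivative_compose[where g = f and g' = D]) (auto intro!: derivative_eq_intros assms)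
  then have "((\<lambda>s. f (x + s *\<^sub>R v)) has_field_derivative D v) (at 0)"
    by (simp add: has_field_derivative_def scaleR mult.commute[of _ "D v"])
  then have "((\<lambda>s. (f (x + s *\<^sub>R v) - f x) / s) \<longlongrightarrow> D v) (at 0)"
    by (simp add: has_field_derivative_iff)
  moreover have "filterlim (\<lambda>n. 1 / real (Suc n)) (at 0) sequentially"
    unfolding filterlim_at using lim_inverse_n' LIMSEQ_Suc[OF lim_inverse_n'] by auto
  ultimately show ?thesis
    by (rule filterlim_compose)
qed

text \<open>
The integral of each difference quotient is zero by translation invariance. The difference quotients
are bounded by the supremum of the derivative and live in one compact set, so dominated convergence
applies.
\<close>

lemma integral_derivative_compact_support:
  fixes f :: "real^3 \<Rightarrow> real"
  assumes f: "has_C1_derivative f f'" and K: "compact K" "\<And>x. x \<notin> K \<Longrightarrow> f x = 0"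
  shows "(\<integral>x. f' x v \<partial>lborel) = 0"
proof -
  note D = has_C1_derivativeD[OF f]
  define d where "d n x = (f (x + (1 / real (Suc n)) *\<^sub>R v) - f x) / (1 / real (Suc n))" for n x
  define K1 where "K1 = (\<lambda>(x, t). x + t *\<^sub>R (- v)) ` (K \<times> {0..1})"
  have K1: "compact K1"
    unfolding K1_def
    by (intro compact_continuous_image compact_Times K compact_Icc)
       (auto simp: split_beta intro!: continuous_intros)
  have f'0: "f' x v = 0" if "x \<notin> K" for x
  proof -
    have "open (- K)"
      using K(1) compact_imp_closed by auto
    have "((\<lambda>x. 0 :: real) has_derivative f' x) (at x)"
      by (rule has_derivative_transform_within_open[OF D(1) \<open>open (- K)\<close>]) (use that K in auto)
    then have "f' x = (\<lambda>_. 0)"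
      using has_derivative_unique[OF _ has_derivative_const] by blast
    then show ?thesis
      by simp
  qed
  have "bounded ((\<lambda>x. f' x v) ` K)"
    by (intro compact_imp_bounded compact_continuous_image K D)
  then obtain M where M: "\<bar>f' x v\<bar> \<le> M" if "x \<in> K" for x
    unfolding bounded_iff by auto
  have M': "\<bar>f' x v\<bar> \<le> max 0 M" for x
    using M[of x] f'0[of x] by (cases "x \<in> K") auto
  have lin: "linear (f' x)" for x
    using D(1)[of x UNIV] has_derivative_linear by blast
  have bound: "\<bar>d n x\<bar> \<le> max 0 M" for n x
  proof -
    define h where "h = 1 / real (Suc n)"
    obtain t where "f (x + h *\<^sub>R v) - f x = f' (x + t *\<^sub>R h *\<^sub>R v) (h *\<^sub>R v)"
      using mean_value_line[OF D(1)] by blast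
    then have "d n x = f' (x + t *\<^sub>R h *\<^sub>R v) v"
      by (simp add: d_def h_def linear_scale[OF lin])
    then show ?thesis
      using M' by simp
  qed
  have supp: "d n x = 0" if "x \<notin> K1 \<union> K" for n x
  proof -
    have "x + (1 / real (Suc n)) *\<^sub>R v \<notin> K"
    proof
      assume "x + (1 / real (Suc n)) *\<^sub>R v \<in> K"
      then have "(x + (1 / real (Suc n)) *\<^sub>R v) + (1 / real (Suc n)) *\<^sub>R (- v) \<in> K1"
        unfolding K1_def by (intro image_eqI[of _ _ "(x + (1 / real (Suc n)) *\<^sub>R v, 1 / real (Suc n))"]) auto
      then show False
        using that by simp
    qed
    then show ?thesis
      using that K by (simp add: d_def)
  qed
  have fint: "integrable lborel f"
    by (rule integrable_compact_support[OF D(3) K])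
  have shift: "integrable lborel (\<lambda>x. f (x + c))" "(\<integral>x. f (x + c) \<partial>lborel) = (\<integral>x. f x \<partial>lborel)" for c
  proof -
    have "f \<in> borel_measurable borel"
      using D(3)[of UNIV] by (rule borel_measurable_continuous_onI)
    then show "integrable lborel (\<lambda>x. f (x + c))" "(\<integral>x. f (x + c) \<partial>lborel) = (\<integral>x. f x \<partial>lborel)"
      using fint integral_distr[of "(+) c" lborel borel f] integrable_distr_eq[of "(+) c" lborel borel f]
      by (simp_all add: lborel_distr_plus add.commute)
  qed
  have "(\<integral>x. d n x \<partial>lborel) = 0" for n
    unfolding d_def using fint shift by simp
  moreover have "(\<lambda>n. \<integral>x. d n x \<partial>lborel) \<longlonglongrightarrow> (\<integral>x. f' x v \<partial>lborel)"
  proof (rule integral_dominated_convergence[where w = "\<lambda>x. max 0 M * indicator (K1 \<union> K) x"])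
    show "(\<lambda>x. f' x v) \<in> borel_measurable lborel"
      using borel_measurable_continuous_onI[OF D(2)[of UNIV]] by simp
    have "continuous_on UNIV (d n)" for n
      unfolding d_def by (intro continuous_intros continuous_on_compose2[OF D(3)[of UNIV]]) auto
    then show "d n \<in> borel_measurable lborel" for n
      using borel_measurable_continuous_onI by auto
    have "emeasure lborel (K1 \<union> K) < \<infinity>"
      using K1 K(1) by (intro emeasure_bounded_finite) (auto intro: compact_imp_bounded)
    then show "integrable lborel (\<lambda>x. max 0 M * indicator (K1 \<union> K) x)"
      using K1 K by (intro integrable_mult_right) (auto simp: integrable_indicator_iff
          intro: compact_imp_closed borel_closed)
    show "AE x in lborel. (\<lambda>n. d n x) \<longlonglongrightarrow> f' x v"
      unfolding d_def using directional_difference_quotient[OF D(1)] by simp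
    show "AE x in lborel. norm (d n x) \<le> max 0 M * indicator (K1 \<union> K) x" for n
      using bound supp by (auto simp: indicator_def)
  qed
  ultimately show ?thesis
    by (simp add: LIMSEQ_const_iff)
qed

text \<open>
The squared positive part agrees with its tangent line up to \<open>(y - s)\<^sup>2\<close>. This quadratic bound also
covers the point \<open>s = 0\<close>, where the two branches meet.
\<close>

lemma DERIV_max_zero_square: "((\<lambda>s::real. (max 0 s)\<^sup>2) has_field_derivative 2 * max 0 s) (at s)"
proof -
  have bound: "norm (((max 0 y)\<^sup>2 - (max 0 s)\<^sup>2) / (y - s) - 2 * max 0 s) \<le> norm (y - s)" if "y \<noteq> s" for y :: real
  proof -
    have "\<bar>(max 0 y)\<^sup>2 - (max 0 s)\<^sup>2 - 2 * max 0 s * (y - s)\<bar> \<le> (y - s)\<^sup>2"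
    proof (cases "0 \<le> s"; cases "0 \<le> y")
      assume "0 \<le> s" "\<not> 0 \<le> y"
      then have "s * y \<le> 0" "0 \<le> s * s" "0 \<le> y * y"
        by (auto simp: mult_nonneg_nonpos)
      moreover have "(max 0 y)\<^sup>2 - (max 0 s)\<^sup>2 - 2 * max 0 s * (y - s) = s * s - 2 * (s * y)"
        "(y - s)\<^sup>2 = y * y - 2 * (s * y) + s * s"
        using \<open>0 \<le> s\<close> \<open>\<not> 0 \<le> y\<close> by (simp_all add: max_def power2_eq_square algebra_simps)
      ultimately show ?thesis
        by linarith
    next
      assume "\<not> 0 \<le> s" "0 \<le> y"
      then have "s * y \<le> 0" "0 \<le> s * s"
        by (auto simp: mult_nonpos_nonneg zero_le_mult_iff)
      moreover have "(max 0 y)\<^sup>2 - (max 0 s)\<^sup>2 - 2 * max 0 s * (y - s) = y * y"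
        "(y - s)\<^sup>2 = y * y - 2 * (s * y) + s * s"
        using \<open>0 \<le> y\<close> \<open>\<not> 0 \<le> s\<close> by (simp_all add: max_def power2_eq_square algebra_simps)
      moreover have "0 \<le> y * y"
        by simp
      ultimately show ?thesis
        by linarith
    next
      assume "0 \<le> s" "0 \<le> y"
      then have "(max 0 y)\<^sup>2 - (max 0 s)\<^sup>2 - 2 * max 0 s * (y - s) = (y - s)\<^sup>2"
        by (simp add: max_def power2_eq_square algebra_simps)
      then show ?thesis
        by simp
    qed (auto simp: max_def)
    then have "\<bar>(max 0 y)\<^sup>2 - (max 0 s)\<^sup>2 - 2 * max 0 s * (y - s)\<bar> / \<bar>y - s\<bar> \<le> (y - s)\<^sup>2 / \<bar>y - s\<bar>"
      by (intro divide_right_mono) auto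
    also have "(y - s)\<^sup>2 / \<bar>y - s\<bar> = \<bar>y - s\<bar>"
      using that by (subst nonzero_divide_eq_eq) (auto simp: power2_eq_square)
    also have "\<bar>(max 0 y)\<^sup>2 - (max 0 s)\<^sup>2 - 2 * max 0 s * (y - s)\<bar> / \<bar>y - s\<bar> =
        norm (((max 0 y)\<^sup>2 - (max 0 s)\<^sup>2) / (y - s) - 2 * max 0 s)"
      using that by (simp add: divide_simps flip: abs_divide)
    finally show ?thesis
      by simp
  qed
  have "((\<lambda>y. ((max 0 y)\<^sup>2 - (max 0 s)\<^sup>2) / (y - s) - 2 * max 0 s) \<longlongrightarrow> 0) (at s)"
  proof (rule Lim_null_comparison)
    show "\<forall>\<^sub>F y in at s. norm (((max 0 y)\<^sup>2 - (max 0 s)\<^sup>2) / (y - s) - 2 * max 0 s) \<le> norm (y - s)"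
      using bound by (auto simp: eventually_at_filter)
    show "((\<lambda>y. norm (y - s)) \<longlongrightarrow> 0) (at s)"
      by (auto intro!: tendsto_eq_intros)
  qed
  then show ?thesis
    by (simp add: has_field_derivative_iff LIM_zero_iff)
qed

section \<open>Smoothed indicator functions of a tetrahedron\<close>

definition bump :: "(real^3) set \<Rightarrow> real^3 \<Rightarrow> real" where
  "bump C x = (\<Prod>v\<in>C. (max 0 (bary C v x))\<^sup>2)"

text \<open>
As \<open>\<epsilon>\<close> tends to \<open>0\<close> from above, this tends to the indicator function of the interior of the
tetrahedron. Since it is a function of \<open>b = bump C\<close> alone, its gradient is \<open>\<epsilon> / (b + \<epsilon>)\<^sup>2 * \<nabla>b\<close>,
and all estimates reduce to the single quantity \<open>b\<close>.
\<close>

definition cutoff :: "(real^3) set \<Rightarrow> real \<Rightarrow> real^3 \<Rightarrow> real" where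
  "cutoff C \<epsilon> x = bump C x / (bump C x + \<epsilon>)"

text \<open>
The coefficient of \<open>bary_grad C w\<close> in the gradient of \<open>cutoff C \<epsilon>\<close>. It is an approximation of the
surface measure of the facet opposite to \<open>w\<close>, up to a constant factor.
\<close>

definition layer :: "(real^3) set \<Rightarrow> real \<Rightarrow> real^3 \<Rightarrow> real^3 \<Rightarrow> real" where
  "layer C \<epsilon> w x =
     2 * \<epsilon> * max 0 (bary C w x) * (\<Prod>v\<in>C - {w}. (max 0 (bary C v x))\<^sup>2) / (bump C x + \<epsilon>)\<^sup>2"

lemma bump_nonneg: "0 \<le> bump C x"
  by (simp add: bump_def prod_nonneg)

lemma continuous_bump: "continuous_on S (bump C)"
  unfolding bump_def by (intro continuous_intros)

lemma continuous_cutoff: "0 < \<epsilon> \<Longrightarrow> continuous_on S (cutoff C \<epsilon>)"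
  unfolding cutoff_def using bump_nonneg[of C]
  by (intro continuous_intros continuous_bump) (metis add_nonneg_pos less_irrefl)

lemma continuous_layer: "0 < \<epsilon> \<Longrightarrow> continuous_on S (layer C \<epsilon> w)"
  unfolding layer_def using bump_nonneg[of C]
  by (intro continuous_intros continuous_bump) (metis add_nonneg_pos less_irrefl power_eq_0_iff)

lemma bump_factor:
  assumes "finite C" "w \<in> C"
  shows "bump C x = (max 0 (bary C w x))\<^sup>2 * (\<Prod>v\<in>C - {w}. (max 0 (bary C v x))\<^sup>2)"
  unfolding bump_def using assms by (simp add: prod.remove)

lemma outside_tetra:
  assumes "tetra_vertices C" "x \<notin> convex hull C"
  shows "cutoff C \<epsilon> x = 0" "w \<in> C \<Longrightarrow> layer C \<epsilon> w x = 0"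
proof -
  have fin: "finite C"
    using assms by (simp add: tetra_vertices_def)
  obtain v where v: "v \<in> C" "bary C v x < 0"
    using assms tetra_iff_bary by force
  then show "cutoff C \<epsilon> x = 0"
    by (simp add: cutoff_def bump_factor[OF fin v(1)])
  have "(\<Prod>u\<in>C - {w}. (max 0 (bary C u x))\<^sup>2) = 0" if "w \<noteq> v"
    using v fin that by (intro prod_zero) (auto intro!: bexI[of _ v])
  then show "layer C \<epsilon> w x = 0"
    using v by (cases "w = v") (auto simp: layer_def)
qed

lemma compact_tetra: "tetra_vertices C \<Longrightarrow> compact (convex hull C)"
  by (simp add: tetra_vertices_def finite_imp_compact_convex_hull)

lemma has_C1_derivative_cutoff:
  assumes "tetra_vertices C" "0 < \<epsilon>"
  shows "has_C1_derivative (cutoff C \<epsilon>) (\<lambda>x v. \<Sum>w\<in>C. layer C \<epsilon> w x * (bary_grad C w \<bullet> v))"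
  unfolding has_C1_derivative_def
proof (intro conjI allI)
  have fin: "finite C"
    using assms by (simp add: tetra_vertices_def)
  fix x :: "real^3"
  have pos: "bump C x + \<epsilon> \<noteq> 0"
    using assms(2) bump_nonneg[of C x] by linarith
  have "((\<lambda>x. bary C v x) has_derivative (\<lambda>y. bary_grad C v \<bullet> y)) (at x)" for v
    unfolding bary_def by (auto intro!: derivative_eq_intros)
  then have "((\<lambda>x. (max 0 (bary C v x))\<^sup>2) has_derivative
      (\<lambda>y. (bary_grad C v \<bullet> y) * (2 * max 0 (bary C v x)))) (at x)" for v
    by (rule DERIV_compose_FDERIV[OF DERIV_max_zero_square])
  then have "((\<lambda>x. \<Prod>v\<in>C. (max 0 (bary C v x))\<^sup>2) has_derivative
      (\<lambda>y. \<Sum>w\<in>C. (bary_grad C w \<bullet> y) * (2 * max 0 (bary C w x)) * (\<Prod>v\<in>C - {w}. (max 0 (bary C v x))\<^sup>2))) (at x)"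
    by (intro has_derivative_prod)
  then have b: "(bump C has_derivative
      (\<lambda>y. \<Sum>w\<in>C. (bary_grad C w \<bullet> y) * (2 * max 0 (bary C w x)) * (\<Prod>v\<in>C - {w}. (max 0 (bary C v x))\<^sup>2))) (at x)"
    by (simp add: bump_def[abs_def])
  have "((\<lambda>s. s / (s + \<epsilon>)) has_field_derivative \<epsilon> / (bump C x + \<epsilon>)\<^sup>2) (at (bump C x))"
    using pos by (auto intro!: derivative_eq_intros simp: power2_eq_square field_simps)
  from DERIV_compose_FDERIV[OF this b]
  show "(cutoff C \<epsilon> has_derivative (\<lambda>v. \<Sum>w\<in>C. layer C \<epsilon> w x * (bary_grad C w \<bullet> v))) (at x)"
    by (simp add: cutoff_def[abs_def] layer_def sum_distrib_left sum_distrib_right sum_divide_distrib mult.assoc mult.left_commute mult.commute)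
next
  show "continuous_on UNIV (\<lambda>x. \<Sum>w\<in>C. layer C \<epsilon> w x * (bary_grad C w \<bullet> v))" for v
    by (intro continuous_intros continuous_layer assms)
qed

lemma integrable_cutoff_mult:
  assumes "tetra_vertices C" "0 < \<epsilon>" "continuous_on UNIV f"
  shows "integrable lborel (\<lambda>x. cutoff C \<epsilon> x * f x)"
  by (rule integrable_compact_support[OF _ compact_tetra[OF assms(1)]])
     (use assms outside_tetra in \<open>auto intro!: continuous_intros continuous_cutoff\<close>)

lemma integrable_layer_mult:
  assumes "tetra_vertices C" "0 < \<epsilon>" "continuous_on UNIV f" "w \<in> C"
  shows "integrable lborel (\<lambda>x. layer C \<epsilon> w x * f x)"
  by (rule integrable_compact_support[OF _ compact_tetra[OF assms(1)]])
     (use assms outside_tetra in \<open>auto intro!: continuous_intros continuous_layer\<close>)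

text \<open>
The product of \<open>f\<close> and the cutoff is continuously differentiable with compact support, so the
integral of its derivative is zero.
\<close>

lemma integral_cutoff_by_parts:
  fixes f :: "real^3 \<Rightarrow> real"
  assumes C: "tetra_vertices C" "0 < \<epsilon>" and f: "has_C1_derivative f f'"
  shows "(\<integral>x. cutoff C \<epsilon> x * f' x v \<partial>lborel) =
    - (\<Sum>w\<in>C. (bary_grad C w \<bullet> v) * (\<integral>x. layer C \<epsilon> w x * f x \<partial>lborel))"
proof -
  have "(\<integral>x. cutoff C \<epsilon> x * f' x v + (\<Sum>w\<in>C. layer C \<epsilon> w x * (bary_grad C w \<bullet> v)) * f x \<partial>lborel) = 0"
    by (rule integral_derivative_compact_support[OF
          has_C1_derivative_mult[OF has_C1_derivative_cutoff[OF C] f] compact_tetra[OF C(1)]])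
       (simp add: outside_tetra[OF C(1)])
  also have "(\<lambda>x. cutoff C \<epsilon> x * f' x v + (\<Sum>w\<in>C. layer C \<epsilon> w x * (bary_grad C w \<bullet> v)) * f x) =
      (\<lambda>x. cutoff C \<epsilon> x * f' x v + (\<Sum>w\<in>C. (bary_grad C w \<bullet> v) * (layer C \<epsilon> w x * f x)))"
    by (simp add: sum_distrib_right mult.assoc mult.left_commute)
  finally show ?thesis
    using C has_C1_derivativeD[OF f] 
    by (simp add: integrable_cutoff_mult integrable_layer_mult)
qed

definition divergence :: "(real^3 \<Rightarrow> real^3 \<Rightarrow> real^3) \<Rightarrow> real^3 \<Rightarrow> real" where
  "divergence g' x = (\<Sum>j\<in>UNIV. g' x (axis j 1) $ j)"

lemma has_C1_derivative_component:
  assumes "has_C1_derivative g g'"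
  shows "has_C1_derivative (\<lambda>x. g x $ j) (\<lambda>x v. g' x v $ j)"
  unfolding has_C1_derivative_def
  by (intro conjI allI bounded_linear.has_derivative[OF bounded_linear_vec_nth]
      continuous_on_component has_C1_derivativeD[OF assms])

lemma continuous_divergence:
  assumes "has_C1_derivative g g'"
  shows "continuous_on S (divergence g')"
  unfolding divergence_def
  by (intro continuous_intros has_C1_derivativeD[OF assms])

lemma integral_cutoff_divergence:
  assumes C: "tetra_vertices C" "0 < \<epsilon>" and g: "has_C1_derivative g g'"
  shows "(\<integral>x. cutoff C \<epsilon> x * divergence g' x \<partial>lborel) =
    - (\<Sum>w\<in>C. \<integral>x. layer C \<epsilon> w x * (bary_grad C w \<bullet> g x) \<partial>lborel)"
proof -
  note G = has_C1_derivative_component[OF g]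
  note D = has_C1_derivativeD[OF G]
  have "(\<integral>x. cutoff C \<epsilon> x * divergence g' x \<partial>lborel) = (\<Sum>j\<in>UNIV. \<integral>x. cutoff C \<epsilon> x * (g' x (axis j 1) $ j) \<partial>lborel)"
    unfolding divergence_def sum_distrib_left
    by (intro Bochner_Integration.integral_sum integrable_cutoff_mult C D)
  also have "\<dots> = (\<Sum>j\<in>UNIV. - (\<Sum>w\<in>C. (bary_grad C w $ j) * (\<integral>x. layer C \<epsilon> w x * g x $ j \<partial>lborel)))"
    by (subst integral_cutoff_by_parts[OF C G]) (simp add: inner_axis)
  also have "\<dots> = - (\<Sum>w\<in>C. \<Sum>j\<in>UNIV. (bary_grad C w $ j) * (\<integral>x. layer C \<epsilon> w x * g x $ j \<partial>lborel))"
    by (simp add: sum_negf sum.swap[of _ C])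
  also have "\<dots> = - (\<Sum>w\<in>C. \<integral>x. (\<Sum>j\<in>UNIV. (bary_grad C w $ j) * (layer C \<epsilon> w x * g x $ j)) \<partial>lborel)"
    using C D by (simp add: integrable_layer_mult)
  also have "\<dots> = - (\<Sum>w\<in>C. \<integral>x. layer C \<epsilon> w x * (bary_grad C w \<bullet> g x) \<partial>lborel)"
    by (simp add: inner_vec_def sum_distrib_left mult.left_commute)
  finally show ?thesis .
qed

lemma AE_bary_nonzero:
  assumes "tetra_vertices C"
  shows "AE x in lborel. \<forall>v\<in>C. bary C v x \<noteq> 0"
proof -
  have "negligible (\<Union>v\<in>C. {x. bary C v x = 0})"
    using assms bary_level_negligible[OF assms] by (intro negligible_Union) (auto simp: tetra_vertices_def)
  then have "AE x in lebesgue. x \<notin> (\<Union>v\<in>C. {x. bary C v x = 0})"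
    by (intro AE_not_in) (simp add: negligible_iff_null_sets)
  then have "AE x in lborel. x \<notin> (\<Union>v\<in>C. {x. bary C v x = 0})"
    by (simp add: AE_completion_iff)
  then show ?thesis
    by eventually_elim auto
qed

lemma tendsto_inverse_Suc: "(\<lambda>n. 1 / real (Suc n)) \<longlonglongrightarrow> 0"
  using LIMSEQ_Suc[OF lim_inverse_n'] by simp

text \<open>
The cutoff lies between \<open>0\<close> and \<open>1\<close>, vanishes outside the tetrahedron and tends to \<open>1\<close> wherever all
barycentric coordinates are positive, which excludes only a null set of the tetrahedron.
\<close>

lemma integral_cutoff_tendsto:
  assumes C: "tetra_vertices C" and f: "continuous_on UNIV f"
  shows "(\<lambda>n. \<integral>x. cutoff C (1 / real (Suc n)) x * f x \<partial>lborel) \<longlonglongrightarrow>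
    (\<integral>x. indicator (convex hull C) x * f x \<partial>lborel)"
proof (rule integral_dominated_convergence[where w = "\<lambda>x. indicator (convex hull C) x * norm (f x)"])
  have fin: "finite C"
    using C by (simp add: tetra_vertices_def)
  have [measurable]: "f \<in> borel_measurable borel" "convex hull C \<in> sets borel"
    using f compact_tetra[OF C] by (auto intro: borel_measurable_continuous_onI compact_imp_closed borel_closed)
  show "(\<lambda>x. indicator (convex hull C) x * f x) \<in> borel_measurable lborel"
    by simp
  have [measurable]: "cutoff C (1 / real (Suc n)) \<in> borel_measurable borel" for n
    using continuous_cutoff[of "1 / real (Suc n)" UNIV C] by (intro borel_measurable_continuous_onI) simp
  show "(\<lambda>x. cutoff C (1 / real (Suc n)) x * f x) \<in> borel_measurable lborel" for n
    by measurable
  show "integrable lborel (\<lambda>x. indicator (convex hull C) x * norm (f x))"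
    using borel_integrable_compact[OF compact_tetra[OF C] continuous_on_norm[OF continuous_on_subset[OF f]]]
    by simp
  show "AE x in lborel. (\<lambda>n. cutoff C (1 / real (Suc n)) x * f x) \<longlonglongrightarrow> indicator (convex hull C) x * f x"
    using AE_bary_nonzero[OF C]
  proof eventually_elim
    case (elim x)
    show ?case
    proof (cases "x \<in> convex hull C")
      case True
      then have "\<forall>v\<in>C. 0 < bary C v x"
        using elim tetra_iff_bary[OF C, of x] by force
      then have pos: "0 < bump C x"
        by (auto simp: bump_def intro!: prod_pos)
      have "(\<lambda>n. bump C x / (bump C x + 1 / real (Suc n)) * f x) \<longlonglongrightarrow> bump C x / (bump C x + 0) * f x"
        using pos by (intro tendsto_intros tendsto_inverse_Suc) auto
      then show ?thesis
        using True pos by (simp add: cutoff_def)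
    qed (simp add: outside_tetra[OF C])
  qed
  show "AE x in lborel. norm (cutoff C (1 / real (Suc n)) x * f x) \<le> indicator (convex hull C) x * norm (f x)" for n
  proof (intro AE_I2)
    fix x
    have "\<bar>cutoff C (1 / real (Suc n)) x\<bar> \<le> 1"
      using bump_nonneg[of C x] by (simp add: cutoff_def divide_le_eq add_nonneg_pos)
    then show "norm (cutoff C (1 / real (Suc n)) x * f x) \<le> indicator (convex hull C) x * norm (f x)"
      by (cases "x \<in> convex hull C") (simp_all add: outside_tetra[OF C] abs_mult mult_left_le_one_le)
  qed
qed

text \<open>
A point \<open>x\<close> of the tetrahedron is moved into the facet along the edge direction \<open>w - u\<close>, where \<open>u\<close>
is a vertex of the facet: the distance to travel is exactly the barycentric coordinate of \<open>w\<close>, and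
the motion stays in the tetrahedron. The mean value theorem on this segment gives the bound.
\<close>

lemma lipschitz_at_facet:
  fixes h :: "real^3 \<Rightarrow> real"
  assumes C: "tetra_vertices C" "w \<in> C" and h: "has_C1_derivative h h'"
    and zero: "\<And>x. x \<in> convex hull (C - {w}) \<Longrightarrow> h x = 0"
  obtains M where "0 \<le> M" "\<And>x. x \<in> convex hull C \<Longrightarrow> \<bar>h x\<bar> \<le> M * bary C w x"
proof -
  note D = has_C1_derivativeD[OF h]
  have fin: "finite C"
    using C by (simp add: tetra_vertices_def)
  have "card (C - {w}) = 3"
    using C by (simp add: tetra_vertices_def)
  then obtain u where u: "u \<in> C - {w}"
    by (metis card.empty ex_in_conv zero_neq_numeral)
  have "bounded ((\<lambda>x. h' x (w - u)) ` (convex hull C))"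
    by (intro compact_imp_bounded compact_continuous_image compact_tetra C D)
  then obtain M where M: "\<bar>h' x (w - u)\<bar> \<le> M" if "x \<in> convex hull C" for x
    unfolding bounded_iff by auto
  show ?thesis
  proof
    show "0 \<le> max 0 M"
      by simp
    fix x assume x: "x \<in> convex hull C"
    define r where "r = bary C w x"
    \<comment> \<open>the point of the facet reached from \<open>x\<close> in direction \<open>u - w\<close>\<close>
    define y where "y = x - r *\<^sub>R (w - u)"
    have r: "0 \<le> r"
      using x C tetra_iff_bary[OF C(1)] by (auto simp: r_def)
    have y_bary: "bary C v y = bary C v x - r * (bary C v w - bary C v u)" for v
      using bary_diff[of C v y x] bary_diff[of C v w u]
      by (simp add: y_def)
    have "y \<in> convex hull (C - {w})"
      unfolding convex_hull_iff_bary[OF C(1) Diff_subset]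
    proof (intro conjI ballI)
      show "0 \<le> bary C v y" if "v \<in> C" for v
      proof -
        have "bary C v y = (if v = w then 0 else if v = u then bary C v x + r else bary C v x)"
          using that u C bary_vertex[OF C(1) that, of w] bary_vertex[OF C(1) that, of u]
          by (auto simp: y_bary r_def)
        moreover have "0 \<le> bary C v x"
          using x that tetra_iff_bary[OF C(1)] by blast
        ultimately show ?thesis
          using r by (auto split: if_splits)
      qed
      show "bary C v y = 0" if "v \<in> C - (C - {w})" for v
        using that C u bary_vertex[OF C(1), of w w] bary_vertex[OF C(1), of w u] by (auto simp: y_bary r_def)
    qed
    then have "h y = 0" and yC: "y \<in> convex hull C"
      using zero hull_mono[of "C - {w}" C] by auto
    obtain t where t: "t \<in> {0..1}" "h (y + r *\<^sub>R (w - u)) - h y = h' (y + t *\<^sub>R r *\<^sub>R (w - u)) (r *\<^sub>R (w - u))"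
      using mean_value_line[OF D(1)] by blast
    have yx: "y + r *\<^sub>R (w - u) = x"
      by (simp add: y_def)
    have "y + t *\<^sub>R r *\<^sub>R (w - u) = (1 - t) *\<^sub>R y + t *\<^sub>R x"
      by (simp add: yx[symmetric] algebra_simps)
    also have "\<dots> \<in> convex hull C"
      using t x yC convex_convex_hull[of C] by (intro convexD_alt) auto
    finally have "\<bar>h' (y + t *\<^sub>R r *\<^sub>R (w - u)) (w - u)\<bar> \<le> max 0 M"
      using M by fastforce
    moreover have "h x = r * h' (y + t *\<^sub>R r *\<^sub>R (w - u)) (w - u)"
      using t(2) \<open>h y = 0\<close> yx linear_scale[OF has_derivative_linear[OF D(1)]] by simp
    ultimately show "\<bar>h x\<bar> \<le> max 0 M * bary C w x"
      using r by (simp add: abs_mult r_def[symmetric] mult.commute mult_left_mono)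
  qed
qed

text \<open>
With \<open>b = bump C\<close>, the bound \<open>M * \<lambda>\<^sub>w\<close> for \<open>h\<close> turns the integrand into at most
\<open>2 * M * \<epsilon> * b / (b + \<epsilon>)\<^sup>2\<close>. This is at most \<open>M\<close> since \<open>2 * \<epsilon> * b \<le> (b + \<epsilon>)\<^sup>2\<close>, and tends to \<open>0\<close> at
every point.
\<close>

lemma integral_layer_tendsto_0:
  fixes h :: "real^3 \<Rightarrow> real"
  assumes C: "tetra_vertices C" "w \<in> C" and h: "has_C1_derivative h h'"
    and zero: "\<And>x. x \<in> convex hull (C - {w}) \<Longrightarrow> h x = 0"
  shows "(\<lambda>n. \<integral>x. layer C (1 / real (Suc n)) w x * h x \<partial>lborel) \<longlonglongrightarrow> 0"
proof -
  have fin: "finite C"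
    using C by (simp add: tetra_vertices_def)
  obtain M where M: "0 \<le> M" "\<And>x. x \<in> convex hull C \<Longrightarrow> \<bar>h x\<bar> \<le> M * bary C w x"
    using lipschitz_at_facet[OF C h zero] by blast
  have bound: "\<bar>layer C \<epsilon> w x * h x\<bar> \<le> 2 * M * \<epsilon> * bump C x / (bump C x + \<epsilon>)\<^sup>2" if "0 < \<epsilon>" for \<epsilon> x
  proof (cases "x \<in> convex hull C")
    case True
    define P where "P = (\<Prod>v\<in>C - {w}. (max 0 (bary C v x))\<^sup>2)"
    have P: "0 \<le> P"
      by (simp add: P_def prod_nonneg)
    define r where "r = bary C w x"
    have r: "0 \<le> r"
      using True C tetra_iff_bary[OF C(1)] by (auto simp: r_def)
    have l: "layer C \<epsilon> w x = 2 * \<epsilon> * r * P / (bump C x + \<epsilon>)\<^sup>2" "bump C x = r * r * P"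
      using r fin C by (simp_all add: layer_def bump_factor r_def P_def power2_eq_square)
    have l0: "0 \<le> layer C \<epsilon> w x"
      using l(1) r P that by simp
    have "\<bar>layer C \<epsilon> w x * h x\<bar> = layer C \<epsilon> w x * \<bar>h x\<bar>"
      using l0 by (simp add: abs_mult)
    also have "\<dots> \<le> layer C \<epsilon> w x * (M * r)"
      using M(2)[OF True] l0 by (intro mult_left_mono) (auto simp: r_def)
    also have "\<dots> = 2 * M * \<epsilon> * bump C x / (bump C x + \<epsilon>)\<^sup>2"
      by (simp add: l(1)) (simp add: l(2) mult_ac)
    finally show ?thesis .
  qed (use outside_tetra[OF C(1), of x] C M bump_nonneg[of C x] that in auto)
  have bound2: "2 * M * \<epsilon> * bump C x / (bump C x + \<epsilon>)\<^sup>2 \<le> M" if "0 < \<epsilon>" for \<epsilon> x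
  proof -
    have "2 * \<epsilon> * bump C x \<le> (bump C x + \<epsilon>)\<^sup>2"
      using that by (simp add: power2_sum)
    then have "2 * M * \<epsilon> * bump C x \<le> M * (bump C x + \<epsilon>)\<^sup>2"
      using mult_left_mono[OF _ M(1), of "2 * \<epsilon> * bump C x" "(bump C x + \<epsilon>)\<^sup>2"]
      by (simp add: mult_ac)
    moreover have "0 < (bump C x + \<epsilon>)\<^sup>2"
      using that bump_nonneg[of C x] by (simp add: add_nonneg_pos)
    ultimately show ?thesis
      by (simp add: divide_le_eq)
  qed
  have [measurable]: "convex hull C \<in> sets borel"
    using compact_tetra[OF C(1)] by (auto intro: compact_imp_closed borel_closed)
  have "(\<lambda>n. \<integral>x. layer C (1 / real (Suc n)) w x * h x \<partial>lborel) \<longlonglongrightarrow> (\<integral>(x::real^3). 0 \<partial>lborel)"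
  proof (rule integral_dominated_convergence[where w = "\<lambda>x. M * indicator (convex hull C) x"])
    have "continuous_on UNIV (\<lambda>x. layer C (1 / real (Suc n)) w x * h x)" for n
      by (intro continuous_intros continuous_layer has_C1_derivativeD[OF h]) simp
    then show "(\<lambda>x. layer C (1 / real (Suc n)) w x * h x) \<in> borel_measurable lborel" for n
      using borel_measurable_continuous_onI by auto
    have "emeasure lborel (convex hull C) < \<infinity>"
      using compact_tetra[OF C(1)] by (intro emeasure_bounded_finite) (auto intro: compact_imp_bounded)
    then show "integrable lborel (\<lambda>x. M * indicator (convex hull C) x)"
      by (intro integrable_mult_right) (auto simp: integrable_indicator_iff)
    show "AE x in lborel. norm (layer C (1 / real (Suc n)) w x * h x) \<le> M * indicator (convex hull C) x" for n
    proof (intro AE_I2)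
      fix x
      show "norm (layer C (1 / real (Suc n)) w x * h x) \<le> M * indicator (convex hull C) x"
        using bound[of "1 / real (Suc n)" x] bound2[of "1 / real (Suc n)" x] outside_tetra[OF C(1), of x] C
        by (cases "x \<in> convex hull C") auto
    qed
    show "AE x in lborel. (\<lambda>n. layer C (1 / real (Suc n)) w x * h x) \<longlonglongrightarrow> 0"
    proof (intro AE_I2)
      fix x
      have "(\<lambda>n. 2 * M * (1 / real (Suc n)) * bump C x / (bump C x + (1 / real (Suc n)))\<^sup>2) \<longlonglongrightarrow> 0"
      proof (cases "bump C x = 0")
        case False
        then have "(\<lambda>n. 2 * M * (1 / real (Suc n)) * bump C x / (bump C x + (1 / real (Suc n)))\<^sup>2) \<longlonglongrightarrow>
            2 * M * 0 * bump C x / (bump C x + 0)\<^sup>2"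
          by (intro tendsto_intros tendsto_inverse_Suc) auto
        then show ?thesis
          by simp
      qed simp
      then show "(\<lambda>n. layer C (1 / real (Suc n)) w x * h x) \<longlonglongrightarrow> 0"
        by (rule Lim_null_comparison[rotated]) (use bound[of "1 / real (Suc _)" x] in auto)
    qed
  qed auto
  then show ?thesis
    by simp
qed

section \<open>Reflection across a shared facet\<close>

text \<open>
The linear change of variables applies to \<open>F\<close> viewed as a map into \<open>real^1\<close>; the translation by \<open>b\<close> is
absorbed by the translation invariance of the Lebesgue measure.
\<close>

lemma integral_affine_substitution:
  fixes F :: "real^3 \<Rightarrow> real"
  assumes L: "linear L" "det (matrix L) \<noteq> 0" and F: "continuous_on UNIV F" "integrable lborel F"
  shows "(\<integral>y. F y \<partial>lborel) = \<bar>det (matrix L)\<bar> * (\<integral>x. F (L x + b) \<partial>lborel)"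
proof -
  have Fm: "F \<in> borel_measurable borel"
    using F(1) by (rule borel_measurable_continuous_onI)
  define f where "f y = F (y + b)" for y
  have f: "integrable lborel f" "(\<integral>y. f y \<partial>lborel) = (\<integral>y. F y \<partial>lborel)"
    using F(2) integral_distr[of "(+) b" lborel borel F] integrable_distr_eq[of "(+) b" lborel borel F] Fm
    by (simp_all add: lborel_distr_plus add.commute f_def[abs_def])
  have lborel_iff: "g absolutely_integrable_on UNIV \<longleftrightarrow> integrable lborel g"
    "integrable lborel g \<Longrightarrow> integral UNIV g = (\<integral>y. g y \<partial>lborel)"
    if "continuous_on UNIV g" for g :: "real^3 \<Rightarrow> real"
  proof -
    have "g \<in> borel_measurable lborel"
      using that borel_measurable_continuous_onI by auto
    then show "g absolutely_integrable_on UNIV \<longleftrightarrow> integrable lborel g"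
      by (simp add: set_integrable_def integrable_completion)
    show "integral UNIV g = (\<integral>y. g y \<partial>lborel)" if "integrable lborel g"
      using has_integral_integral_lborel[OF that] by (rule integral_unique)
  qed
  have cf: "continuous_on UNIV f"
    unfolding f_def by (intro continuous_on_compose2[OF F(1)] continuous_intros) auto
  have cL: "continuous_on UNIV (\<lambda>x. \<bar>det (matrix L)\<bar> * f (L x))"
    using linear_continuous_on[OF linear_conv_bounded_linear[THEN iffD1, OF L(1)], of UNIV]
    by (intro continuous_intros continuous_on_compose2[OF cf]) auto
  have scaleR_vec: "c *\<^sub>R vec y = (vec (c * y) :: real^1)" for c y :: real
    by (simp add: vec_eq_iff)
  have "surj L"
    using L det_nz_iff_inj linear_injective_imp_surjective by blast
  have "(\<lambda>x. \<bar>det (matrix L)\<bar> *\<^sub>R vec (f (L x)) :: real^1) absolutely_integrable_on UNIV \<and>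
      integral UNIV (\<lambda>x. \<bar>det (matrix L)\<bar> *\<^sub>R vec (f (L x))) = (vec (\<integral>y. f y \<partial>lborel) :: real^1)
    \<longleftrightarrow> (\<lambda>x. vec (f x) :: real^1) absolutely_integrable_on (L ` UNIV) \<and>
      integral (L ` UNIV) (\<lambda>x. vec (f x)) = (vec (\<integral>y. f y \<partial>lborel) :: real^1)"
    by (rule has_absolute_integral_change_of_variables_linear[OF L(1)])
  then have "(\<lambda>x. \<bar>det (matrix L)\<bar> * f (L x)) absolutely_integrable_on UNIV \<and>
      integral UNIV (\<lambda>x. \<bar>det (matrix L)\<bar> * f (L x)) = (\<integral>y. f y \<partial>lborel)
    \<longleftrightarrow> f absolutely_integrable_on UNIV \<and> integral UNIV f = (\<integral>y. f y \<partial>lborel)"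
    unfolding \<open>surj L\<close> scaleR_vec by (simp add: absolutely_integrable_on_1_iff integral_on_1_eq)
  then have "(\<integral>x. \<bar>det (matrix L)\<bar> * f (L x) \<partial>lborel) = (\<integral>y. f y \<partial>lborel)"
    using lborel_iff[OF cf] lborel_iff[OF cL] f(1) by metis
  then show ?thesis
    using f(2) by (simp add: f_def)
qed

lemma det_rank_one_update:
  fixes u g :: "real^3"
  shows "det (matrix (\<lambda>x. x + (g \<bullet> x) *\<^sub>R u)) = 1 + g \<bullet> u"
  by (simp add: det_3 matrix_def inner_axis axis_def inner_vec_def sum_3 algebra_simps)

text \<open>
Both gradients are normal to the shared facet. The factor is the coordinate of the apex of one
tetrahedron with respect to the other; its sign tells on which side of the facet that apex lies.
\<close>

lemma shared_facet_gradient: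
  assumes C: "tetra_vertices (insert w K)" "w \<notin> K" and C': "tetra_vertices (insert w' K)" "w' \<notin> K"
  shows "bary_grad (insert w' K) w' = bary (insert w' K) w' w *\<^sub>R bary_grad (insert w K) w"
proof -
  have "card K = 3" "finite K"
    using C by (auto simp: tetra_vertices_def)
  then obtain a where a: "a \<in> K"
    by (metis card.empty ex_in_conv zero_neq_numeral)
  have zero: "bary (insert w' K) w' x = 0" if "x \<in> convex hull K" for x
    using that C'(2) convex_hull_iff_bary[OF C'(1) subset_insertI] by auto
  have normal: "normal_to (convex hull K) (bary_grad (insert w' K) w')"
    using bary_grad_normal[OF C'(1) insertI1] C'(2) by simp
  have "bary_grad (insert w' K) w' = (bary_grad (insert w' K) w' \<bullet> (w - a)) *\<^sub>R bary_grad (insert w K) w"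
    by (rule facet_normal_multiple[OF C(1) insertI1]) (use normal a C(2) in auto)
  also have "bary_grad (insert w' K) w' \<bullet> (w - a) = bary (insert w' K) w' w"
    using bary_diff[of "insert w' K" w' w a] zero[of a] a by (simp add: hull_inc)
  finally show ?thesis .
qed

text \<open>
This replaces the statement that the outward fluxes of two neighbours through their common facet
cancel. Let \<open>A\<close> be the affine map that fixes the facet and sends \<open>w'\<close> to \<open>w\<close>. It transports barycentric
coordinates, hence layers, and its linear part is a rank-one update of the identity with determinant
\<open>c = bary C' w' w\<close>, which is negative for apexes on opposite sides. By
\<open>shared_facet_gradient\<close>, \<open>\<bar>c\<bar>\<close> times the gradient for \<open>C\<close> is minus the gradient for \<open>C'\<close>. So after
the substitution \<open>A\<close> the two integrals combine to one integral of the layer of \<open>C'\<close> against a function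
that vanishes on the facet.
\<close>

lemma reflected_layers_cancel:
  assumes C: "tetra_vertices (insert w K)" "w \<notin> K" and C': "tetra_vertices (insert w' K)" "w' \<notin> K"
    and opposite: "bary (insert w' K) w' w < 0"
    and g: "has_C1_derivative g g1" and g': "has_C1_derivative g' g1'"
    and eq: "\<And>x. x \<in> convex hull K \<Longrightarrow>
      bary_grad (insert w' K) w' \<bullet> g x = bary_grad (insert w' K) w' \<bullet> g' x"
  shows "(\<lambda>n. (\<integral>x. layer (insert w K) (1 / real (Suc n)) w x * (bary_grad (insert w K) w \<bullet> g x) \<partial>lborel) +
      (\<integral>x. layer (insert w' K) (1 / real (Suc n)) w' x * (bary_grad (insert w' K) w' \<bullet> g' x) \<partial>lborel))
    \<longlonglongrightarrow> 0"
proof -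
  define C C' where "C = insert w K" and "C' = insert w' K"
  note CC = C[folded C_def] and CC' = C'[folded C'_def]
  have in_C: "w \<in> C" "w' \<in> C'" "K \<subseteq> C" "K \<subseteq> C'" and finK: "finite K" and cardK: "card K = 3"
    using C C' by (auto simp: C_def C'_def tetra_vertices_def)
  define G G' where "G = bary_grad C w" and "G' = bary_grad C' w'"
  define c where "c = bary C' w' w"
  have "c < 0"
    using opposite by (simp add: c_def C'_def)
  \<comment> \<open>the affine map that fixes \<open>K\<close> pointwise and sends \<open>w'\<close> to \<open>w\<close>\<close>
  define A where "A x = x + bary C' w' x *\<^sub>R (w - w')" for x
  have A_bary: "bary C w (A x) = bary C' w' x" "v \<in> K \<Longrightarrow> bary C v (A x) = bary C' v x" for x v
  proof -
    define u where "u v = bary C' (if v = w then w' else v) x" for v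
    have s: "sum u K = (\<Sum>v\<in>K. bary C' v x)" "(\<Sum>v\<in>K. u v *\<^sub>R v) = (\<Sum>v\<in>K. bary C' v x *\<^sub>R v)"
      using C(2) by (auto simp: u_def intro!: sum.cong)
    have one: "sum u C = 1"
      using sum_bary[OF CC'(1), of x] C C' finK s(1) by (simp add: C_def C'_def u_def)
    have "(\<Sum>v\<in>C. u v *\<^sub>R v) = bary C' w' x *\<^sub>R w + (\<Sum>v\<in>K. bary C' v x *\<^sub>R v)"
      using C finK s(2) by (simp add: C_def u_def)
    also have "(\<Sum>v\<in>K. bary C' v x *\<^sub>R v) = x - bary C' w' x *\<^sub>R w'"
      using sum_bary_vertices[OF CC'(1), of x] C' finK by (simp add: C'_def algebra_simps)
    finally have "A x = (\<Sum>v\<in>C. u v *\<^sub>R v)"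
      by (simp add: A_def algebra_simps)
    then have "bary C v (A x) = u v" if "v \<in> C" for v
      using bary_combination[OF CC(1) subset_refl that one] that by simp
    then show "bary C w (A x) = bary C' w' x" "v \<in> K \<Longrightarrow> bary C v (A x) = bary C' v x"
      using in_C C(2) by (auto simp: u_def)
  qed
  have layer_A: "layer C \<epsilon> w (A x) = layer C' \<epsilon> w' x" for \<epsilon> x
  proof -
    have K: "C - {w} = K" "C' - {w'} = K"
      using C C' by (auto simp: C_def C'_def)
    have P: "(\<Prod>v\<in>K. (max 0 (bary C v (A x)))\<^sup>2) = (\<Prod>v\<in>K. (max 0 (bary C' v x))\<^sup>2)"
      by (intro prod.cong) (simp_all add: A_bary)
    have fin: "finite C" "finite C'"
      using CC(1) CC'(1) by (auto simp: tetra_vertices_def)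
    show ?thesis
      unfolding layer_def bump_factor[OF fin(1) in_C(1)] bump_factor[OF fin(2) in_C(2)] K P A_bary(1) ..
  qed
  define L where "L x = x + (G' \<bullet> x) *\<^sub>R (w - w')" for x
  define b where "b = (1 - G' \<bullet> w') *\<^sub>R (w - w')"
  have A_eq: "A x = L x + b" for x
    by (simp add: A_def L_def b_def bary_def G'_def inner_diff_right algebra_simps)
  have "linear L"
    unfolding L_def by (auto intro!: linearI simp: inner_add_right algebra_simps)
  have detL: "det (matrix L) = c"
    using det_rank_one_update[of G' "w - w'"] bary_diff[of C' w' w w'] bary_vertex[OF CC'(1) in_C(2) in_C(2)]
    by (simp add: L_def[abs_def] c_def G'_def)
  have G': "G' = c *\<^sub>R G"
    using shared_facet_gradient[OF C C'] by (simp add: G_def G'_def c_def C_def C'_def)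
  have contg: "continuous_on S g" "continuous_on S g'" for S
    using has_C1_derivativeD[OF g] has_C1_derivativeD[OF g'] by auto
  have contL: "continuous_on S L" for S
    unfolding L_def by (intro continuous_intros)
  define h where "h x = G' \<bullet> (g' x - g (L x + b))" for x
  have "has_C1_derivative h (\<lambda>x v. G' \<bullet> (g1' x v - g1 (L x + b) (L v)))"
    unfolding has_C1_derivative_def
  proof (intro conjI allI)
    fix x
    have "((\<lambda>x. L x + b) has_derivative L) (at x)"
      unfolding L_def by (auto intro!: derivative_eq_intros)
    from has_derivative_compose[OF this has_C1_derivativeD(1)[OF g]]
    have "((\<lambda>x. g (L x + b)) has_derivative (\<lambda>v. g1 (L x + b) (L v))) (at x)" .
    then show "(h has_derivative (\<lambda>v. G' \<bullet> (g1' x v - g1 (L x + b) (L v)))) (at x)"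
      unfolding h_def by (auto intro!: derivative_eq_intros has_C1_derivativeD[OF g'])
  next
    show "continuous_on UNIV (\<lambda>x. G' \<bullet> (g1' x v - g1 (L x + b) (L v)))" for v
      by (intro continuous_intros has_C1_derivativeD[OF g'] contL
          continuous_on_compose2[OF has_C1_derivativeD(2)[OF g, of UNIV]]) auto
  qed
  then have lim: "(\<lambda>n. \<integral>x. layer C' (1 / real (Suc n)) w' x * h x \<partial>lborel) \<longlonglongrightarrow> 0"
  proof (rule integral_layer_tendsto_0[OF CC'(1) in_C(2)])
    fix x assume "x \<in> convex hull (C' - {w'})"
    then have xK: "x \<in> convex hull K"
      using C'(2) by (simp add: C'_def)
    then have "bary C' w' x = 0"
      using convex_hull_iff_bary[OF CC'(1) in_C(4)] CC'(2) in_C(2) by auto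
    then have "L x + b = x"
      using A_eq[of x] by (simp add: A_def)
    then show "h x = 0"
      using eq[OF xK] by (simp add: h_def inner_diff_right G'_def C'_def)
  qed
  have "(\<integral>x. layer C \<epsilon> w x * (G \<bullet> g x) \<partial>lborel) + (\<integral>x. layer C' \<epsilon> w' x * (G' \<bullet> g' x) \<partial>lborel) =
      (\<integral>x. layer C' \<epsilon> w' x * h x \<partial>lborel)" if "0 < \<epsilon>" for \<epsilon>
  proof -
    have "(\<integral>x. layer C \<epsilon> w x * (G \<bullet> g x) \<partial>lborel) =
        \<bar>det (matrix L)\<bar> * (\<integral>x. layer C \<epsilon> w (L x + b) * (G \<bullet> g (L x + b)) \<partial>lborel)"
      by (rule integral_affine_substitution[OF \<open>linear L\<close>])
         (use detL \<open>c < 0\<close> CC in_C that contg in \<open>auto intro!: continuous_intros continuous_layer integrable_layer_mult\<close>)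
    also have "\<dots> = - c * (\<integral>x. layer C' \<epsilon> w' x * (G \<bullet> g (L x + b)) \<partial>lborel)"
      using detL \<open>c < 0\<close> by (simp add: layer_A A_eq[symmetric])
    also have "\<dots> = - (\<integral>x. layer C' \<epsilon> w' x * (G' \<bullet> g (L x + b)) \<partial>lborel)"
      by (simp add: G' mult.left_commute)
    finally show ?thesis
      using that CC' in_C
      by (simp add: h_def inner_diff_right right_diff_distrib integrable_layer_mult
          continuous_on_inner continuous_on_compose2[OF contg(1)[of UNIV]] contg contL continuous_on_add)
  qed
  then show ?thesis
    using lim by (simp add: C_def C'_def G_def G'_def)
qed

section \<open>A divergence theorem for piecewise smooth fields\<close>

abbreviation vertices :: "(real^3) set \<Rightarrow> (real^3) set" where
  "vertices T \<equiv> {v. v extreme_point_of T}"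

abbreviation opposite_facet :: "(real^3) set \<Rightarrow> real^3 \<Rightarrow> (real^3) set" where
  "opposite_facet T w \<equiv> convex hull (vertices T - {w})"

lemma vertices_convex_hull:
  assumes "tetra_vertices C" "K \<subseteq> C"
  shows "vertices (convex hull K) = K"
  using assms extreme_point_of_convex_hull_affine_independent[of K] affine_independent_subset
  by (auto simp: tetra_vertices_def)

lemma simplex_3D:
  assumes "3 simplex T"
  shows "tetra_vertices (vertices T)" "convex hull (vertices T) = T"
proof -
  obtain C where "finite C" "\<not> affine_dependent C" "int (card C) = 3 + 1" "T = convex hull C"
    using assms unfolding simplex by blast
  then have "tetra_vertices C" "T = convex hull C"
    by (auto simp: tetra_vertices_def)
  then show "tetra_vertices (vertices T)" "convex hull (vertices T) = T"
    using vertices_convex_hull[of C C] by auto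
qed

lemma facet_of_simplex_3:
  assumes "3 simplex T"
  shows "F facet_of T \<longleftrightarrow> (\<exists>w\<in>vertices T. F = opposite_facet T w)"
proof -
  note C = simplex_3D[OF assms]
  have "\<not> affine_dependent (vertices T)" "card (vertices T) = 4"
    using C(1) by (auto simp: tetra_vertices_def)
  then show ?thesis
    using facet_of_convex_hull_affine_independent_alt[of "vertices T" F] unfolding C(2) by auto
qed

lemma vertices_opposite_facet:
  assumes "3 simplex T"
  shows "vertices (opposite_facet T w) = vertices T - {w}"
  by (rule vertices_convex_hull[OF simplex_3D(1)[OF assms]]) (rule Diff_subset)

lemma conforming_gridD:
  assumes "conforming_grid \<Omega> \<T>"
  shows "finite \<T>" "T \<in> \<T> \<Longrightarrow> 3 simplex T" "\<Omega> = interior (\<Union>\<T>)"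
    "T \<in> \<T> \<Longrightarrow> T' \<in> \<T> \<Longrightarrow> (T \<inter> T') face_of T"
  using assms by (auto simp: conforming_grid_def triangulation_def)

lemma facet_barycenter:
  assumes C: "tetra_vertices (insert w K)" "w \<notin> K"
  obtains m where "\<And>v. v \<in> K \<Longrightarrow> bary (insert w K) v m = 1/3" "bary (insert w K) w m = 0"
    "m = (\<Sum>v\<in>K. (1/3) *\<^sub>R v)"
proof
  have "card K = 3" "finite K"
    using C by (auto simp: tetra_vertices_def)
  then have "(\<Sum>v\<in>K. 1/3 :: real) = 1"
    by simp
  note m = bary_combination[OF C(1) subset_insertI _ this]
  show "bary (insert w K) v (\<Sum>v\<in>K. (1/3) *\<^sub>R v) = 1/3" if "v \<in> K" for v
    using that m[of v] by simp
  show "bary (insert w K) w (\<Sum>v\<in>K. (1/3) *\<^sub>R v) = 0"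
    using m[of w] C(2) by simp
qed simp

lemma bary_line: "bary C v (x + \<delta> *\<^sub>R (y - x)) = (1 - \<delta>) * bary C v x + \<delta> * bary C v y"
  by (simp add: bary_def inner_diff_right inner_add_right algebra_simps)

text \<open>
If the apexes were on the same side, then a point slightly inside from the barycenter of the common
facet would be interior to both tetrahedra. But a common face that contains an interior point is the
whole tetrahedron, so the two would be equal.
\<close>

lemma neighbours_opposite:
  assumes C: "tetra_vertices (insert w K)" "w \<notin> K" and C': "tetra_vertices (insert w' K)" "w' \<notin> K"
    and face: "(convex hull (insert w K) \<inter> convex hull (insert w' K)) face_of convex hull (insert w K)"
      "(convex hull (insert w K) \<inter> convex hull (insert w' K)) face_of convex hull (insert w' K)"
    and ne: "convex hull (insert w K) \<noteq> convex hull (insert w' K)"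
  shows "bary (insert w' K) w' w < 0"
proof (rule ccontr)
  define c where "c = bary (insert w' K) w' w"
  assume "\<not> bary (insert w' K) w' w < 0"
  moreover have "c \<noteq> 0"
    using shared_facet_gradient[OF C C'] bary_grad_nonzero[OF C'(1), of w'] by (auto simp: c_def)
  ultimately have c: "0 < c"
    by (simp add: c_def)
  have fin: "finite K"
    using C by (auto simp: tetra_vertices_def)
  obtain m where m: "\<And>v. v \<in> K \<Longrightarrow> bary (insert w K) v m = 1/3" "bary (insert w K) w m = 0"
    "m = (\<Sum>v\<in>K. (1/3) *\<^sub>R v)"
    using facet_barycenter[OF C] by blast
  have m': "\<And>v. v \<in> K \<Longrightarrow> bary (insert w' K) v m = 1/3" "bary (insert w' K) w' m = 0"
    using facet_barycenter[OF C'] m(3) by metis+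
  \<comment> \<open>near \<open>m\<close> the coordinates of the vertices in \<open>K\<close> stay positive, also for the second tetrahedron\<close>
  have "\<forall>\<^sub>F \<delta> in at_right 0. \<forall>v\<in>K. 0 < bary (insert w' K) v (m + \<delta> *\<^sub>R (w - m))"
  proof (intro eventually_ball_finite fin ballI)
    fix v assume v: "v \<in> K"
    have "((\<lambda>\<delta>. (1 - \<delta>) * bary (insert w' K) v m + \<delta> * bary (insert w' K) v w) \<longlongrightarrow>
        (1 - 0) * bary (insert w' K) v m + 0 * bary (insert w' K) v w) (at_right 0)"
      by (intro tendsto_intros)
    then show "\<forall>\<^sub>F \<delta> in at_right 0. 0 < bary (insert w' K) v (m + \<delta> *\<^sub>R (w - m))"
      unfolding bary_line by (rule order_tendstoD(1)) (simp add: m' v)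
  qed
  moreover have "\<forall>\<^sub>F \<delta> in at_right 0. (\<delta>::real) \<in> {0<..<1}"
    by (rule eventually_at_right_real) simp
  ultimately have "\<forall>\<^sub>F \<delta> in at_right 0. \<delta> \<in> {0<..<1} \<and> (\<forall>v\<in>K. 0 < bary (insert w' K) v (m + \<delta> *\<^sub>R (w - m)))"
    by eventually_elim simp
  then obtain \<delta> where \<delta>: "0 < \<delta>" "\<delta> < 1" "\<forall>v\<in>K. 0 < bary (insert w' K) v (m + \<delta> *\<^sub>R (w - m))"
    using eventually_happens[of _ "at_right (0::real)"] by auto
  define z where "z = m + \<delta> *\<^sub>R (w - m)"
  have "0 < bary (insert w K) v z" if "v \<in> insert w K" for v
    using that \<delta> C(2) bary_vertex[OF C(1) that, of w] by (auto simp: z_def bary_line m(1,2))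
  then have zC: "z \<in> interior (convex hull (insert w K))"
    using interior_tetra[OF C(1)] by blast
  have "0 < bary (insert w' K) v z" if "v \<in> insert w' K" for v
    using that \<delta> c by (auto simp: z_def bary_line c_def m'(2))
  then have zC': "z \<in> interior (convex hull (insert w' K))"
    using interior_tetra[OF C'(1)] by blast
  have "z \<in> convex hull (insert w K) \<inter> convex hull (insert w' K)"
    using zC zC' interior_subset by blast
  then have "convex hull (insert w K) \<inter> convex hull (insert w' K) = convex hull (insert w K)"
    "convex hull (insert w K) \<inter> convex hull (insert w' K) = convex hull (insert w' K)"
    using face_of_disjoint_interior[OF face(1)] face_of_disjoint_interior[OF face(2)] zC zC' by blast+
  then show False
    using ne by auto
qed

lemma rel_interior_hull_tetra:
  assumes C: "tetra_vertices C" "K \<subseteq> C"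
    and x: "x = (\<Sum>v\<in>K. u v *\<^sub>R v)" "sum u K = 1" "\<And>v. v \<in> K \<Longrightarrow> 0 < u v"
  shows "x \<in> rel_interior (convex hull K)"
proof -
  have "\<not> affine_dependent K"
    using C affine_independent_subset[of C K] by (auto simp: tetra_vertices_def)
  then show ?thesis
    using rel_interior_convex_hull_explicit[of K] x by auto
qed

text \<open>
The points just beyond the facet, seen from \<open>T\<close>, still belong to \<open>\<Omega>\<close> and hence to one of the
finitely many other tetrahedra; as these are closed, one of them contains a point of the relative
interior of \<open>F\<close>. Its intersection with \<open>T\<close> is a face of \<open>T\<close> that meets the relative interior of \<open>F\<close>,
and so contains \<open>F\<close>.
\<close>

lemma interior_facet_shared:
  assumes grid: "conforming_grid \<Omega> \<T>" and T: "T \<in> \<T>" "F facet_of T" and F: "F \<inter> \<Omega> \<noteq> {}"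
  shows "\<exists>T'\<in>\<T>. T' \<noteq> T \<and> F facet_of T'"
proof -
  note gridD = conforming_gridD[OF grid]
  obtain w where w: "w \<in> vertices T" "F = opposite_facet T w"
    using T facet_of_simplex_3[OF gridD(2)] by blast
  define K where "K = vertices T - {w}"
  have ins: "insert w K = vertices T" "w \<notin> K"
    using w by (auto simp: K_def)
  note TC = simplex_3D[OF gridD(2)[OF T(1)]]
  have C: "tetra_vertices (insert w K)" and FK: "F = convex hull K"
    using TC ins w by (simp_all add: K_def)
  have fin: "finite K"
    using C by (auto simp: tetra_vertices_def)
  obtain x0 where x0: "x0 \<in> F" "x0 \<in> \<Omega>"
    using F by blast
  obtain m where m: "\<And>v. v \<in> K \<Longrightarrow> bary (insert w K) v m = 1/3" "bary (insert w K) w m = 0"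
    using facet_barycenter[OF C ins(2)] by metis
  have near: "\<forall>\<^sub>F \<delta> in at_right 0. y + \<delta> *\<^sub>R z \<in> \<Omega>" if "y \<in> \<Omega>" for y z
  proof -
    have "((\<lambda>\<delta>. y + \<delta> *\<^sub>R z) \<longlongrightarrow> y + 0 *\<^sub>R z) (at_right 0)"
      by (intro tendsto_intros)
    then show ?thesis
      by (rule topological_tendstoD) (use that gridD(3) in auto)
  qed
  \<comment> \<open>move the common point of \<open>F\<close> and \<open>\<Omega>\<close> towards the barycenter \<open>m\<close>, into the relative interior of \<open>F\<close>\<close>
  have "\<forall>\<^sub>F \<delta> in at_right 0. (\<delta>::real) \<in> {0<..<1}"
    by (rule eventually_at_right_real) simp
  with near[OF x0(2), of "m - x0"]
  have "\<forall>\<^sub>F \<delta> in at_right 0. \<delta> \<in> {0<..<1} \<and> x0 + \<delta> *\<^sub>R (m - x0) \<in> \<Omega>"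
    by eventually_elim simp
  then obtain \<delta> where \<delta>: "0 < \<delta>" "\<delta> < 1" "x0 + \<delta> *\<^sub>R (m - x0) \<in> \<Omega>"
    using eventually_happens[of _ "at_right (0::real)"] by auto
  define x where "x = x0 + \<delta> *\<^sub>R (m - x0)"
  have x0b: "\<And>v. v \<in> K \<Longrightarrow> 0 \<le> bary (insert w K) v x0" "bary (insert w K) w x0 = 0"
    using x0(1) FK convex_hull_iff_bary[OF C subset_insertI] ins(2) by auto
  have xK: "0 < bary (insert w K) v x" if "v \<in> K" for v
    using that x0b(1) \<delta> by (simp add: x_def bary_line m(1) add_nonneg_pos)
  have xw: "bary (insert w K) w x = 0"
    using m(2) x0b(2) by (simp add: x_def bary_line)
  have xr: "x \<in> rel_interior F"
    unfolding FK
  proof (rule rel_interior_hull_tetra[OF C subset_insertI])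
    show "x = (\<Sum>v\<in>K. bary (insert w K) v x *\<^sub>R v)" "(\<Sum>v\<in>K. bary (insert w K) v x) = 1"
      using sum_bary_vertices[OF C, of x] sum_bary[OF C, of x] fin ins(2) xw by simp_all
  qed (rule xK)
  have cl: "closed (\<Union>(\<T> - {T}))"
    using gridD(1) gridD(2) closed_simplex by (intro closed_Union) auto
  have ev: "\<forall>\<^sub>F s in at_right 0. x + s *\<^sub>R (x - w) \<in> \<Union>(\<T> - {T})"
    using near[OF \<delta>(3), of "x - w"] eventually_at_right_less[of "0::real"]
  proof eventually_elim
    case (elim s)
    have "bary (insert w K) w (x + (- s) *\<^sub>R (w - x)) < 0"
      unfolding bary_line using elim xw bary_vertex[OF C insertI1 insertI1] by simp
    then have "x + s *\<^sub>R (x - w) \<notin> T"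
      using tetra_iff_bary[OF C] TC(2) ins by (auto simp: algebra_simps)
    then show ?case
      using elim gridD(3) interior_subset[of "\<Union>\<T>"] by (auto simp: x_def)
  qed
  have "((\<lambda>s. x + s *\<^sub>R (x - w)) \<longlongrightarrow> x + 0 *\<^sub>R (x - w)) (at_right 0)"
    by (intro tendsto_intros)
  then have "x + 0 *\<^sub>R (x - w) \<in> \<Union>(\<T> - {T})"
    using Lim_in_closed_set[OF cl ev] by simp
  then obtain T' where T': "T' \<in> \<T>" "T' \<noteq> T" "x \<in> T'"
    by auto
  have "x \<in> T"
    using xr rel_interior_subset facet_of_imp_subset[OF T(2)] by blast
  then have sub: "F \<subseteq> T \<inter> T'"
    using subset_of_face_of[OF gridD(4)[OF T(1) T'(1)] facet_of_imp_subset[OF T(2)]] xr T'(3) by blast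
  then have "F face_of (T \<inter> T')"
    using face_of_subset[OF facet_of_imp_face_of[OF T(2)]] by blast
  then have "F face_of T'"
    using gridD(4)[OF T'(1) T(1)] face_of_trans by (metis Int_commute)
  moreover have "aff_dim T' = aff_dim T"
    using aff_dim_simplex gridD(2) T T' by metis
  ultimately have "F facet_of T'"
    using T(2) by (simp add: facet_of_def)
  then show ?thesis
    using T' by blast
qed

lemma facet_opposite_vertex:
  assumes "conforming_grid \<Omega> \<T>" "T \<in> \<T>" "w \<in> vertices T" "vertices T - {w} = K"
  shows "tetra_vertices (insert w K)" "w \<notin> K" "convex hull (insert w K) = T" "insert w K = vertices T"
proof -
  show *: "insert w K = vertices T" "w \<notin> K"
    using assms by auto
  show "tetra_vertices (insert w K)" "convex hull (insert w K) = T"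
    unfolding *(1) using simplex_3D conforming_gridD(2)[OF assms(1,2)] by blast+
qed

lemma grid_neighbours_opposite:
  assumes grid: "conforming_grid \<Omega> \<T>" and T: "T \<in> \<T>" "w \<in> vertices T" "vertices T - {w} = K"
    and T': "T' \<in> \<T>" "w' \<in> vertices T'" "vertices T' - {w'} = K" and ne: "T \<noteq> T'"
  shows "bary (vertices T') w' w < 0"
proof -
  note C = facet_opposite_vertex[OF grid T] and C' = facet_opposite_vertex[OF grid T']
  show ?thesis
    using neighbours_opposite[OF C(1,2) C'(1,2)] C C' ne conforming_gridD(4)[OF grid T(1) T'(1)]
      conforming_gridD(4)[OF grid T'(1) T(1)] by (simp add: Int_commute)
qed

text \<open>
Any two tetrahedra at a facet lie on opposite sides, which is impossible for three of them: the
factors that relate the three gradients would all be negative, although one is the product of the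
other two.
\<close>

lemma facet_shared_by_at_most_two:
  assumes grid: "conforming_grid \<Omega> \<T>"
    and T: "T \<in> \<T>" "w \<in> vertices T" "vertices T - {w} = K"
    and T': "T' \<in> \<T>" "w' \<in> vertices T'" "vertices T' - {w'} = K"
    and T'': "T'' \<in> \<T>" "w'' \<in> vertices T''" "vertices T'' - {w''} = K"
    and ne: "T \<noteq> T'" "T \<noteq> T''"
  shows "T' = T''"
proof (rule ccontr)
  assume ne2: "T' \<noteq> T''"
  note C = facet_opposite_vertex[OF grid T] and C' = facet_opposite_vertex[OF grid T']
    and C'' = facet_opposite_vertex[OF grid T'']
  define c d e where "c = bary (vertices T') w' w" and "d = bary (vertices T'') w'' w'"
    and "e = bary (vertices T'') w'' w"
  have neg: "c < 0" "d < 0" "e < 0"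
    using grid_neighbours_opposite[OF grid T T' ne(1)] grid_neighbours_opposite[OF grid T' T'' ne2]
      grid_neighbours_opposite[OF grid T T'' ne(2)] by (simp_all add: c_def d_def e_def)
  define G where "G = bary_grad (vertices T) w"
  have "bary_grad (vertices T') w' = c *\<^sub>R G" "bary_grad (vertices T'') w'' = d *\<^sub>R bary_grad (vertices T') w'"
    "bary_grad (vertices T'') w'' = e *\<^sub>R G"
    using shared_facet_gradient[OF C(1,2) C'(1,2)] shared_facet_gradient[OF C'(1,2) C''(1,2)]
      shared_facet_gradient[OF C(1,2) C''(1,2)] C(4) C'(4) C''(4)
    by (simp_all add: c_def d_def e_def G_def)
  then have "(d * c) *\<^sub>R G = e *\<^sub>R G"
    by (metis scaleR_scaleR)
  moreover have "G \<noteq> 0"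
    using bary_grad_nonzero[OF C(1) insertI1] C(4) by (simp add: G_def)
  ultimately have "d * c = e"
    by simp
  then show False
    using neg mult_neg_neg[of d c] by simp
qed


text \<open>
A pair of a tetrahedron and one of its vertices stands for the facet opposite to that vertex, seen
from that tetrahedron.
\<close>

definition flux_layer ::
    "((real^3) set \<Rightarrow> real^3 \<Rightarrow> real^3) \<Rightarrow> nat \<Rightarrow> (real^3) set \<times> (real^3) \<Rightarrow> real" where
  "flux_layer g n p = (\<integral>x. layer (vertices (fst p)) (1 / real (Suc n)) (snd p) x *
     (bary_grad (vertices (fst p)) (snd p) \<bullet> g (fst p) x) \<partial>lborel)"

text \<open>
The sum over all pairs \<open>p\<close> of a tetrahedron and a vertex is controlled by an involution \<open>\<sigma>\<close> of these
pairs: it exchanges the two sides of a facet that meets \<open>\<Omega>\<close> and fixes the pairs of all other facets.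
Each sum of the terms for \<open>p\<close> and \<open>\<sigma> p\<close> tends to zero, and summing over all \<open>p\<close> counts every
term twice.
\<close>

theorem piecewise_divergence:
  assumes grid: "conforming_grid \<Omega> \<T>"
    and g: "\<And>T. T \<in> \<T> \<Longrightarrow> has_C1_derivative (g T) (g' T)"
    and boundary: "\<And>T F \<nu> x. \<lbrakk>T \<in> \<T>; F facet_of T; F \<inter> \<Omega> = {}; normal_to F \<nu>; x \<in> F\<rbrakk> \<Longrightarrow> \<nu> \<bullet> g T x = 0"
    and jump: "\<And>T T' F \<nu> x. \<lbrakk>T \<in> \<T>; T' \<in> \<T>; F facet_of T; F facet_of T'; normal_to F \<nu>; x \<in> F\<rbrakk>
      \<Longrightarrow> \<nu> \<bullet> g T x = \<nu> \<bullet> g T' x"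
  shows "(\<Sum>T\<in>\<T>. \<integral>x. indicator T x * divergence (g' T) x \<partial>lborel) = 0"
proof -
  note gridD = conforming_gridD[OF grid]
  note V = simplex_3D[OF gridD(2)]
  define P where "P = Sigma \<T> vertices"
  define face where "face p = opposite_facet (fst p) (snd p)" for p
  have fin: "finite \<T>" "T \<in> \<T> \<Longrightarrow> finite (vertices T)" for T
    using gridD(1) V(1) by (auto simp: tetra_vertices_def)
  have facet: "face p facet_of fst p" "fst p \<in> \<T>" "snd p \<in> vertices (fst p)"
    "vertices (fst p) - {snd p} = vertices (face p)" if "p \<in> P" for p
  proof -
    show T: "fst p \<in> \<T>" "snd p \<in> vertices (fst p)"
      using that by (auto simp: P_def)
    show "face p facet_of fst p"
      unfolding face_def facet_of_simplex_3[OF gridD(2)[OF T(1)]] using T(2) by blast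
    show "vertices (fst p) - {snd p} = vertices (face p)"
      unfolding face_def by (rule vertices_opposite_facet[OF gridD(2)[OF T(1)], symmetric])
  qed
  have same_tetra: "p = q" if "p \<in> P" "q \<in> P" "face p = face q" "fst p = fst q" for p q
    using facet(3,4)[OF that(1)] facet(3,4)[OF that(2)] that(3,4) by (auto simp: prod_eq_iff)
  have exists: "\<exists>q\<in>P. q \<noteq> p \<and> face q = face p" if p: "p \<in> P" "face p \<inter> \<Omega> \<noteq> {}" for p
  proof -
    obtain T' where T': "T' \<in> \<T>" "T' \<noteq> fst p" "face p facet_of T'"
      using interior_facet_shared[OF grid facet(2,1)[OF p(1)] p(2)] by blast
    then obtain w' where "w' \<in> vertices T'" "face p = opposite_facet T' w'"
      using facet_of_simplex_3[OF gridD(2)[OF T'(1)]] by blast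
    then show ?thesis
      using T' by (intro bexI[of _ "(T', w')"]) (auto simp: P_def face_def)
  qed
  have unique: "q = r" if "p \<in> P" "q \<in> P" "r \<in> P" "q \<noteq> p" "r \<noteq> p" "face q = face p" "face r = face p" for p q r
  proof -
    have "fst q = fst r"
      using facet_shared_by_at_most_two[OF grid facet(2,3)[OF that(1)] refl
          facet(2,3)[OF that(2)] _ facet(2,3)[OF that(3)]] facet(4) that same_tetra by metis
    then show ?thesis
      using same_tetra that by metis
  qed
  define \<sigma> where "\<sigma> p = (if face p \<inter> \<Omega> = {} then p else (SOME q. q \<in> P \<and> q \<noteq> p \<and> face q = face p))" for p
  have \<sigma>_interior: "\<sigma> p \<in> P \<and> \<sigma> p \<noteq> p \<and> face (\<sigma> p) = face p" if "p \<in> P" "face p \<inter> \<Omega> \<noteq> {}" for p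
    using someI_ex[of "\<lambda>q. q \<in> P \<and> q \<noteq> p \<and> face q = face p"] exists[OF that] that(2)
    unfolding \<sigma>_def by auto
  have \<sigma>_P: "\<sigma> p \<in> P" "\<sigma> (\<sigma> p) = p" if p: "p \<in> P" for p
  proof -
    show "\<sigma> p \<in> P"
      using \<sigma>_interior p by (cases "face p \<inter> \<Omega> = {}") (auto simp: \<sigma>_def)
    show "\<sigma> (\<sigma> p) = p"
    proof (cases "face p \<inter> \<Omega> = {}")
      case False
      note s = \<sigma>_interior[OF p False]
      then have "\<sigma> (\<sigma> p) \<in> P \<and> \<sigma> (\<sigma> p) \<noteq> \<sigma> p \<and> face (\<sigma> (\<sigma> p)) = face (\<sigma> p)"
        using False by (intro \<sigma>_interior) auto
      then show ?thesis
        using unique[of "\<sigma> p" "\<sigma> (\<sigma> p)" p] s p by metis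
    qed (simp add: \<sigma>_def)
  qed
  then have bij: "bij_betw \<sigma> P P"
    by (intro bij_betwI[where g = \<sigma>]) auto
  have "(\<lambda>n. flux_layer g n p + flux_layer g n (\<sigma> p)) \<longlonglongrightarrow> 0" if p: "p \<in> P" for p
  proof (cases "face p \<inter> \<Omega> = {}")
    case True
    define T w where "T = fst p" and "w = snd p"
    have Tw: "T \<in> \<T>" "w \<in> vertices T"
      using facet[OF p] by (auto simp: T_def w_def)
    have h: "has_C1_derivative (\<lambda>x. bary_grad (vertices T) w \<bullet> g T x) (\<lambda>x v. bary_grad (vertices T) w \<bullet> g' T x v)"
      unfolding has_C1_derivative_def
      by (intro conjI allI has_derivative_inner_right continuous_intros has_C1_derivativeD[OF g[OF Tw(1)]])
    have "(\<lambda>n. flux_layer g n p) \<longlonglongrightarrow> 0"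
      unfolding flux_layer_def T_def[symmetric] w_def[symmetric]
    proof (rule integral_layer_tendsto_0[OF V(1)[OF Tw(1)] Tw(2) h])
      fix x assume "x \<in> opposite_facet T w"
      then show "bary_grad (vertices T) w \<bullet> g T x = 0"
        using boundary[OF Tw(1) _ _ bary_grad_normal[OF V(1)[OF Tw(1)] Tw(2)]] True facet(1)[OF p]
        by (auto simp: face_def T_def w_def)
    qed
    then show ?thesis
      using tendsto_add[of "\<lambda>n. flux_layer g n p" 0 _ "\<lambda>n. flux_layer g n p" 0] True by (simp add: \<sigma>_def)
  next
    case False
    note s = \<sigma>_interior[OF p False]
    define T w T' w' where "T = fst p" and "w = snd p" and "T' = fst (\<sigma> p)" and "w' = snd (\<sigma> p)"
    define K where "K = vertices (face p)"
    have T: "T \<in> \<T>" "w \<in> vertices T" "vertices T - {w} = K" "face p facet_of T"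
      using facet[OF p] by (simp_all add: T_def w_def K_def)
    have T': "T' \<in> \<T>" "w' \<in> vertices T'" "vertices T' - {w'} = K" "face p facet_of T'"
      using facet[OF conjunct1[OF s]] s by (simp_all add: T'_def w'_def K_def)
    have ne: "T \<noteq> T'"
      using same_tetra[OF p conjunct1[OF s]] s by (auto simp: T_def T'_def)
    note C = facet_opposite_vertex[OF grid T(1-3)] and C' = facet_opposite_vertex[OF grid T'(1-3)]
    have K: "face p = convex hull K"
      unfolding T(3)[symmetric] by (simp add: face_def T_def w_def)
    have "bary_grad (vertices T') w' \<bullet> g T x = bary_grad (vertices T') w' \<bullet> g T' x" if "x \<in> convex hull K" for x
    proof (rule jump[OF T(1) T'(1) T(4) T'(4)])
      show "normal_to (face p) (bary_grad (vertices T') w')"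
        using bary_grad_normal[OF V(1)[OF T'(1)] T'(2)] T'(3) K by simp
      show "x \<in> face p"
        using that K by simp
    qed
    then show ?thesis
      using reflected_layers_cancel[OF C(1,2) C'(1,2) _ g[OF T(1)] g[OF T'(1)]]
        grid_neighbours_opposite[OF grid T(1-3) T'(1-3) ne] C(4) C'(4)
      unfolding flux_layer_def T_def[symmetric] w_def[symmetric] T'_def[symmetric] w'_def[symmetric]
      by simp
  qed
  then have "(\<lambda>n. \<Sum>p\<in>P. flux_layer g n p + flux_layer g n (\<sigma> p)) \<longlonglongrightarrow> (\<Sum>p\<in>P. 0)"
    by (intro tendsto_sum)
  moreover have "(\<Sum>p\<in>P. flux_layer g n p + flux_layer g n (\<sigma> p)) = 2 * (\<Sum>p\<in>P. flux_layer g n p)" for n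
    using sum.reindex_bij_betw[OF bij, of "flux_layer g n"] by (simp add: sum.distrib)
  ultimately have lim0: "(\<lambda>n. 2 * (\<Sum>p\<in>P. flux_layer g n p)) \<longlonglongrightarrow> 0"
    by simp
  have "(\<Sum>T\<in>\<T>. \<integral>x. cutoff (vertices T) (1 / real (Suc n)) x * divergence (g' T) x \<partial>lborel) =
      - (\<Sum>p\<in>P. flux_layer g n p)" for n
  proof -
    have "(\<Sum>T\<in>\<T>. \<integral>x. cutoff (vertices T) (1 / real (Suc n)) x * divergence (g' T) x \<partial>lborel) =
        (\<Sum>T\<in>\<T>. - (\<Sum>w\<in>vertices T. flux_layer g n (T, w)))"
      by (intro sum.cong refl) (subst integral_cutoff_divergence[OF V(1) _ g], auto simp: flux_layer_def)
    also have "\<dots> = - (\<Sum>p\<in>P. flux_layer g n p)"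
      using fin by (simp add: sum_negf P_def sum.Sigma)
    finally show ?thesis .
  qed
  moreover have "(\<lambda>n. \<Sum>T\<in>\<T>. \<integral>x. cutoff (vertices T) (1 / real (Suc n)) x * divergence (g' T) x \<partial>lborel) \<longlonglongrightarrow>
      (\<Sum>T\<in>\<T>. \<integral>x. indicator T x * divergence (g' T) x \<partial>lborel)"
  proof (intro tendsto_sum)
    fix T assume T: "T \<in> \<T>"
    show "(\<lambda>n. \<integral>x. cutoff (vertices T) (1 / real (Suc n)) x * divergence (g' T) x \<partial>lborel) \<longlonglongrightarrow>
        (\<integral>x. indicator T x * divergence (g' T) x \<partial>lborel)"
      using integral_cutoff_tendsto[OF V(1)[OF T] continuous_divergence[OF g[OF T]]] V(2)[OF T] by simp
  qed
  moreover have "(\<lambda>n. - (\<Sum>p\<in>P. flux_layer g n p)) \<longlonglongrightarrow> 0"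
    using tendsto_mult_left[OF lim0, of "- 1 / 2"] by simp
  ultimately show ?thesis
    using LIMSEQ_unique by fastforce
qed

section \<open>Unisolvence of the Lagrange points of a triangle\<close>

text \<open>
Polynomials in two variables of total degree at most \<open>k\<close>, in Newton form with respect to the second
variable at the nodes \<open>0, 1, 2, \<dots>\<close>. In this form the values on the row \<open>t = j\<close> involve only the
coefficient polynomials with index at most \<open>j\<close>, so unisolvence becomes a triangular system.
\<close>

definition bivariate_poly :: "nat \<Rightarrow> (real \<Rightarrow> real \<Rightarrow> real) \<Rightarrow> bool" where
  "bivariate_poly k f \<longleftrightarrow> (\<exists>p :: nat \<Rightarrow> real poly.
     (\<forall>j. p j = 0 \<or> degree (p j) + j \<le> k) \<and>
     (\<forall>s t. f s t = (\<Sum>j\<le>k. poly (p j) s * (\<Prod>m<j. t - real m))))"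

lemma bivariate_polyE:
  assumes "bivariate_poly k f"
  obtains p :: "nat \<Rightarrow> real poly" where "\<forall>j. p j = 0 \<or> degree (p j) + j \<le> k"
    "\<forall>s t. f s t = (\<Sum>j\<le>k. poly (p j) s * (\<Prod>m<j. t - real m))"
  using assms unfolding bivariate_poly_def by (elim exE conjE)

lemma bivariate_poly_const: "bivariate_poly k (\<lambda>s t. c)"
  unfolding bivariate_poly_def
proof (intro exI conjI allI)
  fix s t :: real
  have "(\<Sum>j\<le>k. poly (if j = 0 then [:c:] else 0) s * (\<Prod>m<j. t - real m)) = (\<Sum>j\<le>k. if j = 0 then c else 0)"
    by (intro sum.cong) auto
  then show "c = (\<Sum>j\<le>k. poly (if j = 0 then [:c:] else 0) s * (\<Prod>m<j. t - real m))"
    by simp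
qed auto

lemma bivariate_poly_add:
  assumes "bivariate_poly k f" "bivariate_poly k g"
  shows "bivariate_poly k (\<lambda>s t. f s t + g s t)"
proof -
  obtain p where p: "\<forall>j. p j = 0 \<or> degree (p j) + j \<le> k"
      "\<forall>s t. f s t = (\<Sum>j\<le>k. poly (p j) s * (\<Prod>m<j. t - real m))"
    by (rule bivariate_polyE[OF assms(1)])
  obtain q where q: "\<forall>j. q j = 0 \<or> degree (q j) + j \<le> k"
      "\<forall>s t. g s t = (\<Sum>j\<le>k. poly (q j) s * (\<Prod>m<j. t - real m))"
    by (rule bivariate_polyE[OF assms(2)])
  have "p j + q j = 0 \<or> degree (p j + q j) + j \<le> k" for j
  proof (cases "p j = 0 \<or> q j = 0")
    case True
    then show ?thesis
      using p(1) q(1) by auto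
  next
    case False
    then have "degree (p j) + j \<le> k" "degree (q j) + j \<le> k"
      using p(1) q(1) by auto
    then show ?thesis
      using degree_add_le_max[of "p j" "q j"] by linarith
  qed
  then show ?thesis
    unfolding bivariate_poly_def
    by (intro exI[of _ "\<lambda>j. p j + q j"]) (simp add: p(2) q(2) distrib_right sum.distrib)
qed

lemma bivariate_poly_cmult:
  assumes "bivariate_poly k f"
  shows "bivariate_poly k (\<lambda>s t. c * f s t)"
proof -
  obtain p where p: "\<forall>j. p j = 0 \<or> degree (p j) + j \<le> k"
      "\<forall>s t. f s t = (\<Sum>j\<le>k. poly (p j) s * (\<Prod>m<j. t - real m))"
    by (rule bivariate_polyE[OF assms(1)])
  have "smult c (p j) = 0 \<or> degree (smult c (p j)) + j \<le> k" for j
    using p(1) by (auto simp: degree_smult_eq)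
  then show ?thesis
    unfolding bivariate_poly_def
    by (intro exI[of _ "\<lambda>j. smult c (p j)"]) (simp add: p(2) sum_distrib_left mult.assoc)
qed

lemma bivariate_poly_mono:
  assumes "bivariate_poly k f" "k \<le> l"
  shows "bivariate_poly l f"
proof -
  obtain p where p: "\<forall>j. p j = 0 \<or> degree (p j) + j \<le> k"
      "\<forall>s t. f s t = (\<Sum>j\<le>k. poly (p j) s * (\<Prod>m<j. t - real m))"
    by (rule bivariate_polyE[OF assms(1)])
  have "p j = 0" if "k < j" for j
    using p(1) that by (metis leD le_add2 le_trans)
  then have "(\<Sum>j\<le>k. poly (p j) s * (\<Prod>m<j. t - real m)) = (\<Sum>j\<le>l. poly (p j) s * (\<Prod>m<j. t - real m))" for s t
    using assms(2) by (intro sum.mono_neutral_left) auto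
  then show ?thesis
    unfolding bivariate_poly_def using p assms(2) by (intro exI[of _ p]) (metis le_trans)
qed

lemma bivariate_poly_mult_fst:
  assumes "bivariate_poly k f"
  shows "bivariate_poly (Suc k) (\<lambda>s t. s * f s t)"
proof -
  obtain p where p: "\<forall>j. p j = 0 \<or> degree (p j) + j \<le> k"
      "\<forall>s t. f s t = (\<Sum>j\<le>k. poly (p j) s * (\<Prod>m<j. t - real m))"
    by (rule bivariate_polyE[OF assms(1)])
  have "p (Suc k) = 0"
    using p(1) by (metis not_less_eq_eq le_add2 le_trans)
  moreover have "pCons 0 (p j) = 0 \<or> degree (pCons 0 (p j)) + j \<le> Suc k" for j
    using p(1) by (auto simp: degree_pCons_eq_if)
  ultimately show ?thesis
    unfolding bivariate_poly_def
    by (intro exI[of _ "\<lambda>j. pCons 0 (p j)"]) (simp add: p(2) sum_distrib_left mult.assoc)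
qed

text \<open>
Multiplication by \<open>t = (t - j) + j\<close> shifts the Newton basis and adds a multiple of it.
\<close>

lemma bivariate_poly_mult_snd:
  assumes "bivariate_poly k f"
  shows "bivariate_poly (Suc k) (\<lambda>s t. t * f s t)"
proof -
  obtain p where p: "\<forall>j. p j = 0 \<or> degree (p j) + j \<le> k"
      "\<forall>s t. f s t = (\<Sum>j\<le>k. poly (p j) s * (\<Prod>m<j. t - real m))"
    by (rule bivariate_polyE[OF assms(1)])
  define q where "q j = (case j of 0 \<Rightarrow> 0 | Suc i \<Rightarrow> p i)" for j
  have "p (Suc k) = 0"
    using p(1) by (metis not_less_eq_eq le_add2 le_trans)
  have "bivariate_poly (Suc k) (\<lambda>s t. \<Sum>j\<le>Suc k. poly (q j) s * (\<Prod>m<j. t - real m))"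
    unfolding bivariate_poly_def using p(1)
    by (intro exI[of _ q]) (auto simp: q_def split: nat.split)
  moreover have "bivariate_poly (Suc k) (\<lambda>s t. \<Sum>j\<le>Suc k. poly (smult (real j) (p j)) s * (\<Prod>m<j. t - real m))"
    unfolding bivariate_poly_def
  proof (intro exI[of _ "\<lambda>j. smult (real j) (p j)"] conjI allI refl)
    show "smult (real j) (p j) = 0 \<or> degree (smult (real j) (p j)) + j \<le> Suc k" for j
      using spec[OF p(1), of j] by (auto simp: degree_smult_eq)
  qed
  ultimately have "bivariate_poly (Suc k) (\<lambda>s t. (\<Sum>j\<le>Suc k. poly (q j) s * (\<Prod>m<j. t - real m)) +
      (\<Sum>j\<le>Suc k. poly (smult (real j) (p j)) s * (\<Prod>m<j. t - real m)))"
    by (rule bivariate_poly_add)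
  also have "(\<lambda>s t. (\<Sum>j\<le>Suc k. poly (q j) s * (\<Prod>m<j. t - real m)) +
      (\<Sum>j\<le>Suc k. poly (smult (real j) (p j)) s * (\<Prod>m<j. t - real m))) = (\<lambda>s t. t * f s t)"
  proof (intro ext)
    fix s t
    have "(\<Sum>j\<le>Suc k. poly (q j) s * (\<Prod>m<j. t - real m)) = (\<Sum>j\<le>k. poly (p j) s * ((\<Prod>m<j. t - real m) * (t - real j)))"
      by (subst sum.atMost_Suc_shift) (simp add: q_def)
    moreover have "(\<Sum>j\<le>Suc k. poly (smult (real j) (p j)) s * (\<Prod>m<j. t - real m)) = (\<Sum>j\<le>k. poly (p j) s * ((\<Prod>m<j. t - real m) * real j))"
      by (simp add: \<open>p (Suc k) = 0\<close> mult_ac)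
    ultimately show "(\<Sum>j\<le>Suc k. poly (q j) s * (\<Prod>m<j. t - real m)) +
      (\<Sum>j\<le>Suc k. poly (smult (real j) (p j)) s * (\<Prod>m<j. t - real m)) = t * f s t"
      by (simp add: p(2) sum_distrib_left flip: sum.distrib) (simp add: algebra_simps)
  qed
  finally show ?thesis .
qed

lemma bivariate_poly_mult_affine:
  assumes "bivariate_poly k f"
  shows "bivariate_poly (Suc k) (\<lambda>s t. (\<alpha> + \<beta> * s + \<gamma> * t) * f s t)"
proof -
  have "bivariate_poly (Suc k) (\<lambda>s t. (\<alpha> * f s t + \<beta> * (s * f s t)) + \<gamma> * (t * f s t))"
    by (intro bivariate_poly_add bivariate_poly_cmult bivariate_poly_mult_fst bivariate_poly_mult_snd
        bivariate_poly_mono[OF assms] assms) simp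
  then show ?thesis
    by (simp add: algebra_simps)
qed

lemma bivariate_poly_mult_affine_power:
  assumes "bivariate_poly k f"
  shows "bivariate_poly (k + n) (\<lambda>s t. (\<alpha> + \<beta> * s + \<gamma> * t) ^ n * f s t)"
proof (induction n)
  case (Suc n)
  then show ?case
    using bivariate_poly_mult_affine[OF Suc, of \<alpha> \<beta> \<gamma>] by (simp add: mult.assoc)
qed (use assms in simp)

lemma bivariate_poly_prod_affine:
  assumes "finite I"
  shows "bivariate_poly (\<Sum>i\<in>I. e i) (\<lambda>s t. \<Prod>i\<in>I. (\<alpha> i + \<beta> i * s + \<gamma> i * t) ^ e i)"
  using assms
proof (induction I)
  case empty
  then show ?case
    using bivariate_poly_const[of 0 1] by simp
next
  case (insert i I)
  then show ?case
    using bivariate_poly_mult_affine_power[OF insert.IH, of "e i" "\<alpha> i" "\<beta> i" "\<gamma> i"]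
    by (simp add: add.commute)
qed

lemma bivariate_poly_sum:
  "finite A \<Longrightarrow> (\<And>a. a \<in> A \<Longrightarrow> bivariate_poly k (f a)) \<Longrightarrow> bivariate_poly k (\<lambda>s t. \<Sum>a\<in>A. f a s t)"
proof (induction A rule: finite_induct)
  case (insert a A)
  then show ?case
    using bivariate_poly_add[of k "f a" "\<lambda>s t. \<Sum>a\<in>A. f a s t"] by simp
qed (use bivariate_poly_const[of k 0] in simp)

text \<open>
By induction on \<open>j\<close>, the coefficient polynomial \<open>p j\<close> vanishes: on the row \<open>t = j\<close> it is the only
term left, its degree is at most \<open>k - j\<close>, and it has the \<open>k - j + 1\<close> zeros \<open>0, \<dots>, k - j\<close>.
\<close>

lemma bivariate_poly_unisolvent:
  assumes f: "bivariate_poly k f" and zero: "\<And>i j. i + j \<le> k \<Longrightarrow> f (real i) (real j) = 0"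
  shows "f s t = 0"
proof -
  obtain p where p: "\<forall>j. p j = 0 \<or> degree (p j) + j \<le> k"
      "\<forall>s t. f s t = (\<Sum>j\<le>k. poly (p j) s * (\<Prod>m<j. t - real m))"
    by (rule bivariate_polyE[OF assms(1)])
  have "p j = 0" for j
  proof (induction j rule: less_induct)
    case (less j)
    show "p j = 0"
    proof (rule ccontr)
      assume nz: "p j \<noteq> 0"
      then have deg: "degree (p j) + j \<le> k"
        using p(1) by blast
      have "poly (p j) (real i) = 0" if "i \<le> k - j" for i
      proof -
        have "poly (p l) (real i) * (\<Prod>m<l. real j - real m) = 0" if "l \<noteq> j" for l
        proof (cases "l < j")
          case True
          then show ?thesis
            using less by simp
        next
          case False
          then have "(\<Prod>m<l. real j - real m) = 0"
            using that by (intro prod_zero) auto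
          then show ?thesis
            by simp
        qed
        then have "f (real i) (real j) = (\<Sum>l\<le>k. if l = j then poly (p j) (real i) * (\<Prod>m<j. real j - real m) else 0)"
          unfolding p(2)[rule_format] by (intro sum.cong) auto
        then have "poly (p j) (real i) * (\<Prod>m<j. real j - real m) = 0"
          using zero[of i j] that deg by simp
        then show ?thesis
          by simp
      qed
      then have "p j = 0"
        using nz deg by (intro poly_eqI_degree[of "real ` {..k - j}"]) (auto simp: card_image)
      then show False
        using nz by simp
    qed
  qed
  then show ?thesis
    using p(2) by simp
qed

definition scalar_polynomial :: "nat \<Rightarrow> (real^3 \<Rightarrow> real) \<Rightarrow> bool" where
  "scalar_polynomial k q \<longleftrightarrow>
     (\<exists>c. \<forall>x. q x = (\<Sum>\<alpha>\<in>multi_indices k. (\<Prod>i\<in>UNIV. (x $ i) ^ (\<alpha> $ i)) * c \<alpha>))"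

lemma bivariate_poly_restriction:
  assumes "scalar_polynomial k q"
  shows "bivariate_poly k (\<lambda>s t. q (a + s *\<^sub>R u + t *\<^sub>R v))"
proof -
  obtain c where c: "\<forall>x. q x = (\<Sum>\<alpha>\<in>multi_indices k. (\<Prod>i\<in>UNIV. (x $ i) ^ (\<alpha> $ i)) * c \<alpha>)"
    using assms unfolding scalar_polynomial_def by blast
  have "bivariate_poly k (\<lambda>s t. \<Sum>\<alpha>\<in>multi_indices k. c \<alpha> * (\<Prod>i\<in>UNIV. (a $ i + u $ i * s + v $ i * t) ^ (\<alpha> $ i)))"
  proof (intro bivariate_poly_sum finite_multi_indices bivariate_poly_cmult)
    fix \<alpha> assume "\<alpha> \<in> multi_indices k"
    then show "bivariate_poly k (\<lambda>s t. \<Prod>i\<in>UNIV. (a $ i + u $ i * s + v $ i * t) ^ (\<alpha> $ i))"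
      using bivariate_poly_mono[OF bivariate_poly_prod_affine[of UNIV "\<lambda>i. \<alpha> $ i"]]
      by (auto simp: multi_indices_def)
  qed
  then show ?thesis
    by (simp add: c mult.commute)
qed

text \<open>
The affine parametrization of the triangle that maps \<open>(i, j)\<close> to the Lagrange point with barycentric
coordinates \<open>(k - i - j) / k\<close>, \<open>i / k\<close>, \<open>j / k\<close> turns \<open>q\<close> into a bivariate polynomial.
\<close>

lemma triangle_lagrange_unisolvent:
  assumes q: "scalar_polynomial k q" and k: "1 \<le> k" and K: "card K = 3"
    and zero: "\<And>m. (\<Sum>v\<in>K. m v) = k \<Longrightarrow> q (\<Sum>v\<in>K. (real (m v) / real k) *\<^sub>R v) = 0"
    and x: "x \<in> convex hull K"
  shows "q x = 0"
proof -
  obtain a b c where abc: "K = {a, b, c}" "a \<noteq> b" "a \<noteq> c" "b \<noteq> c"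
    using K by (auto simp: card_3_iff)
  define f where "f s t = q (a + s *\<^sub>R ((1 / real k) *\<^sub>R (b - a)) + t *\<^sub>R ((1 / real k) *\<^sub>R (c - a)))" for s t
  have "f (real i) (real j) = 0" if "i + j \<le> k" for i j
  proof -
    define m where "m v = (if v = a then k - (i + j) else if v = b then i else j)" for v
    have "(\<Sum>v\<in>K. m v) = k"
      using abc that by (simp add: m_def)
    then have "q (\<Sum>v\<in>K. (real (m v) / real k) *\<^sub>R v) = 0"
      by (rule zero)
    also have "(\<Sum>v\<in>K. (real (m v) / real k) *\<^sub>R v) =
        a + real i *\<^sub>R ((1 / real k) *\<^sub>R (b - a)) + real j *\<^sub>R ((1 / real k) *\<^sub>R (c - a))"
    proof -
      have "real (k - (i + j)) / real k = 1 - real i / real k - real j / real k"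
        using that k by (simp add: of_nat_diff field_simps)
      moreover have "(\<Sum>v\<in>K. (real (m v) / real k) *\<^sub>R v) =
          (real (k - (i + j)) / real k) *\<^sub>R a + (real i / real k) *\<^sub>R b + (real j / real k) *\<^sub>R c"
        using abc by (simp add: m_def)
      ultimately show ?thesis
        by (simp only:) (simp add: scaleR_diff_left scaleR_diff_right)
    qed
    finally show ?thesis
      by (simp add: f_def)
  qed
  moreover have "bivariate_poly k f"
    unfolding f_def by (rule bivariate_poly_restriction[OF q])
  ultimately have f0: "f s t = 0" for s t
    using bivariate_poly_unisolvent by blast
  obtain r s t where "r + s + t = 1" "x = r *\<^sub>R a + s *\<^sub>R b + t *\<^sub>R c"
    using x unfolding abc(1) convex_hull_3 by blast
  then have "r = 1 - s - t" and x_eq: "x = r *\<^sub>R a + s *\<^sub>R b + t *\<^sub>R c"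
    by simp_all
  have "x = a + (s * real k) *\<^sub>R ((1 / real k) *\<^sub>R (b - a)) + (t * real k) *\<^sub>R ((1 / real k) *\<^sub>R (c - a))"
    unfolding x_eq \<open>r = 1 - s - t\<close> using k by (simp add: scaleR_diff_left scaleR_diff_right)
  then show ?thesis
    using f0[of "s * real k" "t * real k"] by (simp add: f_def)
qed

section \<open>Degrees of freedom and jumps of the tangential trace\<close>

text \<open>
Twice the symmetric part of the row-wise cross product of \<open>J\<close> with \<open>n\<close>, as a bilinear form in \<open>c\<close> and \<open>d\<close>.
\<close>

definition jump_form :: "real^3^3 \<Rightarrow> real^3 \<Rightarrow> real^3 \<Rightarrow> real^3 \<Rightarrow> real" where
  "jump_form J n c d = sandwich c J (cross3 n d) + sandwich d J (cross3 n c)"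

lemma jump_form_commute: "jump_form J n c d = jump_form J n d c"
  by (simp add: jump_form_def)

lemma linear_jump_form: "linear (\<lambda>c. jump_form J n c d)"
  by (auto intro!: linearI simp: jump_form_def inner_add_left cross_add_right cross_mult_right
      matrix_vector_right_distrib inner_add_right matrix_vector_mult_scaleR algebra_simps)

lemma linear_jump_form_normal: "linear (\<lambda>n. jump_form J n c d)"
  by (auto intro!: linearI simp: jump_form_def cross_add_left cross_mult_left
      matrix_vector_right_distrib inner_add_right matrix_vector_mult_scaleR algebra_simps)

lemma linear_jump_form_matrix: "linear (\<lambda>J. jump_form J n c d)"
  by (auto intro!: linearI simp: jump_form_def matrix_vector_mult_add_rdistrib inner_add_right
      scaleR_matrix_vector_assoc[symmetric] algebra_simps)

lemma jump_form_zero_on_span: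
  assumes "span B = UNIV" "\<And>c d. c \<in> B \<Longrightarrow> d \<in> B \<Longrightarrow> jump_form J n c d = 0"
  shows "jump_form J n c d = 0"
proof -
  have "jump_form J n c d = 0" if "d \<in> B" for c d
    using linear_eq_0_on_span[OF linear_jump_form, of B J n d c] assms that by auto
  then show ?thesis
    using linear_eq_0_on_span[OF linear_jump_form, of B J n c d] assms(1)
    by (auto simp: jump_form_commute[of J n _ c])
qed

lemma span_three:
  fixes a b c :: "real^3"
  assumes "distinct [a, b, c]" "independent {a, b, c}"
  shows "span {a, b, c} = UNIV"
  using card_ge_dim_independent[OF _ assms(2), of UNIV] assms(1) by (auto simp: dim_UNIV)

text \<open>
The row-wise cross product of the identity with a vector is skew. This is why the vertex conditions
need not fix the trace.
\<close>

lemma jump_form_mat_multiple: "jump_form (r *\<^sub>R mat 1) n c d = 0"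
proof -
  have "c \<bullet> cross3 n d = - (d \<bullet> cross3 n c)"
    by (simp add: cross3_simps)
  then show ?thesis
    by (simp add: jump_form_def flip: scaleR_matrix_vector_assoc)
qed

lemma jump_form_zero_face:
  assumes "distinct [a, b, n]" "independent {a, b, n}"
    and "sandwich a J (cross3 n a) = 0" "sandwich b J (cross3 n b) = 0"
    and "sandwich a J (cross3 n b) + sandwich b J (cross3 n a) = 0"
    and "sandwich n J (cross3 n a) = 0" "sandwich n J (cross3 n b) = 0"
  shows "jump_form J n c d = 0"
  by (rule jump_form_zero_on_span[OF span_three[OF assms(1,2)]])
     (use assms in \<open>auto simp: jump_form_def cross_refl\<close>)

text \<open>
The form is tested on the orthonormal basis \<open>{t, t \<times> n, n}\<close>. Since \<open>n \<times> (t \<times> n) = t\<close>, the pairs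
that involve \<open>t \<times> n\<close> and one of \<open>n\<close>, \<open>t \<times> n\<close> reduce to \<open>J t\<close> tested with vectors orthogonal to the edge.
\<close>

lemma jump_form_zero_edge:
  fixes t n :: "real^3"
  assumes tn: "norm t = 1" "norm n = 1" "t \<bullet> n = 0"
    and normals: "n \<in> span N" "cross3 t n \<in> span N" "\<And>m. m \<in> N \<Longrightarrow> sandwich m J t = 0"
    and "sandwich t J (cross3 n t) = 0" "sandwich n J (cross3 n t) = 0"
    and "sandwich t J (cross3 n (cross3 t n)) + sandwich (cross3 t n) J (cross3 n t) = 0"
  shows "jump_form J n c d = 0"
proof -
  define e where "e = cross3 t n"
  have tt: "t \<bullet> t = 1" "n \<bullet> n = 1"
    using tn by (simp_all add: norm_eq_1)
  have orth: "t \<bullet> e = 0" "n \<bullet> e = 0"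
    by (simp_all add: e_def dot_cross_self)
  have "e \<bullet> e = 1"
    unfolding e_def using tt tn(3) by (simp add: dot_cross inner_commute)
  then have dist: "distinct [t, e, n]"
    using orth tt tn(3) by (auto simp: inner_commute)
  have "independent {t, e, n}"
    using orth tt tn(3) \<open>e \<bullet> e = 1\<close>
    by (intro pairwise_orthogonal_independent) (auto simp: pairwise_def orthogonal_def inner_commute)
  note span = span_three[OF dist this]
  have "cross3 n e = t"
    unfolding e_def using tt tn(3) by (simp add: Lagrange inner_commute)
  have zero: "sandwich m J t = 0" if "m \<in> span N" for m
    using that normals(3)
  proof (induction rule: span_induct)
    case base
    show ?case
      by (auto simp: subspace_def inner_add_left)
  qed auto
  show ?thesis
    by (rule jump_form_zero_on_span[OF span])
       (use assms(7-9) zero[OF normals(1)] zero[OF normals(2)] \<open>cross3 n e = t\<close>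
         in \<open>auto simp: jump_form_def cross_refl e_def[symmetric]\<close>)
qed

lemma constant_onD: "f constant_on S \<Longrightarrow> x \<in> S \<Longrightarrow> y \<in> S \<Longrightarrow> f x = f y"
  by (auto simp: constant_on_def)

lemma sandwich_diff: "sandwich a (A - B) b = sandwich a A b - sandwich a B b"
  by (simp add: matrix_vector_mult_diff_rdistrib inner_diff_right)

lemma jump_vertex:
  assumes W: "vertex_conditions \<T> W" and T: "T \<in> \<T>" "T' \<in> \<T>" "v extreme_point_of T" "v extreme_point_of T'"
  shows "jump_form (W T v - W T' v) n c d = 0"
proof -
  define J where "J = W T v - W T' v"
  have mem: "T \<in> {T \<in> \<T>. v extreme_point_of T}" "T' \<in> {T \<in> \<T>. v extreme_point_of T}"
    using T by auto
  have off: "J $ i $ j = 0" if "i \<noteq> j" for i j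
    using constant_onD[of "\<lambda>T. W T v $ i $ j", OF _ mem] W that
    by (simp add: vertex_conditions_def Let_def J_def)
  have diag: "J $ 1 $ 1 = J $ 2 $ 2" "J $ 2 $ 2 = J $ 3 $ 3"
    using constant_onD[of "\<lambda>T. W T v $ 1 $ 1 - W T v $ 2 $ 2", OF _ mem]
      constant_onD[of "\<lambda>T. W T v $ 2 $ 2 - W T v $ 3 $ 3", OF _ mem] W
    by (simp_all add: vertex_conditions_def Let_def J_def)
  have "J $ i $ i = J $ 1 $ 1" for i
    using diag exhaust_3[of i] by auto
  then have "J = (J $ 1 $ 1) *\<^sub>R mat 1"
    using off by (auto simp: vec_eq_iff mat_def)
  then show ?thesis
    using jump_form_mat_multiple J_def by metis
qed

lemma jump_edge:
  assumes W: "edge_conditions \<T> D k W" and D: "admissible_vectors \<T> D"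
    and T: "T \<in> \<T>" "T' \<in> \<T>" "E edge_of T" "E edge_of T'"
    and F: "F facet_of T" "F facet_of T'" "E edge_of F" and E: "E = convex hull {p, q}"
    and L: "L \<in> lagrange_points k T" "L \<in> rel_interior E"
  shows "jump_form (W T L - W T' L) (face_normal D F) c d = 0"
proof -
  define t n N where "t = edge_tangent D E" and "n = face_normal D F"
    and "N = {edge_normal1 D E, edge_normal2 D E}"
  have n: "norm n = 1" "\<forall>x\<in>F. \<forall>y\<in>F. n \<bullet> (x - y) = 0"
    using D T(1) F(1) by (auto simp: admissible_vectors_def Let_def n_def)
  have t: "norm t = 1" "t \<in> span {x - y |x y. x \<in> E \<and> y \<in> E}"
    and N: "span N = {v. \<forall>x\<in>E. \<forall>y\<in>E. v \<bullet> (x - y) = 0}"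
    using D T(1,3) by (auto simp: admissible_vectors_def Let_def t_def N_def)
  \<comment> \<open>the edge has only one direction, so orthogonality to the edge is orthogonality to \<open>t\<close>\<close>
  have along: "\<exists>r. x - y = r *\<^sub>R (q - p)" if "x \<in> E" "y \<in> E" for x y
  proof -
    obtain u u' where xy: "x = (1 - u) *\<^sub>R p + u *\<^sub>R q" "y = (1 - u') *\<^sub>R p + u' *\<^sub>R q"
      using \<open>x \<in> E\<close> \<open>y \<in> E\<close> unfolding E segment_convex_hull[symmetric] by (auto simp: in_segment)
    have "x - y = (u - u') *\<^sub>R (q - p)"
      unfolding xy by (simp add: algebra_simps)
    then show ?thesis ..
  qed
  have "{x - y |x y. x \<in> E \<and> y \<in> E} \<subseteq> span {q - p}"
    unfolding span_singleton image_def using along by blast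
  then have "t \<in> span {q - p}"
    using t(2) span_minimal[OF _ subspace_span] by blast
  then obtain r where r: "t = r *\<^sub>R (q - p)"
    by (auto simp: span_singleton)
  have "r \<noteq> 0"
    using r t(1) by auto
  then have qp: "q - p = (1 / r) *\<^sub>R t"
    by (simp add: r)
  have pq: "p \<in> E" "q \<in> E"
    unfolding E by (simp_all add: hull_inc)
  have "E \<subseteq> F"
    using edge_of_imp_subset[OF F(3)] .
  then have "t \<bullet> n = 0"
    using n(2) pq by (auto simp: r inner_commute)
  have normal: "v \<in> span N" if "v \<bullet> t = 0" for v
  proof -
    have "v \<bullet> (x - y) = 0" if "x \<in> E" "y \<in> E" for x y
      using along[OF that] \<open>v \<bullet> t = 0\<close> by (auto simp: qp)
    then show ?thesis
      by (simp add: N)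
  qed
  have cond: "(let t = edge_tangent D E; sharing = {T\<in>\<T>. E edge_of T} in
          (\<lambda>T. sandwich (edge_normal1 D E) (W T L) t) constant_on sharing \<and>
          (\<lambda>T. sandwich (edge_normal2 D E) (W T L) t) constant_on sharing \<and>
          (\<forall>F. E edge_of F \<longrightarrow>
             (let n = face_normal D F; d = cross3 t n; having = {T\<in>\<T>. F facet_of T} in
                (\<lambda>T. sandwich t (W T L) (cross3 n t)) constant_on having \<and>
                (\<lambda>T. sandwich n (W T L) (cross3 n t)) constant_on having \<and>
                (\<lambda>T. sandwich t (W T L) (cross3 n d) + sandwich d (W T L) (cross3 n t))
                   constant_on having)))"
    using W T(1,3) L unfolding edge_conditions_def by blast
  have memE: "T \<in> {T\<in>\<T>. E edge_of T}" "T' \<in> {T\<in>\<T>. E edge_of T}"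
    and memF: "T \<in> {T\<in>\<T>. F facet_of T}" "T' \<in> {T\<in>\<T>. F facet_of T}"
    using T F by auto
  have edge: "sandwich m (W T L) t = sandwich m (W T' L) t" if "m \<in> N" for m
    using that cond constant_onD[of "\<lambda>T. sandwich m (W T L) t", OF _ memE]
    unfolding Let_def N_def t_def by blast
  have face: "sandwich t (W T L) (cross3 n t) = sandwich t (W T' L) (cross3 n t)"
    "sandwich n (W T L) (cross3 n t) = sandwich n (W T' L) (cross3 n t)"
    "sandwich t (W T L) (cross3 n (cross3 t n)) + sandwich (cross3 t n) (W T L) (cross3 n t) =
     sandwich t (W T' L) (cross3 n (cross3 t n)) + sandwich (cross3 t n) (W T' L) (cross3 n t)"
    using cond F(3) constant_onD[of "\<lambda>T. sandwich t (W T L) (cross3 n t)", OF _ memF]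
      constant_onD[of "\<lambda>T. sandwich n (W T L) (cross3 n t)", OF _ memF]
      constant_onD[of "\<lambda>T. sandwich t (W T L) (cross3 n (cross3 t n)) + sandwich (cross3 t n) (W T L) (cross3 n t)", OF _ memF]
    unfolding Let_def n_def t_def by blast+
  show ?thesis
    unfolding n_def[symmetric]
  proof (rule jump_form_zero_edge[where N = N, OF t(1) n(1) \<open>t \<bullet> n = 0\<close>])
    show "n \<in> span N" "cross3 t n \<in> span N"
      using \<open>t \<bullet> n = 0\<close> by (auto intro!: normal simp: inner_commute dot_cross_self)
  qed (use edge face in \<open>simp_all add: sandwich_diff\<close>)
qed

lemma jump_face:
  assumes W: "face_conditions \<T> D k W" and D: "admissible_vectors \<T> D"
    and T: "T \<in> \<T>" "T' \<in> \<T>" and F: "F facet_of T" "F facet_of T'"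
    and L: "L \<in> lagrange_points k T" "L \<in> rel_interior F"
  shows "jump_form (W T L - W T' L) (face_normal D F) c d = 0"
proof -
  define n a b where "n = face_normal D F" and "a = face_vec1 D F" and "b = face_vec2 D F"
  have ind: "distinct [a, b, n]" "independent {a, b, n}"
    using D T(1) F(1) by (auto simp: admissible_vectors_def Let_def n_def a_def b_def)
  have cond: "(let n = face_normal D F; a\<^sub>1 = face_vec1 D F; a\<^sub>2 = face_vec2 D F;
            sharing = {T\<in>\<T>. F facet_of T} in
          (\<lambda>T. sandwich a\<^sub>1 (W T L) (cross3 n a\<^sub>1)) constant_on sharing \<and>
          (\<lambda>T. sandwich a\<^sub>2 (W T L) (cross3 n a\<^sub>2)) constant_on sharing \<and>
          (\<lambda>T. sandwich a\<^sub>1 (W T L) (cross3 n a\<^sub>2) + sandwich a\<^sub>2 (W T L) (cross3 n a\<^sub>1))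
             constant_on sharing \<and>
          (\<lambda>T. sandwich n (W T L) (cross3 n a\<^sub>1)) constant_on sharing \<and>
          (\<lambda>T. sandwich n (W T L) (cross3 n a\<^sub>2)) constant_on sharing)"
    using W T(1) F(1) L unfolding face_conditions_def by blast
  have mem: "T \<in> {T\<in>\<T>. F facet_of T}" "T' \<in> {T\<in>\<T>. F facet_of T}"
    using T F by auto
  have face: "sandwich a (W T L) (cross3 n a) = sandwich a (W T' L) (cross3 n a)"
    "sandwich b (W T L) (cross3 n b) = sandwich b (W T' L) (cross3 n b)"
    "sandwich a (W T L) (cross3 n b) + sandwich b (W T L) (cross3 n a) =
     sandwich a (W T' L) (cross3 n b) + sandwich b (W T' L) (cross3 n a)"
    "sandwich n (W T L) (cross3 n a) = sandwich n (W T' L) (cross3 n a)"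
    "sandwich n (W T L) (cross3 n b) = sandwich n (W T' L) (cross3 n b)"
    using cond constant_onD[of "\<lambda>T. sandwich a (W T L) (cross3 n a)", OF _ mem]
      constant_onD[of "\<lambda>T. sandwich b (W T L) (cross3 n b)", OF _ mem]
      constant_onD[of "\<lambda>T. sandwich a (W T L) (cross3 n b) + sandwich b (W T L) (cross3 n a)", OF _ mem]
      constant_onD[of "\<lambda>T. sandwich n (W T L) (cross3 n a)", OF _ mem]
      constant_onD[of "\<lambda>T. sandwich n (W T L) (cross3 n b)", OF _ mem]
    unfolding Let_def n_def a_def b_def by blast+
  show ?thesis
    unfolding n_def[symmetric]
    by (rule jump_form_zero_face[OF ind]) (use face in \<open>simp_all add: sandwich_diff\<close>)
qed

lemma scalar_polynomial_functional:
  assumes "W \<in> matrix_polynomials k" "W' \<in> matrix_polynomials k" "linear \<phi>"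
  shows "scalar_polynomial k (\<lambda>x. \<phi> (W x - W' x))"
proof -
  obtain c c' where "\<forall>x. W x = (\<Sum>\<alpha>\<in>multi_indices k. (\<Prod>i\<in>UNIV. (x $ i) ^ (\<alpha> $ i)) *\<^sub>R c \<alpha>)"
    "\<forall>x. W' x = (\<Sum>\<alpha>\<in>multi_indices k. (\<Prod>i\<in>UNIV. (x $ i) ^ (\<alpha> $ i)) *\<^sub>R c' \<alpha>)"
    using assms(1,2) unfolding matrix_polynomials_def by auto
  then have "\<phi> (W x - W' x) = (\<Sum>\<alpha>\<in>multi_indices k. (\<Prod>i\<in>UNIV. (x $ i) ^ (\<alpha> $ i)) * \<phi> (c \<alpha> - c' \<alpha>))" for x
    using assms(3) by (simp add: linear_diff linear_sum linear_scale right_diff_distrib sum_subtractf)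
  then show ?thesis
    unfolding scalar_polynomial_def by (intro exI[of _ "\<lambda>\<alpha>. \<phi> (c \<alpha> - c' \<alpha>)"] allI)
qed

lemma aff_dim_hull_tetra:
  assumes "tetra_vertices C" "S \<subseteq> C"
  shows "aff_dim (convex hull S) = int (card S) - 1"
proof -
  have "\<not> affine_dependent S"
    using assms affine_independent_subset[of C S] by (auto simp: tetra_vertices_def)
  then show ?thesis
    by (simp add: aff_dim_affine_independent aff_dim_convex_hull)
qed

lemma face_of_tetra:
  assumes "tetra_vertices C" "S \<subseteq> K" "K \<subseteq> C"
  shows "convex hull S face_of convex hull K"
proof -
  have "\<not> affine_dependent K"
    using assms affine_independent_subset[of C K] by (auto simp: tetra_vertices_def)
  then show ?thesis
    using assms(2) face_of_convex_hull_affine_independent by blast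
qed

text \<open>
A Lagrange point lies in the relative interior of the convex hull of the vertices with positive
weight. According to the number of these vertices, this hull is a vertex, an edge or the facet.
\<close>

lemma jump_lagrange_point:
  assumes grid: "conforming_grid \<Omega> \<T>" and D: "admissible_vectors \<T> D" and k: "1 \<le> k"
    and W: "vertex_conditions \<T> W" "edge_conditions \<T> D k W" "face_conditions \<T> D k W"
    and T: "T \<in> \<T>" "T' \<in> \<T>" and F: "F facet_of T" "F facet_of T'"
    and m: "(\<Sum>v\<in>vertices F. m v) = k"
  defines "L \<equiv> \<Sum>v\<in>vertices F. (real (m v) / real k) *\<^sub>R v"
  shows "jump_form (W T L - W T' L) (face_normal D F) c d = 0"
proof -
  note gridD = conforming_gridD[OF grid]
  have C: "tetra_vertices (vertices T)" "convex hull (vertices T) = T"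
    and C': "tetra_vertices (vertices T')" "convex hull (vertices T') = T'"
    using simplex_3D gridD(2) T by blast+
  define K where "K = vertices F"
  obtain w where w: "w \<in> vertices T" "F = opposite_facet T w"
    using F(1) facet_of_simplex_3[OF gridD(2)[OF T(1)]] by blast
  then have K: "K = vertices T - {w}" "F = convex hull K"
    using vertices_opposite_facet[OF gridD(2)[OF T(1)], of w] by (simp_all add: K_def)
  obtain w' where w': "w' \<in> vertices T'" "F = opposite_facet T' w'"
    using F(2) facet_of_simplex_3[OF gridD(2)[OF T(2)]] by blast
  then have K': "K = vertices T' - {w'}"
    using vertices_opposite_facet[OF gridD(2)[OF T(2)], of w'] by (simp_all add: K_def)
  have fin: "finite (vertices T)" "finite K" and card: "card K = 3"
    using C(1) K(1) w(1) by (auto simp: tetra_vertices_def)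
  have sub: "K \<subseteq> vertices T" "K \<subseteq> vertices T'"
    using K(1) K' by auto
  define S where "S = {v \<in> K. 0 < m v}"
  have SK: "S \<subseteq> K" and finS: "finite S"
    using fin by (auto simp: S_def)
  have mS: "sum m S = k"
    using m fin unfolding K_def[symmetric] S_def by (subst sum.mono_neutral_left[of K]) auto
  have L_S: "L = (\<Sum>v\<in>S. (real (m v) / real k) *\<^sub>R v)"
    using fin unfolding L_def K_def[symmetric] S_def by (subst sum.mono_neutral_left[of K]) auto
  have one: "(\<Sum>v\<in>S. real (m v) / real k) = 1"
    using mS k by (simp flip: sum_divide_distrib of_nat_sum)
  have LE: "L \<in> rel_interior (convex hull S)"
    by (rule rel_interior_hull_tetra[OF C(1) _ L_S one]) (use SK sub k in \<open>auto simp: S_def\<close>)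
  have LT: "L \<in> lagrange_points k T"
    unfolding lagrange_points_def
  proof (intro CollectI exI conjI)
    let ?m = "\<lambda>v. if v \<in> S then m v else 0"
    have S: "S \<subseteq> vertices T"
      using SK sub by auto
    show "L = (\<Sum>v | v extreme_point_of T. (real (?m v) / real k) *\<^sub>R v)"
      unfolding L_S by (rule sum.mono_neutral_cong_left[OF fin(1) S]) auto
    have "(\<Sum>v | v extreme_point_of T. real (?m v) / real k) = (\<Sum>v\<in>S. real (m v) / real k)"
      by (rule sum.mono_neutral_cong_right[OF fin(1) S]) auto
    then show "(\<Sum>v | v extreme_point_of T. real (?m v) / real k) = 1"
      using one by simp
  qed
  have "S \<noteq> {}"
    using mS k by auto
  then have "card S = 1 \<or> card S = 2 \<or> card S = 3"
    using card_mono[OF fin(2) SK] card finS card_gt_0_iff[of S] by linarith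
  then show ?thesis
  proof (elim disjE)
    assume "card S = 1"
    then obtain v where "S = {v}"
      by (rule card_1_singletonE)
    then have "L = v"
      using L_S one by simp
    moreover have "v \<in> K"
      using SK \<open>S = {v}\<close> by simp
    ultimately show ?thesis
      using jump_vertex[OF W(1) T] sub by blast
  next
    assume card2: "card S = 2"
    then obtain p q where "S = {p, q}"
      by (auto simp: card_2_iff)
    have "aff_dim (convex hull S) = 1"
      using aff_dim_hull_tetra[OF C(1), of S] SK sub card2 by auto
    then have "convex hull S edge_of T" "convex hull S edge_of T'" "convex hull S edge_of F"
      using face_of_tetra[OF C(1) _ subset_refl, of S] face_of_tetra[OF C'(1) _ subset_refl, of S]
        face_of_tetra[OF C(1) SK sub(1)] SK sub C(2) C'(2) K(2)
      unfolding edge_of_def by auto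
    then show ?thesis
      using jump_edge[OF W(2) D T _ _ F _ _ LT LE] \<open>S = {p, q}\<close> by blast
  next
    assume "card S = 3"
    then have "S = K"
      using card_subset_eq[OF fin(2) SK] card by simp
    then show ?thesis
      using jump_face[OF W(3) D T F LT] LE K(2) by simp
  qed
qed

text \<open>
The form for the prescribed normal is a polynomial on the facet that vanishes at its Lagrange points.
Any other normal is a multiple of the prescribed one.
\<close>

lemma jump_facet:
  assumes grid: "conforming_grid \<Omega> \<T>" and D: "admissible_vectors \<T> D" and k: "1 \<le> k"
    and W: "vertex_conditions \<T> W" "edge_conditions \<T> D k W" "face_conditions \<T> D k W"
    and poly: "\<And>T. T \<in> \<T> \<Longrightarrow> W T \<in> matrix_polynomials k"
    and T: "T \<in> \<T>" "T' \<in> \<T>" and F: "F facet_of T" "F facet_of T'"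
    and x: "x \<in> F" and \<nu>: "normal_to F \<nu>"
  shows "jump_form (W T x - W T' x) \<nu> c d = 0"
proof -
  note gridD = conforming_gridD[OF grid]
  note C = simplex_3D(1)[OF gridD(2)[OF T(1)]]
  define n where "n = face_normal D F"
  obtain w where w: "w \<in> vertices T" "F = opposite_facet T w"
    using F(1) facet_of_simplex_3[OF gridD(2)[OF T(1)]] by blast
  then have K: "vertices F = vertices T - {w}" "F = convex hull (vertices F)"
    using vertices_opposite_facet[OF gridD(2)[OF T(1)], of w] by simp_all
  have card: "card (vertices F) = 3"
    using C K(1) w(1) by (auto simp: tetra_vertices_def)
  have zero: "jump_form (W T x - W T' x) n c d = 0"
    by (rule triangle_lagrange_unisolvent[OF scalar_polynomial_functional[OF poly[OF T(1)] poly[OF T(2)]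
            linear_jump_form_matrix] k card])
       (use jump_lagrange_point[OF grid D k W T F] x K(2) in \<open>auto simp: n_def\<close>)
  obtain a where a: "a \<in> vertices T - {w}"
    using card K(1) by (metis card.empty ex_in_conv zero_neq_numeral)
  have "norm n = 1" "normal_to F n"
    using D T(1) F(1) by (auto simp: admissible_vectors_def Let_def n_def normal_to_def)
  define G where "G = bary_grad (vertices T) w"
  have multiple: "\<mu> = (\<mu> \<bullet> (w - a)) *\<^sub>R G" if "normal_to F \<mu>" for \<mu>
    using facet_normal_multiple[OF C w(1) _ a, of \<mu>] that w(2) by (simp add: G_def)
  define r where "r = n \<bullet> (w - a)"
  have n: "n = r *\<^sub>R G"
    using multiple[OF \<open>normal_to F n\<close>] by (simp add: r_def)
  then have "r \<noteq> 0"
    using \<open>norm n = 1\<close> by auto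
  then have "\<nu> = ((\<nu> \<bullet> (w - a)) / r) *\<^sub>R n"
    using multiple[OF \<nu>] n by simp
  then obtain s where "\<nu> = s *\<^sub>R n"
    by blast
  then show ?thesis
    using zero by (simp add: linear_scale[OF linear_jump_form_normal])
qed

section \<open>Weak derivatives of piecewise polynomials\<close>

lemma test_function_C1:
  assumes "\<phi> \<in> test_functions \<Omega>"
  shows "has_C1_derivative \<phi> (\<lambda>x v. \<Sum>j\<in>UNIV. v $ j * pderivative j \<phi> x)"
  unfolding has_C1_derivative_def
proof (intro conjI allI)
  have "C_times (Suc 0) \<phi>"
    using assms by (simp add: test_functions_def del: C_times.simps)
  then have diff: "\<And>x. \<phi> differentiable (at x)" and cont: "\<And>j. continuous_on UNIV (pderivative j \<phi>)"
    by auto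
  show "continuous_on UNIV (\<lambda>x. \<Sum>j\<in>UNIV. v $ j * pderivative j \<phi> x)" for v :: "real^3"
    by (intro continuous_intros cont)
  fix x
  have D: "(\<phi> has_derivative frechet_derivative \<phi> (at x)) (at x)"
    using diff frechet_derivative_works by blast
  then have lin: "linear (frechet_derivative \<phi> (at x))"
    by (rule has_derivative_linear)
  have "frechet_derivative \<phi> (at x) v = (\<Sum>j\<in>UNIV. v $ j * pderivative j \<phi> x)" for v
    using arg_cong[OF basis_expansion[of v], of "frechet_derivative \<phi> (at x)"]
    by (simp add: linear_sum[OF lin] linear_scale[OF lin] pderivative_def scalar_mult_eq_scaleR)
  then have "frechet_derivative \<phi> (at x) = (\<lambda>v. \<Sum>j\<in>UNIV. v $ j * pderivative j \<phi> x)"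
    by auto
  then show "(\<phi> has_derivative (\<lambda>v. \<Sum>j\<in>UNIV. v $ j * pderivative j \<phi> x)) (at x)"
    using D by simp
qed

lemma test_functionD:
  assumes "\<phi> \<in> test_functions \<Omega>"
  shows "continuous_on S \<phi>" "x \<notin> \<Omega> \<Longrightarrow> \<phi> x = 0" "\<exists>M. \<forall>x. \<bar>\<phi> x\<bar> \<le> M"
    "pderivative j \<phi> \<in> test_functions \<Omega>"
proof -
  define K where "K = closure {x. \<phi> x \<noteq> 0}"
  have K: "compact K" "K \<subseteq> \<Omega>" and outside: "\<And>x. x \<notin> K \<Longrightarrow> \<phi> x = 0"
    using assms closure_subset[of "{x. \<phi> x \<noteq> 0}"] by (auto simp: test_functions_def K_def)
  show cont: "continuous_on S \<phi>" for S
    using has_C1_derivativeD(3)[OF test_function_C1[OF assms]] .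
  show "x \<notin> \<Omega> \<Longrightarrow> \<phi> x = 0"
    using K outside by blast
  have "bounded (\<phi> ` K)"
    by (intro compact_imp_bounded compact_continuous_image cont K)
  then obtain M where M: "\<forall>x\<in>K. \<bar>\<phi> x\<bar> \<le> M"
    unfolding bounded_iff by auto
  then have "\<bar>\<phi> x\<bar> \<le> max 0 M" for x
    using outside[of x] by (cases "x \<in> K") auto
  then show "\<exists>M. \<forall>x. \<bar>\<phi> x\<bar> \<le> M"
    by blast
  have zero: "pderivative j \<phi> x = 0" if "x \<notin> K" for x
  proof -
    have "((\<lambda>x. 0 :: real) has_derivative (\<lambda>_. 0)) (at x)"
      by simp
    then have "(\<phi> has_derivative (\<lambda>_. 0)) (at x)"
      by (rule has_derivative_transform_within_open[OF _ open_Compl[OF compact_imp_closed[OF K(1)]]])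
         (use that outside in auto)
    then have "frechet_derivative \<phi> (at x) = (\<lambda>_. 0)"
      using frechet_derivative_at by metis
    then show ?thesis
      by (simp add: pderivative_def)
  qed
  have "closed K"
    by (simp add: K_def)
  then have sub: "closure {x. pderivative j \<phi> x \<noteq> 0} \<subseteq> K"
    using zero by (intro closure_minimal) auto
  moreover have "C_times m (pderivative j \<phi>)" for m
  proof -
    have "C_times (Suc m) \<phi>"
      using assms by (simp add: test_functions_def del: C_times.simps)
    then show ?thesis
      by simp
  qed
  moreover have "compact (closure {x. pderivative j \<phi> x \<noteq> 0})"
    using sub K(1) by (metis closed_closure compact_Int_closed inf.absorb_iff2)
  ultimately show "pderivative j \<phi> \<in> test_functions \<Omega>"
    using K(2) by (auto simp: test_functions_def)
qed

lemma continuous_imp_lebesgue_measurable: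
  fixes f :: "real^3 \<Rightarrow> 'b::euclidean_space"
  assumes "continuous_on UNIV f"
  shows "f \<in> borel_measurable lebesgue"
  using borel_measurable_continuous_onI[OF assms] by (simp add: measurable_completion)

lemma lebesgue_integral_lborel:
  fixes f :: "real^3 \<Rightarrow> real"
  assumes "f \<in> borel_measurable borel"
  shows "integrable lebesgue f \<longleftrightarrow> integrable lborel f" "(\<integral>x. f x \<partial>lebesgue) = (\<integral>x. f x \<partial>lborel)"
  using assms by (simp_all add: integrable_completion integral_completion)

text \<open>
Almost every point of a tetrahedron is interior, because each facet lies in a plane, and distinct
tetrahedra have no common interior point.
\<close>

lemma grid_AE_unique:
  assumes grid: "conforming_grid \<Omega> \<T>"
  shows "AE x in lebesgue. \<forall>T\<in>\<T>. \<forall>T'\<in>\<T>. x \<in> T \<longrightarrow> x \<in> T' \<longrightarrow> T = T'"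
proof -
  note gridD = conforming_gridD[OF grid]
  have "AE x in lebesgue. \<forall>T\<in>\<T>. \<forall>v\<in>vertices T. bary (vertices T) v x \<noteq> 0"
    by (intro AE_finite_allI gridD AE_completion AE_bary_nonzero simplex_3D)
  then show ?thesis
  proof eventually_elim
    case (elim x)
    have int: "x \<in> interior T" if "T \<in> \<T>" "x \<in> T" for T
    proof -
      note C = simplex_3D[OF gridD(2)[OF that(1)]]
      have "\<forall>v\<in>vertices T. 0 < bary (vertices T) v x"
        using elim that tetra_iff_bary[OF C(1), of x] unfolding C(2) by force
      then show ?thesis
        using interior_tetra[OF C(1)] unfolding C(2) by blast
    qed
    show ?case
    proof (intro ballI impI)
      fix T T' assume T: "T \<in> \<T>" "T' \<in> \<T>" "x \<in> T" "x \<in> T'"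
      have "T \<inter> T' = T" "T \<inter> T' = T'"
        using face_of_disjoint_interior[OF gridD(4)[OF T(1,2)]] face_of_disjoint_interior[OF gridD(4)[OF T(2,1)]]
          int[OF T(1,3)] int[OF T(2,4)] T by (auto simp: Int_commute)
      then show "T = T'"
        by simp
    qed
  qed
qed

lemma grid_integral:
  fixes f :: "real^3 \<Rightarrow> real" and fT :: "(real^3) set \<Rightarrow> real^3 \<Rightarrow> real"
  assumes grid: "conforming_grid \<Omega> \<T>"
    and f: "set_borel_measurable lebesgue \<Omega> f"
    and cont: "\<And>T. T \<in> \<T> \<Longrightarrow> continuous_on UNIV (fT T)"
    and eq: "AE x in lebesgue. \<forall>T\<in>\<T>. x \<in> T \<inter> \<Omega> \<longrightarrow> f x = fT T x"
    and zero: "\<And>T x. T \<in> \<T> \<Longrightarrow> x \<notin> \<Omega> \<Longrightarrow> fT T x = 0"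
  shows "(LINT x:\<Omega>|lebesgue. f x) = (\<Sum>T\<in>\<T>. \<integral>x. indicator T x * fT T x \<partial>lborel)"
proof -
  note gridD = conforming_gridD[OF grid]
  have int: "integrable lborel (\<lambda>x. indicator T x * fT T x)"
    and meas: "(\<lambda>x. indicator T x * fT T x) \<in> borel_measurable borel" if "T \<in> \<T>" for T
  proof -
    have "compact T"
      using compact_simplex gridD(2) that by blast
    then show "integrable lborel (\<lambda>x. indicator T x * fT T x)"
      using borel_integrable_compact[OF _ continuous_on_subset[OF cont[OF that]]] by simp
    then show "(\<lambda>x. indicator T x * fT T x) \<in> borel_measurable borel"
      by auto
  qed
  have "(LINT x:\<Omega>|lebesgue. f x) = (\<integral>x. (\<Sum>T\<in>\<T>. indicator T x * fT T x) \<partial>lebesgue)"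
    unfolding set_lebesgue_integral_def
  proof (rule integral_cong_AE)
    show "(\<lambda>x. indicator \<Omega> x *\<^sub>R f x) \<in> borel_measurable lebesgue"
      using f by (simp add: set_borel_measurable_def)
    show "(\<lambda>x. \<Sum>T\<in>\<T>. indicator T x * fT T x) \<in> borel_measurable lebesgue"
      using meas by (intro borel_measurable_sum) (simp add: measurable_completion)
    show "AE x in lebesgue. indicator \<Omega> x *\<^sub>R f x = (\<Sum>T\<in>\<T>. indicator T x * fT T x)"
      using eq grid_AE_unique[OF grid]
    proof eventually_elim
      case (elim x)
      show ?case
      proof (cases "x \<in> \<Omega>")
        case True
        then obtain T where T: "T \<in> \<T>" "x \<in> T"
          using gridD(3) interior_subset by blast
        have "(\<Sum>T\<in>\<T>. indicator T x * fT T x) = (\<Sum>S\<in>\<T>. if S = T then fT T x else 0)"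
          using elim(2) T by (intro sum.cong) (auto simp: indicator_def)
        then show ?thesis
          using True T gridD(1) elim(1) by simp
      qed (simp add: zero)
    qed
  qed
  also have "\<dots> = (\<Sum>T\<in>\<T>. \<integral>x. indicator T x * fT T x \<partial>lebesgue)"
    using int meas by (intro Bochner_Integration.integral_sum) (simp add: lebesgue_integral_lborel)
  also have "\<dots> = (\<Sum>T\<in>\<T>. \<integral>x. indicator T x * fT T x \<partial>lborel)"
    using meas by (intro sum.cong) (simp_all add: lebesgue_integral_lborel)
  finally show ?thesis .
qed

lemma open_bounded_integrable:
  fixes \<Omega> :: "(real^3) set"
  assumes "open \<Omega>" "bounded \<Omega>"
  shows "\<Omega> \<in> sets lebesgue" "integrable lebesgue (\<lambda>x. B * indicator \<Omega> x :: real)"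
proof -
  show "\<Omega> \<in> sets lebesgue"
    using assms(1) by (simp add: borel_open)
  then have "integrable lebesgue (indicator \<Omega> :: _ \<Rightarrow> real)"
    using emeasure_bounded_finite[OF assms(2)] assms(1)
    by (simp add: integrable_indicator_iff emeasure_completion borel_open)
  then show "integrable lebesgue (\<lambda>x. B * indicator \<Omega> x :: real)"
    by simp
qed

lemma bounded_in_Lp:
  assumes \<Omega>: "open \<Omega>" "bounded \<Omega>" and p: "0 \<le> p"
    and P: "set_borel_measurable lebesgue \<Omega> P"
    and bound: "AE x in lebesgue. x \<in> \<Omega> \<longrightarrow> norm (P x) \<le> B"
  shows "P \<in> Lp \<Omega> p"
proof -
  have eq: "indicator \<Omega> x *\<^sub>R norm (P x) powr p = norm (indicator \<Omega> x *\<^sub>R P x) powr p * indicator \<Omega> x" for x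
    by (simp add: indicator_def)
  have [measurable]: "(\<lambda>x. indicator \<Omega> x *\<^sub>R P x) \<in> borel_measurable lebesgue" "\<Omega> \<in> sets lebesgue"
    using P open_bounded_integrable[OF \<Omega>] by (simp_all add: set_borel_measurable_def)
  have "set_integrable lebesgue \<Omega> (\<lambda>x. norm (P x) powr p)"
    unfolding set_integrable_def
  proof (rule Bochner_Integration.integrable_bound[OF open_bounded_integrable(2)[OF \<Omega>, of "B powr p"]])
    show "(\<lambda>x. indicator \<Omega> x *\<^sub>R norm (P x) powr p) \<in> borel_measurable lebesgue"
      unfolding eq by measurable
    show "AE x in lebesgue. norm (indicator \<Omega> x *\<^sub>R norm (P x) powr p) \<le> norm (B powr p * indicator \<Omega> x)"
      using bound by eventually_elim (auto simp: indicator_def intro: powr_mono2 p)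
  qed
  then show ?thesis
    using P by (simp add: Lp_def)
qed

text \<open>
For \<open>p \<ge> 1\<close> the norm is at most \<open>1 + norm (P x) powr p\<close>, which is integrable on a bounded set.
\<close>

lemma Lp_times_test_function_integrable:
  assumes \<Omega>: "open \<Omega>" "bounded \<Omega>" and p: "1 \<le> p" and P: "P \<in> Lp \<Omega> p"
    and \<phi>: "\<phi> \<in> test_functions \<Omega>"
  shows "set_integrable lebesgue \<Omega> (\<lambda>x. \<phi> x *\<^sub>R P x)"
proof -
  obtain M where M: "\<And>x. \<bar>\<phi> x\<bar> \<le> M"
    using test_functionD(3)[OF \<phi>] by blast
  have [measurable]: "(\<lambda>x. indicator \<Omega> x *\<^sub>R P x) \<in> borel_measurable lebesgue" "\<phi> \<in> borel_measurable lebesgue"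
    using P continuous_imp_lebesgue_measurable[OF test_functionD(1)[OF \<phi>]]
    by (simp_all add: Lp_def set_borel_measurable_def)
  have "integrable lebesgue (\<lambda>x. M * (1 * indicator \<Omega> x + indicator \<Omega> x *\<^sub>R norm (P x) powr p))"
    using P open_bounded_integrable(2)[OF \<Omega>, of 1] 
    by (intro integrable_mult_right Bochner_Integration.integrable_add) (simp_all add: Lp_def set_integrable_def)
  then show ?thesis
    unfolding set_integrable_def
  proof (rule Bochner_Integration.integrable_bound)
    have "(\<lambda>x. indicator \<Omega> x *\<^sub>R \<phi> x *\<^sub>R P x) = (\<lambda>x. \<phi> x *\<^sub>R (indicator \<Omega> x *\<^sub>R P x))"
      by (simp add: mult.commute)
    also have "\<dots> \<in> borel_measurable lebesgue"
      by measurable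
    finally show "(\<lambda>x. indicator \<Omega> x *\<^sub>R \<phi> x *\<^sub>R P x) \<in> borel_measurable lebesgue" .
    have "norm (indicator \<Omega> x *\<^sub>R \<phi> x *\<^sub>R P x) \<le>
        norm (M * (1 * indicator \<Omega> x + indicator \<Omega> x *\<^sub>R norm (P x) powr p))" for x
    proof -
      have "norm (P x) \<le> 1 + norm (P x) powr p"
      proof (cases "norm (P x) \<le> 1")
        case False
        then have "norm (P x) powr 1 \<le> norm (P x) powr p"
          using p by (intro powr_mono) auto
        then show ?thesis
          using False by simp
      qed (smt (verit) powr_ge_zero)
      then have "\<bar>\<phi> x\<bar> * norm (P x) \<le> M * (1 + norm (P x) powr p)"
        using M[of x] by (intro mult_mono) auto
      moreover have "0 \<le> M"
        using M[of x] by simp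
      ultimately show ?thesis
        by (auto simp: indicator_def abs_mult)
    qed
    then show "AE x in lebesgue. norm (indicator \<Omega> x *\<^sub>R \<phi> x *\<^sub>R P x) \<le>
        norm (M * (1 * indicator \<Omega> x + indicator \<Omega> x *\<^sub>R norm (P x) powr p))"
      by simp
  qed
qed

lemma regular_distr_linear:
  fixes l :: "real^3^3 \<Rightarrow> 'b::euclidean_space"
  assumes \<Omega>: "open \<Omega>" "bounded \<Omega>" and p: "1 \<le> p" and P: "P \<in> Lp \<Omega> p"
    and \<phi>: "\<phi> \<in> test_functions \<Omega>" and l: "linear l"
  shows "l (regular_distr \<Omega> P \<phi>) = (LINT x:\<Omega>|lebesgue. \<phi> x *\<^sub>R l (P x))"
proof -
  have "bounded_linear l"
    using l by (simp add: linear_conv_bounded_linear)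
  from integral_bounded_linear[OF this Lp_times_test_function_integrable[OF \<Omega> p P \<phi>, unfolded set_integrable_def]]
  show ?thesis
    by (simp add: regular_distr_def set_lebesgue_integral_def linear_scale[OF l])
qed

lemma linear_dev_part: "linear dev_part"
  by (auto intro!: linearI simp: dev_part_def trace_def sum.distrib vec_eq_iff mat_def algebra_simps
      simp flip: sum_distrib_left)

lemma dev_part_in_Lp:
  assumes "P \<in> Lp \<Omega> p" "0 \<le> p"
  shows "(\<lambda>x. dev_part (P x)) \<in> Lp \<Omega> p"
proof -
  have lin: "bounded_linear dev_part"
    using linear_dev_part by (simp add: linear_conv_bounded_linear)
  then obtain K where K: "0 \<le> K" "\<And>A. norm (dev_part A) \<le> norm A * K"
    using bounded_linear.nonneg_bounded by blast
  have dev_ind: "indicator \<Omega> x *\<^sub>R dev_part (P x) = dev_part (indicator \<Omega> x *\<^sub>R P x)" for x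
    by (simp add: linear_scale[OF linear_dev_part])
  have [measurable]: "(\<lambda>x. indicator \<Omega> x *\<^sub>R P x) \<in> borel_measurable lebesgue"
    using assms by (simp add: Lp_def set_borel_measurable_def)
  have "dev_part \<in> borel_measurable borel"
    using lin by (intro borel_measurable_continuous_onI linear_continuous_on)
  then have meas[measurable]: "(\<lambda>x. indicator \<Omega> x *\<^sub>R dev_part (P x)) \<in> borel_measurable lebesgue"
    unfolding dev_ind by measurable
  have "set_integrable lebesgue \<Omega> (\<lambda>x. norm (dev_part (P x)) powr p)"
    unfolding set_integrable_def
  proof (rule Bochner_Integration.integrable_bound)
    show "integrable lebesgue (\<lambda>x. K powr p * (indicator \<Omega> x *\<^sub>R norm (P x) powr p))"
      using assms by (intro integrable_mult_right) (simp_all add: Lp_def set_integrable_def)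
    have eq: "indicator \<Omega> x *\<^sub>R norm (dev_part (P x)) powr p =
        (if norm (indicator \<Omega> x *\<^sub>R P x) = 0 then indicator \<Omega> x *\<^sub>R norm (P x) powr p
         else norm (indicator \<Omega> x *\<^sub>R dev_part (P x)) powr p)" for x
      by (auto simp: indicator_def linear_0[OF linear_dev_part])
    have [measurable]: "(\<lambda>x. indicator \<Omega> x *\<^sub>R norm (P x) powr p) \<in> borel_measurable lebesgue"
      using assms by (intro borel_measurable_integrable) (simp add: Lp_def set_integrable_def)
    show "(\<lambda>x. indicator \<Omega> x *\<^sub>R norm (dev_part (P x)) powr p) \<in> borel_measurable lebesgue"
      unfolding eq by measurable
    have "norm (dev_part (P x)) powr p \<le> K powr p * norm (P x) powr p" for x
      using K powr_mono2[OF assms(2) norm_ge_zero K(2)[of "P x"]] by (simp add: powr_mult mult.commute)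
    then show "AE x in lebesgue. norm (indicator \<Omega> x *\<^sub>R norm (dev_part (P x)) powr p) \<le>
        norm (K powr p * (indicator \<Omega> x *\<^sub>R norm (P x) powr p))"
      by (auto simp: indicator_def)
  qed
  then show ?thesis
    using meas by (simp add: Lp_def set_borel_measurable_def)
qed

lemma H_symCurl_subset_H_devsymCurl:
  assumes \<Omega>: "open \<Omega>" "bounded \<Omega>" and p: "1 \<le> p"
  shows "H_symCurl \<Omega> p \<subseteq> H_devsymCurl \<Omega> p"
proof
  fix P assume "P \<in> H_symCurl \<Omega> p"
  then obtain Q where P: "P \<in> Lp \<Omega> p" and Q: "Q \<in> Lp \<Omega> p"
    and eq: "\<forall>\<phi>\<in>test_functions \<Omega>. sym_part (distr_Curl (regular_distr \<Omega> P) \<phi>) = regular_distr \<Omega> Q \<phi>"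
    unfolding H_symCurl_def by blast
  have "dev_part (sym_part (distr_Curl (regular_distr \<Omega> P) \<phi>)) = regular_distr \<Omega> (\<lambda>x. dev_part (Q x)) \<phi>"
    if "\<phi> \<in> test_functions \<Omega>" for \<phi>
    using eq that regular_distr_linear[OF \<Omega> p Q that linear_dev_part] by (simp add: regular_distr_def)
  then show "P \<in> H_devsymCurl \<Omega> p"
    using P dev_part_in_Lp[OF Q] p unfolding H_devsymCurl_def by auto
qed

lemma has_C1_derivative_linear:
  fixes l :: "'a::euclidean_space \<Rightarrow> 'b::euclidean_space"
  assumes "linear l" "has_C1_derivative f f'"
  shows "has_C1_derivative (\<lambda>x. l (f x)) (\<lambda>x v. l (f' x v))"
proof -
  have "bounded_linear l"
    using assms(1) by (simp add: linear_conv_bounded_linear)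
  then show ?thesis
    unfolding has_C1_derivative_def
    by (intro conjI allI bounded_linear.has_derivative[of l] bounded_linear.continuous_on[of l]
        has_C1_derivativeD[OF assms(2)])
qed

lemma monomial_C1:
  fixes \<alpha> :: "nat^3"
  shows "\<exists>f'. has_C1_derivative (\<lambda>x :: real^3. \<Prod>i\<in>UNIV. (x $ i) ^ (\<alpha> $ i)) f'"
proof -
  have "\<exists>f'. has_C1_derivative (\<lambda>x :: real^3. (x $ i) ^ n) f'" for i n
  proof (induction n)
    case 0
    have "has_C1_derivative (\<lambda>x :: real^3. 1 :: real) (\<lambda>_ _. 0)"
      by (auto simp: has_C1_derivative_def)
    then show ?case
      by auto
  next
    case (Suc n)
    then obtain f' where "has_C1_derivative (\<lambda>x :: real^3. (x $ i) ^ n) f'"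
      by blast
    moreover have "has_C1_derivative (\<lambda>x :: real^3. x $ i) (\<lambda>_ v. v $ i)"
      by (simp add: has_C1_derivative_def bounded_linear_imp_has_derivative[OF bounded_linear_vec_nth])
    ultimately show ?case
      using has_C1_derivative_mult by fastforce
  qed
  then obtain f' where f': "\<And>i n. has_C1_derivative (\<lambda>x :: real^3. (x $ i) ^ n) (f' i n)"
    by metis
  then show ?thesis
    using has_C1_derivative_mult[OF f'[of 1 "\<alpha> $ 1"] has_C1_derivative_mult[OF f'[of 2 "\<alpha> $ 2"] f'[of 3 "\<alpha> $ 3"]]]
    unfolding UNIV_3 by (intro exI) simp
qed

lemma matrix_polynomial_C1:
  assumes "W \<in> matrix_polynomials k"
  shows "\<exists>W'. has_C1_derivative W W'"
proof -
  obtain c where W: "\<And>x. W x = (\<Sum>\<alpha>\<in>multi_indices k. (\<Prod>i\<in>UNIV. (x $ i) ^ (\<alpha> $ i)) *\<^sub>R c \<alpha>)"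
    using assms unfolding matrix_polynomials_def by blast
  obtain f' where f': "\<And>\<alpha> :: nat^3. has_C1_derivative (\<lambda>x :: real^3. \<Prod>i\<in>UNIV. (x $ i) ^ (\<alpha> $ i)) (f' \<alpha>)"
    using monomial_C1 by metis
  have "has_C1_derivative (\<lambda>x. \<Sum>\<alpha>\<in>multi_indices k. (\<Prod>i\<in>UNIV. (x $ i) ^ (\<alpha> $ i)) *\<^sub>R c \<alpha>)
      (\<lambda>x v. \<Sum>\<alpha>\<in>multi_indices k. f' \<alpha> x v *\<^sub>R c \<alpha>)"
    unfolding has_C1_derivative_def
    by (intro conjI allI has_derivative_sum has_derivative_scaleR_left continuous_intros
        has_C1_derivativeD[OF f'])
  then show ?thesis
    using W by (metis (no_types, lifting) ext)
qed

text \<open>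
The symmetric curl in divergence form: the entries of \<open>sym Curl W\<close> are \<open>- 1 / 2\<close> times the divergences
of \<open>flux (axis a 1) (axis b 1) (W x)\<close>.
\<close>

definition flux :: "real^3 \<Rightarrow> real^3 \<Rightarrow> real^3^3 \<Rightarrow> real^3" where
  "flux c d A = cross3 d (transpose A *v c) + cross3 c (transpose A *v d)"

lemma linear_flux: "linear (flux c d)"
  by (auto intro!: linearI simp: flux_def vec_eq_iff forall_3 cross3_def vector_3 matrix_vector_mult_def
      transpose_def sum_3 algebra_simps)

lemma flux_normal: "n \<bullet> flux c d A = jump_form A n c d"
  by (simp add: flux_def jump_form_def inner_vec_def cross3_def vector_3 matrix_vector_mult_def
      transpose_def sum_3 algebra_simps)

lemma sym_distr_Curl:
  "sym_part (distr_Curl S \<phi>) $ a $ b =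
    (1/2) * (\<Sum>j\<in>UNIV. flux (axis a 1) (axis b 1) (S (pderivative j \<phi>)) $ j)"
proof -
  have "\<forall>a b. sym_part (distr_Curl S \<phi>) $ a $ b =
    (1/2) * (\<Sum>j\<in>UNIV. flux (axis a 1) (axis b 1) (S (pderivative j \<phi>)) $ j)"
    unfolding forall_3
    by (simp add: sym_part_def distr_Curl_def distr_curl_def distr_pderivative_def flux_def cross3_def
        vector_3 matrix_vector_mult_def transpose_def sum_3 axis_def)
  then show ?thesis
    by blast
qed


text \<open>
The representing function \<open>Q\<close> is the piecewise symmetric curl, its entries being \<open>- 1 / 2\<close> times the
divergences of the fields \<open>flux\<close>. For a test function \<open>\<phi>\<close>, the divergence of \<open>\<phi>\<close> times such a field
has two parts, one with a derivative of \<open>\<phi>\<close> and one with \<open>Q\<close>; by the piecewise divergence theorem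
they cancel in total.
\<close>

lemma V_symCurl_subset_H_symCurl:
  assumes \<Omega>: "open \<Omega>" "bounded \<Omega>" and grid: "conforming_grid \<Omega> \<T>"
    and D: "admissible_vectors \<T> D" and k: "1 \<le> k" and p: "1 \<le> p"
  shows "V_symCurl \<Omega> \<T> D k \<subseteq> H_symCurl \<Omega> p"
proof
  fix U assume "U \<in> V_symCurl \<Omega> \<T> D k"
  then obtain W where U: "U \<in> Lp \<Omega> 2"
    and poly: "\<And>T. T \<in> \<T> \<Longrightarrow> W T \<in> matrix_polynomials k"
    and UW: "\<And>T. T \<in> \<T> \<Longrightarrow> AE x in lebesgue. x \<in> T \<inter> \<Omega> \<longrightarrow> U x = W T x"
    and W: "vertex_conditions \<T> W" "edge_conditions \<T> D k W" "face_conditions \<T> D k W"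
    unfolding V_symCurl_def by blast
  note gridD = conforming_gridD[OF grid]
  have UW_AE: "AE x in lebesgue. \<forall>T\<in>\<T>. x \<in> T \<inter> \<Omega> \<longrightarrow> U x = W T x"
    using UW by (intro AE_finite_allI gridD(1))
  have cover: "\<exists>T\<in>\<T>. x \<in> T" if "x \<in> \<Omega>" for x
    using that gridD(3) interior_subset by blast
  have cpt: "compact T" if "T \<in> \<T>" for T
    using compact_simplex gridD(2) that by blast
  have "\<forall>T\<in>\<T>. \<exists>W'. has_C1_derivative (W T) W'"
    using poly matrix_polynomial_C1 by blast
  then obtain W' where W': "\<And>T. T \<in> \<T> \<Longrightarrow> has_C1_derivative (W T) (W' T)"
    by metis
  \<comment> \<open>a uniform bound on a finite family of continuous functions over the grid\<close>
  have grid_bound: "\<exists>B. \<forall>T\<in>\<T>. \<forall>x\<in>T. norm (h T x) \<le> B"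
    if "\<And>T. T \<in> \<T> \<Longrightarrow> continuous_on UNIV (h T)" for h :: "(real^3) set \<Rightarrow> real^3 \<Rightarrow> 'c::real_normed_vector"
  proof -
    have "bounded (\<Union>T\<in>\<T>. h T ` T)"
      using gridD(1) cpt that
      by (intro bounded_UN) (auto intro!: compact_imp_bounded compact_continuous_image intro: continuous_on_subset)
    then show ?thesis
      unfolding bounded_iff by fastforce
  qed
  have U_meas: "set_borel_measurable lebesgue \<Omega> U"
    using U by (simp add: Lp_def)
  have U_p: "U \<in> Lp \<Omega> p"
  proof -
    obtain B where B: "\<forall>T\<in>\<T>. \<forall>x\<in>T. norm (W T x) \<le> B"
      using grid_bound[of W] has_C1_derivativeD(3)[OF W'] by blast
    have "AE x in lebesgue. x \<in> \<Omega> \<longrightarrow> norm (U x) \<le> B"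
      using UW_AE
    proof eventually_elim
      case (elim x)
      then show ?case
        using cover[of x] B by (metis IntI)
    qed
    then show ?thesis
      using p by (intro bounded_in_Lp[OF \<Omega> _ U_meas]) auto
  qed
  define e where "e a = (axis a 1 :: real^3)" for a :: 3
  define dv where "dv T a b = divergence (\<lambda>x v. flux (e a) (e b) (W' T x v))" for T a b
  have flux_C1: "has_C1_derivative (\<lambda>x. flux (e a) (e b) (W T x)) (\<lambda>x v. flux (e a) (e b) (W' T x v))"
    if "T \<in> \<T>" for T a b
    by (rule has_C1_derivative_linear[OF linear_flux W'[OF that]])
  have div_cont: "continuous_on S (dv T a b)" if "T \<in> \<T>" for S T a b
    unfolding dv_def by (rule continuous_divergence[OF flux_C1[OF that]])
  \<comment> \<open>on the null set where tetrahedra meet, \<open>Q\<close> adds up the contributions of all of them\<close>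
  define Q :: "real^3 \<Rightarrow> real^3^3" where
    "Q x = (\<chi> a b. - (1/2) * (\<Sum>T\<in>\<T>. indicator T x * dv T a b x))" for x
  have Q_nth: "Q x $ a $ b = - (1/2) * (\<Sum>T\<in>\<T>. indicator T x * dv T a b x)" for x a b
    by (simp add: Q_def)
  have Q_nth_meas: "(\<lambda>x. Q x $ a $ b) \<in> borel_measurable lebesgue" for a b
  proof -
    have "(\<lambda>x. indicator T x * dv T a b x) \<in> borel_measurable lebesgue" if "T \<in> \<T>" for T
      using fmeasurableD[OF lmeasurable_compact[OF cpt[OF that]]]
        continuous_imp_lebesgue_measurable[OF div_cont[OF that]]
      by (intro borel_measurable_times borel_measurable_indicator)
    from borel_measurable_times[OF borel_measurable_const borel_measurable_sum[OF this]] show ?thesis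
      unfolding Q_nth .
  qed
  have "Q \<in> borel_measurable lebesgue"
    unfolding borel_measurable_euclidean_space[of Q] Basis_vec_def
    using Q_nth_meas by (auto simp: inner_axis)
  then have Q_meas: "set_borel_measurable lebesgue \<Omega> Q"
    using open_bounded_integrable(1)[OF \<Omega>] unfolding set_borel_measurable_def
    by (intro borel_measurable_scaleR borel_measurable_indicator)
  have Q_AE: "AE x in lebesgue. \<forall>T\<in>\<T>. x \<in> T \<longrightarrow> (\<forall>a b. Q x $ a $ b = - (1/2) * dv T a b x)"
    using grid_AE_unique[OF grid]
  proof eventually_elim
    case (elim x)
    have "(\<Sum>S\<in>\<T>. indicator S x * dv S a b x) = (\<Sum>S\<in>\<T>. if S = T then dv T a b x else 0)"
      if "T \<in> \<T>" "x \<in> T" for T a b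
      using elim that by (intro sum.cong) (auto simp: indicator_def)
    then show ?case
      using gridD(1) by (simp add: Q_nth)
  qed
  have Q_p: "Q \<in> Lp \<Omega> p"
  proof -
    obtain B where B: "\<forall>T\<in>\<T>. \<forall>x\<in>T. norm (\<chi> a b. - (1/2) * dv T a b x :: real^3^3) \<le> B"
      using grid_bound[of "\<lambda>T x. \<chi> a b. - (1/2) * dv T a b x :: real^3^3"] div_cont
      by (force intro!: continuous_intros)
    have "AE x in lebesgue. x \<in> \<Omega> \<longrightarrow> norm (Q x) \<le> B"
      using Q_AE
    proof eventually_elim
      case (elim x)
      show ?case
      proof
        assume "x \<in> \<Omega>"
        then obtain T where T: "T \<in> \<T>" "x \<in> T"
          using cover by blast
        then have "Q x = (\<chi> a b. - (1/2) * dv T a b x)"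
          using elim by (simp add: vec_eq_iff)
        then show "norm (Q x) \<le> B"
          using B T by simp
      qed
    qed
    then show ?thesis
      using p by (intro bounded_in_Lp[OF \<Omega> _ Q_meas]) auto
  qed
  have "sym_part (distr_Curl (regular_distr \<Omega> U) \<phi>) $ a $ b = regular_distr \<Omega> Q \<phi> $ a $ b"
    if \<phi>: "\<phi> \<in> test_functions \<Omega>" for \<phi> a b
  proof -
    note \<phi>D = test_functionD[OF \<phi>] and \<phi>j = test_functionD(4)[OF \<phi>]
    define d\<phi> where "d\<phi> x v = (\<Sum>j\<in>UNIV. v $ j * pderivative j \<phi> x)" for x and v :: "real^3"
    define F where "F T x = flux (e a) (e b) (W T x)" for T x
    define F' where "F' T x v = flux (e a) (e b) (W' T x v)" for T x v
    define g' where "g' T x v = d\<phi> x v *\<^sub>R F T x + \<phi> x *\<^sub>R F' T x v" for T x v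
    have F: "has_C1_derivative (F T) (F' T)" if "T \<in> \<T>" for T
      using flux_C1[OF that] by (simp add: F_def[abs_def] F'_def[abs_def])
    have C1: "has_C1_derivative (\<lambda>x. \<phi> x *\<^sub>R F T x) (g' T)" if "T \<in> \<T>" for T
      unfolding has_C1_derivative_def
    proof (intro conjI allI)
      note d = test_function_C1[OF \<phi>, folded d\<phi>_def]
      show "continuous_on UNIV (\<lambda>x. g' T x v)" for v
        unfolding g'_def
        by (intro continuous_intros has_C1_derivativeD[OF d] has_C1_derivativeD[OF F[OF that]])
      show "((\<lambda>x. \<phi> x *\<^sub>R F T x) has_derivative g' T x) (at x)" for x
        using has_derivative_scaleR[OF has_C1_derivativeD(1)[OF d] has_C1_derivativeD(1)[OF F[OF that]], of x UNIV]
        by (simp add: g'_def[abs_def] add.commute)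
    qed
    have div_g: "divergence (g' T) x = (\<Sum>j\<in>UNIV. pderivative j \<phi> x * F T x $ j) + \<phi> x * dv T a b x" for T x
    proof -
      have "d\<phi> x (axis j 1) = pderivative j \<phi> x" for j
        unfolding d\<phi>_def by (simp add: axis_def if_distrib[of "\<lambda>y. y * _"] cong: if_cong)
      then show ?thesis
        by (simp add: divergence_def g'_def dv_def F'_def sum.distrib sum_distrib_left)
    qed
    have total: "(\<Sum>T\<in>\<T>. \<integral>x. indicator T x * divergence (g' T) x \<partial>lborel) = 0"
    proof (rule piecewise_divergence[OF grid C1])
      fix T G \<nu> x assume "T \<in> \<T>" "G facet_of T" "G \<inter> \<Omega> = {}" "normal_to G \<nu>" "x \<in> G"
      then have "x \<notin> \<Omega>"
        by blast
      then show "\<nu> \<bullet> (\<phi> x *\<^sub>R F T x) = 0"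
        by (simp add: \<phi>D)
    next
      fix T T' G \<nu> x
      assume T: "T \<in> \<T>" "T' \<in> \<T>" "G facet_of T" "G facet_of T'" "normal_to G \<nu>" "x \<in> G"
      have "jump_form (W T x - W T' x) \<nu> (e a) (e b) = 0"
        using jump_facet[OF grid D k W poly T(1-4,6,5)] .
      then have "\<nu> \<bullet> F T x = \<nu> \<bullet> F T' x"
        by (simp add: F_def flux_normal linear_diff[OF linear_jump_form_matrix])
      then show "\<nu> \<bullet> (\<phi> x *\<^sub>R F T x) = \<nu> \<bullet> (\<phi> x *\<^sub>R F T' x)"
        by simp
    qed
    have int: "integrable lborel (\<lambda>x. indicator T x * h x)" if "T \<in> \<T>" "continuous_on UNIV h"
      for T and h :: "real^3 \<Rightarrow> real"
      using borel_integrable_compact[OF cpt[OF that(1)] continuous_on_subset[OF that(2)]] by simp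
    have contF: "continuous_on UNIV (\<lambda>x. pderivative j \<phi> x * F T x $ j)" if "T \<in> \<T>" for T j
      by (intro continuous_intros test_functionD(1)[OF \<phi>j] has_C1_derivativeD(3)[OF F[OF that]])
    have cont_div: "continuous_on UNIV (\<lambda>x. \<phi> x * dv T a b x)" if "T \<in> \<T>" for T
      by (intro continuous_intros \<phi>D(1) div_cont that)
    have lhs: "flux (e a) (e b) (regular_distr \<Omega> U (pderivative j \<phi>)) $ j =
        (\<Sum>T\<in>\<T>. \<integral>x. indicator T x * (pderivative j \<phi> x * F T x $ j) \<partial>lborel)" for j
    proof -
      have lin: "linear (\<lambda>A. flux (e a) (e b) A $ j)"
        using linear_flux[of "e a" "e b"] by (auto intro!: linearI simp: linear_add linear_scale)
      have "flux (e a) (e b) (regular_distr \<Omega> U (pderivative j \<phi>)) $ j =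
          (LINT x:\<Omega>|lebesgue. pderivative j \<phi> x *\<^sub>R flux (e a) (e b) (U x) $ j)"
        by (rule regular_distr_linear[OF \<Omega> p U_p \<phi>j lin])
      also have "\<dots> = (\<Sum>T\<in>\<T>. \<integral>x. indicator T x * (pderivative j \<phi> x * F T x $ j) \<partial>lborel)"
      proof (rule grid_integral[OF grid _ contF])
        have "(\<lambda>x. indicator \<Omega> x *\<^sub>R (pderivative j \<phi> x *\<^sub>R flux (e a) (e b) (U x) $ j)) =
            (\<lambda>x. flux (e a) (e b) (indicator \<Omega> x *\<^sub>R pderivative j \<phi> x *\<^sub>R U x) $ j)"
          by (simp add: linear_scale[OF linear_flux] mult.assoc)
        also have "\<dots> \<in> borel_measurable lebesgue"
        proof -
          have "(\<lambda>x. indicator \<Omega> x *\<^sub>R pderivative j \<phi> x *\<^sub>R U x) \<in> borel_measurable lebesgue"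
            using Lp_times_test_function_integrable[OF \<Omega> p U_p \<phi>j] unfolding set_integrable_def by auto
          moreover have "(\<lambda>A. flux (e a) (e b) A $ j) \<in> borel_measurable borel"
            using lin by (intro borel_measurable_continuous_onI linear_continuous_on)
              (simp add: linear_conv_bounded_linear)
          ultimately show ?thesis
            by (rule measurable_compose)
        qed
        finally show "set_borel_measurable lebesgue \<Omega> (\<lambda>x. pderivative j \<phi> x *\<^sub>R flux (e a) (e b) (U x) $ j)"
          by (simp add: set_borel_measurable_def)
        show "AE x in lebesgue. \<forall>T\<in>\<T>. x \<in> T \<inter> \<Omega> \<longrightarrow>
            pderivative j \<phi> x *\<^sub>R flux (e a) (e b) (U x) $ j = pderivative j \<phi> x * F T x $ j"
          using UW_AE by eventually_elim (simp add: F_def)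
        show "pderivative j \<phi> x * F T x $ j = 0" if "x \<notin> \<Omega>" for x T
          using test_functionD(2)[OF \<phi>j that] by simp
      qed
      finally show ?thesis .
    qed
    have lin_nth: "linear (\<lambda>A :: real^3^3. A $ a $ b)"
      by (auto intro!: linearI)
    have "regular_distr \<Omega> Q \<phi> $ a $ b = (LINT x:\<Omega>|lebesgue. \<phi> x *\<^sub>R Q x $ a $ b)"
      by (rule regular_distr_linear[OF \<Omega> p Q_p \<phi> lin_nth])
    also have "\<dots> = (\<Sum>T\<in>\<T>. \<integral>x. indicator T x * (- (1/2) * (\<phi> x * dv T a b x)) \<partial>lborel)"
    proof (rule grid_integral[OF grid])
      have "(\<lambda>x. indicator \<Omega> x *\<^sub>R (\<phi> x *\<^sub>R Q x $ a $ b)) \<in> borel_measurable lebesgue"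
        using Q_nth_meas open_bounded_integrable(1)[OF \<Omega>] continuous_imp_lebesgue_measurable[OF \<phi>D(1)]
        by (intro borel_measurable_scaleR borel_measurable_indicator)
      then show "set_borel_measurable lebesgue \<Omega> (\<lambda>x. \<phi> x *\<^sub>R Q x $ a $ b)"
        by (simp add: set_borel_measurable_def)
      show "continuous_on UNIV (\<lambda>x. - (1/2) * (\<phi> x * dv T a b x))" if "T \<in> \<T>" for T
        by (intro continuous_intros cont_div that)
      show "AE x in lebesgue. \<forall>T\<in>\<T>. x \<in> T \<inter> \<Omega> \<longrightarrow> \<phi> x *\<^sub>R Q x $ a $ b = - (1/2) * (\<phi> x * dv T a b x)"
        using Q_AE by eventually_elim auto
      show "- (1/2) * (\<phi> x * dv T a b x) = 0" if "x \<notin> \<Omega>" for x T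
        using \<phi>D(2)[OF that] by simp
    qed
    also have "\<dots> = - (1/2) * (\<Sum>T\<in>\<T>. \<integral>x. indicator T x * (\<phi> x * dv T a b x) \<partial>lborel)"
      by (simp add: mult.left_commute[of "indicator _ _"] sum_divide_distrib sum_negf)
    also have "(\<Sum>T\<in>\<T>. \<integral>x. indicator T x * (\<phi> x * dv T a b x) \<partial>lborel) =
        - (\<Sum>T\<in>\<T>. \<Sum>j\<in>UNIV. \<integral>x. indicator T x * (pderivative j \<phi> x * F T x $ j) \<partial>lborel)"
    proof -
      have "(\<integral>x. indicator T x * divergence (g' T) x \<partial>lborel) =
          (\<Sum>j\<in>UNIV. \<integral>x. indicator T x * (pderivative j \<phi> x * F T x $ j) \<partial>lborel) +
          (\<integral>x. indicator T x * (\<phi> x * dv T a b x) \<partial>lborel)" if "T \<in> \<T>" for T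
      proof -
        note iA = int[OF that contF[OF that]] and iB = int[OF that cont_div[OF that]]
        have "(\<integral>x. indicator T x * divergence (g' T) x \<partial>lborel) =
            (\<integral>x. (\<Sum>j\<in>UNIV. indicator T x * (pderivative j \<phi> x * F T x $ j)) +
              indicator T x * (\<phi> x * dv T a b x) \<partial>lborel)"
          by (simp only: div_g distrib_left sum_distrib_left)
        also have "\<dots> = (\<integral>x. (\<Sum>j\<in>UNIV. indicator T x * (pderivative j \<phi> x * F T x $ j)) \<partial>lborel) +
            (\<integral>x. indicator T x * (\<phi> x * dv T a b x) \<partial>lborel)"
          by (intro Bochner_Integration.integral_add Bochner_Integration.integrable_sum iA iB)
        also have "(\<integral>x. (\<Sum>j\<in>UNIV. indicator T x * (pderivative j \<phi> x * F T x $ j)) \<partial>lborel) =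
            (\<Sum>j\<in>UNIV. \<integral>x. indicator T x * (pderivative j \<phi> x * F T x $ j) \<partial>lborel)"
          by (intro Bochner_Integration.integral_sum iA)
        finally show ?thesis .
      qed
      then show ?thesis
        using total by (simp add: sum.distrib)
    qed
    also have "- (1/2) * - (\<Sum>T\<in>\<T>. \<Sum>j\<in>UNIV. \<integral>x. indicator T x * (pderivative j \<phi> x * F T x $ j) \<partial>lborel) =
        (1/2) * (\<Sum>j\<in>UNIV. flux (e a) (e b) (regular_distr \<Omega> U (pderivative j \<phi>)) $ j)"
      unfolding lhs by (subst sum.swap) simp
    finally show ?thesis
      by (simp add: sym_distr_Curl e_def)
  qed
  then have "sym_part (distr_Curl (regular_distr \<Omega> U) \<phi>) = regular_distr \<Omega> Q \<phi>"
    if "\<phi> \<in> test_functions \<Omega>" for \<phi>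
    using that by (simp add: vec_eq_iff)
  then show "U \<in> H_symCurl \<Omega> p"
    using U_p Q_p unfolding H_symCurl_def by blast
qed

theorem corollary12:
  fixes \<Omega> :: "(real^3) set" and \<T> :: "(real^3) set set" and D :: grid_vectors
    and k :: nat and p :: real
  assumes "open \<Omega>" and "connected \<Omega>" and "\<Omega> \<noteq> {}" and "bounded \<Omega>"
    and "conforming_grid \<Omega> \<T>"
    and "admissible_vectors \<T> D"
    and "k \<ge> 1" and "p \<ge> 1"
  shows "V_symCurl \<Omega> \<T> D k \<subseteq> H_symCurl \<Omega> p \<and> H_symCurl \<Omega> p \<subseteq> H_devsymCurl \<Omega> p"
  using V_symCurl_subset_H_symCurl[OF assms(1,4-8)] H_symCurl_subset_H_devsymCurl[OF assms(1,4,8)] by blast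

end
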